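(* Let $0\le v\le1/2$, $0<\lambda<1$, and let $\mathcal Q_{\Lambda,s}=\{(w_{i,s},x_i): w_{i,s}\ge0,\ x_i\in\Lambda\}$, $\Lambda=\{x_i\}_{i=1}^{|D|}\subset\mathbb S^d$, be a positive quadrature rule on $\mathbb S^d$ of degree $s\in\mathbb N$. Let $\phi$ be a positive definite function with $\hat\phi_k\sim k^{-2\gamma}$, $\gamma>d/2$. Then $$\|(\mathcal L_\phi+\lambda I)^{-1}(L_{\phi,D,W_s}+\lambda I)\|\le\tilde c\,\big(\lambda^{-1}s^{-\gamma}+\lambda^{-1+v}s^{-(1-v)\gamma}\big)+1$$ and $$\|(L_{\phi,D,W_s}+\lambda I)^{-1}(\mathcal L_\phi+\lambda I)\|\le2\tilde c^2\lambda^{-2+2v}s^{-2(1-v)\gamma}+2\tilde c^2\lambda^{-2}s^{-2\gamma}+\tilde c\lambda^{-1+v}s^{-(1-v)\gamma}+\tilde c\lambda^{-1}s^{-\gamma}+1,$$ where $\tilde c$ is a constant depending only on $\gamma$, $v$ and $d$, and $\|\cdot\|$ is the operator (spectral) norm on $\mathcal N_\phi$.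
   Context: $\mathbb S^d$ is the unit sphere of $\mathbb R^{d+1}$, $d\omega$ its Lebesgue (surface) measure and $\Omega_d$ its volume. $\Pi_s^d$ is the space of spherical polynomials of degree at most $s$ on $\mathbb S^d$, $\mathbb H_k^d$ the space of spherical harmonics of degree $k$, $d_k^d=\dim\mathbb H_k^d$, and $\{Y_{k,\ell}\}_{\ell=1}^{d_k^d}$ an orthonormal basis of $\mathbb H_k^d$ in $L^2(\mathbb S^d)$. $P_k^{d+1}$ is the Legendre polynomial of degree $k$ with $P_k^{d+1}(1)=1$, orthogonal on $[-1,1]$ with weight $(1-t^2)^{(d-2)/2}$, so that $\sum_{\ell}Y_{k,\ell}(x)Y_{k,\ell}(x')=\frac{d_k^d}{\Omega_d}P_k^{d+1}(x\cdot x')$. A function $\phi(t)=\sum_{k=0}^\infty\hat\phi_k\frac{d_k^d}{\Omega_d}P_k^{d+1}(t)$ with all $\hat\phi_k>0$ and $\sum_k\hat\phi_k\frac{d_k^d}{\Omega_d}<\infty$ is called positive definite. Its native space is $\mathcal N_\phi=\{f=\sum_k\sum_{\ell}\hat f_{k,\ell}Y_{k,\ell}:\ \|f\|_\phi^2:=\sum_k\hat\phi_k^{-1}\sum_{\ell}|\hat f_{k,\ell}|^2<\infty\}$, $\hat f_{k,\ell}=\int_{\mathbb S^d}fY_{k,\ell}\,d\omega$, a reproducing kernel Hilbert space with kernel $(x,x')\mapsto\phi(x\cdot x')$; write $\phi_x=\phi(x\cdot\,)$. $\mathcal L_\phi:\mathcal N_\phi\to\mathcal N_\phi$ is the integral operator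 $\mathcal L_\phi f(x)=\int_{\mathbb S^d}\phi(x\cdot x')f(x')\,d\omega(x')=\sum_k\hat\phi_k\sum_\ell\hat f_{k,\ell}Y_{k,\ell}(x)$. The empirical operator is $L_{\phi,D,W_s}f=\sum_{i=1}^{|D|}w_{i,s}f(x_i)\phi_{x_i}$ on $\mathcal N_\phi$. A positive quadrature rule of degree $s$ is a set $\{(w_{i,s},x_i)\}$ with $w_{i,s}\ge0$ and $\int_{\mathbb S^d}P\,d\omega=\sum_{x_i\in\Lambda}w_{i,s}P(x_i)$ for all $P\in\Pi_s^d$. $a\sim b$ means $\hat c_1b\le a\le\hat c_2b$ with absolute constants $\hat c_1,\hat c_2>0$ (here for all $k\ge1$); $\phi$ and these implied constants are regarded as fixed and dependence on them is not tracked. *)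

theory Defs
  imports
    "HOL-Analysis.Analysis"
    "HOL-Library.Function_Algebras"
    "HOL-Computational_Algebra.Polynomial"
begin

text \<open>
  The sphere $S^d$ is \<^term>\<open>sphere (0::'a::euclidean_space) 1\<close> with \<open>DIM('a) = d + 1\<close>.
  Functions on the sphere are functions on \<^typ>\<open>'a\<close>; wherever equality of such functions
  matters (function spaces, ranges of operators) they are normalised to be 0 off the sphere.
\<close>

text \<open>
  Surface (Lebesgue) measure as normalised cone measure: the measure of a Borel set \<open>A\<close> of the
  sphere is \<open>DIM('a)\<close> times the volume of the cone \<open>{t x | 0 < t \<le> 1, x \<in> A}\<close>.
\<close>

definition surface_measure :: "'a::euclidean_space measure" where
  "surface_measure =
     scale_measure (ennreal (real DIM('a)))
       (distr (restrict_space lborel (cball 0 1 - {0})) (restrict_space borel (sphere 0 1)) sgn)"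

definition sphere_volume :: "'a::euclidean_space itself \<Rightarrow> real" where
  "sphere_volume _ = measure surface_measure (sphere (0::'a) 1)"

definition homogeneous_polynomial :: "nat \<Rightarrow> ('a::euclidean_space \<Rightarrow> real) \<Rightarrow> bool" where
  "homogeneous_polynomial k p \<longleftrightarrow>
     real_polynomial_function p \<and> (\<forall>t x. p (t *\<^sub>R x) = t ^ k * p x)"

definition polynomial_degree_le :: "nat \<Rightarrow> ('a::euclidean_space \<Rightarrow> real) \<Rightarrow> bool" where
  "polynomial_degree_le s p \<longleftrightarrow>
     (\<exists>h. (\<forall>k\<le>s. homogeneous_polynomial k (h k)) \<and> (\<forall>x. p x = (\<Sum>k\<le>s. h k x)))"

definition laplacian :: "('a::euclidean_space \<Rightarrow> real) \<Rightarrow> 'a \<Rightarrow> real" where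
  "laplacian f x = (\<Sum>b\<in>Basis. deriv (deriv (\<lambda>t. f (x + t *\<^sub>R b))) 0)"

definition sphere_restrict :: "('a::euclidean_space \<Rightarrow> real) \<Rightarrow> 'a \<Rightarrow> real" where
  "sphere_restrict f = (\<lambda>x. if x \<in> sphere 0 1 then f x else 0)"

definition spherical_polynomials :: "nat \<Rightarrow> ('a::euclidean_space \<Rightarrow> real) set" where
  "spherical_polynomials s = {sphere_restrict p |p. polynomial_degree_le s p}"

definition spherical_harmonics :: "nat \<Rightarrow> ('a::euclidean_space \<Rightarrow> real) set" where
  "spherical_harmonics k =
     {sphere_restrict p |p. homogeneous_polynomial k p \<and> (\<forall>x. laplacian p x = 0)}"

definition harmonic_dim :: "'a::euclidean_space itself \<Rightarrow> nat \<Rightarrow> nat" where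
  "harmonic_dim _ k =
     vector_space.dim (\<lambda>(c::real) f x. c * f x) (spherical_harmonics k :: ('a \<Rightarrow> real) set)"

definition harmonic_orthonormal_basis :: "(nat \<Rightarrow> nat \<Rightarrow> 'a::euclidean_space \<Rightarrow> real) \<Rightarrow> bool" where
  "harmonic_orthonormal_basis Y \<longleftrightarrow>
     (\<forall>k. (\<forall>l\<in>{1..harmonic_dim TYPE('a) k}. Y k l \<in> spherical_harmonics k) \<and>
          (\<forall>l\<in>{1..harmonic_dim TYPE('a) k}. \<forall>m\<in>{1..harmonic_dim TYPE('a) k}.
             (\<integral>x. Y k l x * Y k m x \<partial>surface_measure) = (if l = m then 1 else 0)) \<and>
          (\<forall>f\<in>spherical_harmonics k. \<exists>c. \<forall>x.
             f x = (\<Sum>l=1..harmonic_dim TYPE('a) k. c l * Y k l x)))"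

text \<open>
  \<open>legendre_poly n k\<close> is the Legendre polynomial of degree \<open>k\<close> in dimension \<open>n\<close>, written
  $P_k^n$; with \<open>n = d + 1\<close> the exponent of the weight is \<open>(d - 2) / 2\<close>.
\<close>

definition legendre_poly :: "nat \<Rightarrow> nat \<Rightarrow> real poly" where
  "legendre_poly n k = (THE p. degree p = k \<and> poly p 1 = 1 \<and>
     (\<forall>q. degree q < k \<longrightarrow>
        (LINT t:{-1<..<1}|lborel. poly p t * poly q t * (1 - t\<^sup>2) powr ((real n - 3) / 2)) = 0))"

definition positive_definite_function ::
  "'a::euclidean_space itself \<Rightarrow> (real \<Rightarrow> real) \<Rightarrow> (nat \<Rightarrow> real) \<Rightarrow> bool" where
  "positive_definite_function T \<phi> \<phi>hat \<longleftrightarrow>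
     (\<forall>k. \<phi>hat k > 0) \<and>
     summable (\<lambda>k. \<phi>hat k * (real (harmonic_dim T k) / sphere_volume T)) \<and>
     (\<forall>t\<in>{-1..1}. (\<lambda>k. \<phi>hat k * (real (harmonic_dim T k) / sphere_volume T)
                          * poly (legendre_poly DIM('a) k) t) sums \<phi> t)"

definition harmonic_coeff ::
  "(nat \<Rightarrow> nat \<Rightarrow> 'a::euclidean_space \<Rightarrow> real) \<Rightarrow> ('a \<Rightarrow> real) \<Rightarrow> nat \<Rightarrow> nat \<Rightarrow> real" where
  "harmonic_coeff Y f k l = (\<integral>x. f x * Y k l x \<partial>surface_measure)"

text \<open>
  The expansion of \<open>f\<close> is required pointwise, so members are genuine functions rather than
  classes modulo null sets.
\<close>

definition native_space ::
  "(nat \<Rightarrow> nat \<Rightarrow> 'a::euclidean_space \<Rightarrow> real) \<Rightarrow> (nat \<Rightarrow> real) \<Rightarrow> ('a \<Rightarrow> real) set" where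
  "native_space Y \<phi>hat = {f.
     (\<forall>x. x \<notin> sphere 0 1 \<longrightarrow> f x = 0) \<and>
     (\<forall>x\<in>sphere 0 1.
        (\<lambda>k. \<Sum>l=1..harmonic_dim TYPE('a) k. harmonic_coeff Y f k l * Y k l x) sums f x) \<and>
     summable (\<lambda>k. (\<Sum>l=1..harmonic_dim TYPE('a) k. (harmonic_coeff Y f k l)\<^sup>2) / \<phi>hat k)}"

definition native_norm ::
  "(nat \<Rightarrow> nat \<Rightarrow> 'a::euclidean_space \<Rightarrow> real) \<Rightarrow> (nat \<Rightarrow> real) \<Rightarrow> ('a \<Rightarrow> real) \<Rightarrow> real" where
  "native_norm Y \<phi>hat f =
     sqrt (\<Sum>k. (\<Sum>l=1..harmonic_dim TYPE('a) k. (harmonic_coeff Y f k l)\<^sup>2) / \<phi>hat k)"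

text \<open>
  Operator norm on the native space. It is \<^typ>\<open>ereal\<close>-valued, so that a finite bound excludes
  unbounded operators.
\<close>

definition native_onorm ::
  "(nat \<Rightarrow> nat \<Rightarrow> 'a::euclidean_space \<Rightarrow> real) \<Rightarrow> (nat \<Rightarrow> real)
     \<Rightarrow> (('a \<Rightarrow> real) \<Rightarrow> 'a \<Rightarrow> real) \<Rightarrow> ereal" where
  "native_onorm Y \<phi>hat A =
     (SUP f\<in>native_space Y \<phi>hat. ereal (native_norm Y \<phi>hat (A f) / native_norm Y \<phi>hat f))"

definition integral_op :: "(real \<Rightarrow> real) \<Rightarrow> ('a::euclidean_space \<Rightarrow> real) \<Rightarrow> 'a \<Rightarrow> real" where
  "integral_op \<phi> f = sphere_restrict (\<lambda>x. \<integral>y. \<phi> (x \<bullet> y) * f y \<partial>surface_measure)"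

definition empirical_op ::
  "(real \<Rightarrow> real) \<Rightarrow> nat \<Rightarrow> (nat \<Rightarrow> real) \<Rightarrow> (nat \<Rightarrow> 'a::euclidean_space)
     \<Rightarrow> ('a \<Rightarrow> real) \<Rightarrow> 'a \<Rightarrow> real" where
  "empirical_op \<phi> N w X f = sphere_restrict (\<lambda>x. \<Sum>i=1..N. w i * f (X i) * \<phi> (X i \<bullet> x))"

definition shifted_op ::
  "(('a \<Rightarrow> real) \<Rightarrow> 'a \<Rightarrow> real) \<Rightarrow> real \<Rightarrow> ('a \<Rightarrow> real) \<Rightarrow> 'a \<Rightarrow> real" where
  "shifted_op A \<mu> f = (\<lambda>x. A f x + \<mu> * f x)"

definition positive_quadrature_rule ::
  "nat \<Rightarrow> nat \<Rightarrow> (nat \<Rightarrow> real) \<Rightarrow> (nat \<Rightarrow> 'a::euclidean_space) \<Rightarrow> bool" where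
  "positive_quadrature_rule s N w X \<longleftrightarrow>
     (\<forall>i\<in>{1..N}. w i \<ge> 0 \<and> X i \<in> sphere 0 1) \<and>
     (\<forall>P\<in>spherical_polynomials s. (\<integral>x. P x \<partial>surface_measure) = (\<Sum>i=1..N. w i * P (X i)))"

end

theory Submission
  imports Defs
begin

text \<open>
  Both shifted operators are bounded below by \<open>\<mu>\<close> on the native space, so everything reduces to
  the bound \<open>\<parallel>L - L\<^sub>D\<parallel> \<le> c * s powr (- \<gamma>)\<close> for the integral operator \<open>L\<close> and the empirical
  operator \<open>L\<^sub>D\<close>: both products in the statement then differ from the identity by at most
  \<open>c * s powr (- \<gamma>) / \<mu>\<close>, and the terms involving \<open>v\<close> are only slack. The inner product of
  \<open>(L - L\<^sub>D) f\<close> with \<open>g\<close> is the quadrature error of \<open>f g\<close>. Splitting \<open>f\<close> and \<open>g\<close> at degree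
  \<open>s / 2\<close> makes the low parts cancel, and the high parts are controlled, by duality, by a
  Marcinkiewicz--Zygmund inequality for the weighted nodes.

  That inequality is proved with the nonnegative kernels \<open>((1 + x \<bullet> y) / 2) ^ M\<close>, which behave
  like heat kernels at time \<open>1 / M\<close>. The Gegenbauer equation gives a two-term recurrence in \<open>M\<close>
  for their multipliers, and these, normalised at degree 0, tend to 1 because the kernels
  concentrate. With \<open>M\<close> a small multiple of \<open>s\<^sup>2\<close>, the degrees up to \<open>s / 2\<close> are handled by
  exactness of the rule, and those above are damped exponentially against the kernel for \<open>2 * M\<close>,
  which is itself dominated pointwise by the one for \<open>M\<close>; hence the best constant \<open>K\<close> satisfies
  \<open>K \<le> 1 + K / 2\<close>.

  The addition theorem follows since a harmonic invariant under the reflections fixing a point is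
  determined by its value there. Harmonics of distinct degrees are orthogonal because the integrated
  product of their reproducing kernels is an invariant kernel, hence a multiple of two Legendre
  polynomials of different degrees.
\<close>

text \<open>Nothing is known about the geometry of the nodes; positivity and exactness are the only
  information. The sampled high-degree part of \<open>f\<close> is therefore bounded through the
  adjoint: the energies up to degree \<open>K\<close>, at least \<open>s / 2\<close>, of the point
  measure with densities \<open>c\<close> add up to at most a constant times
  \<open>(K / s) powr d\<close> times the weighted norm of \<open>c\<close>. Summed over dyadic
  blocks against coefficients of order \<open>k powr (-2 * \<gamma>)\<close>, this converges to
  order \<open>s powr (-2 * \<gamma>)\<close> because \<open>2 * \<gamma> > d\<close>.

  The low parts of \<open>f\<close> and \<open>g\<close> are merely bounded, so each low-high
  product is of order \<open>s powr (- \<gamma>)\<close>, the square root of the bound for high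
  parts. These products fix the exponent; all other errors are of order
  \<open>s powr (-2 * \<gamma>)\<close>.

  The scale of \<open>M\<close> balances two demands. The normalised multiplier of degree
  \<open>k\<close> is about \<open>exp (- k^2 / M)\<close>, so \<open>M\<close> must be small
  against \<open>s^2\<close> for the damping above \<open>s / 2\<close> to beat the loss of mass
  between \<open>M\<close> and \<open>2 * M\<close>; and it must be of order \<open>s^2\<close> for
  the comparison with concentration \<open>K^2\<close> to cost only
  \<open>(K / s) powr d\<close>.\<close>

subsection \<open>Surface measure and reflections\<close>

text \<open>The reflection in the hyperplane orthogonal to \<open>v\<close>. For
  \<open>v = 0\<close> the quotient is 0 and the map is the identity, so
  \<open>householder_swap\<close> covers \<open>x = y\<close>. Reflections can replace the
  orthogonal group: they act transitively on the sphere, and those fixing a point act transitively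
  on each sphere of latitude around it.\<close>

definition householder :: "'a::euclidean_space \<Rightarrow> 'a \<Rightarrow> 'a" where
  "householder v x = x - (2 * (x \<bullet> v) / (v \<bullet> v)) *\<^sub>R v"

lemma linear_householder: "linear (householder v)"
  by (rule linearI)
     (auto simp: householder_def inner_left_distrib add_divide_distrib distrib_left algebra_simps)

lemma householder_inner: "householder v x \<bullet> householder v y = x \<bullet> y"
  by (cases "v = 0") (auto simp: householder_def inner_simps inner_commute field_simps)

lemma householder_invol [simp]: "householder v (householder v x) = x"
  by (cases "v = 0") (auto simp: householder_def inner_simps algebra_simps)

lemma norm_householder [simp]: "norm (householder v x) = norm x"
  by (simp add: norm_eq_sqrt_inner householder_inner)

lemma householder_eq_0_iff [simp]: "householder v x = 0 \<longleftrightarrow> x = 0"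
  by (metis norm_householder norm_eq_zero)

lemma householder_fix: "x \<bullet> v = 0 \<Longrightarrow> householder v x = x"
  by (simp add: householder_def)

lemma householder_swap:
  assumes "norm x = norm y"
  shows "householder (x - y) x = y"
proof (cases "x = y")
  case False
  have "x \<bullet> x = y \<bullet> y" using assms by (simp add: norm_eq)
  then have "2 * (x \<bullet> (x - y)) = (x - y) \<bullet> (x - y)"
    by (simp add: inner_simps inner_commute)
  moreover have "(x - y) \<bullet> (x - y) \<noteq> 0" using False by simp
  ultimately show ?thesis by (simp add: householder_def)
qed (simp add: householder_def)

lemma householder_add: "householder v (x + y) = householder v x + householder v y"
  using linear_householder linear_add by blast

lemma householder_diff: "householder v (x - y) = householder v x - householder v y"
  using linear_householder linear_diff by blast

lemma householder_scaleR: "householder v (c *\<^sub>R x) = c *\<^sub>R householder v x"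
  using linear_householder linear_scale by blast

lemma continuous_householder: "continuous_on A (householder v)"
  by (simp add: linear_continuous_on linear_conv_bounded_linear[symmetric] linear_householder)

lemma borel_measurable_householder [measurable]: "householder v \<in> borel_measurable borel"
  by (rule borel_measurable_continuous_onI[OF continuous_householder])

lemma sgn_householder: "sgn (householder v x) = householder v (sgn x)"
  by (simp add: sgn_div_norm householder_scaleR)

lemma nn_integral_lborel_translate:
  fixes g :: "'a::euclidean_space \<Rightarrow> ennreal"
  assumes [measurable]: "g \<in> borel_measurable borel"
  shows "(\<integral>\<^sup>+x. g (c + x) \<partial>lborel) = (\<integral>\<^sup>+x. g x \<partial>lborel)"
proof -
  have "(\<integral>\<^sup>+x. g x \<partial>lborel) = (\<integral>\<^sup>+x. g x \<partial>(distr lborel borel ((+) c)))"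
    by (simp add: lborel_distr_plus)
  also have "\<dots> = (\<integral>\<^sup>+x. g (c + x) \<partial>lborel)"
    by (subst nn_integral_distr) auto
  finally show ?thesis by simp
qed

text \<open>
  Uniqueness of Haar measure, specialised: Lebesgue measure and its image under the reflection are
  both translation invariant, and they agree on the unit ball.
\<close>

lemma nn_integral_lborel_householder:
  fixes g :: "'a::euclidean_space \<Rightarrow> ennreal"
  assumes [measurable]: "g \<in> borel_measurable borel"
  shows "(\<integral>\<^sup>+x. g (householder v x) \<partial>lborel) = (\<integral>\<^sup>+x. g x \<partial>lborel)"
proof -
  define f :: "'a \<Rightarrow> ennreal" where "f = indicator (ball 0 1)"
  define R where "R = householder v"
  have [measurable]: "f \<in> borel_measurable borel" "R \<in> borel_measurable borel"
    by (auto simp: f_def R_def intro!: borel_measurable_indicator)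
  \<comment> \<open>The double integral of \<open>f x * g (x + R y)\<close> is evaluated in two
    ways; translation invariance extracts the integral of \<open>g\<close> composed with
    \<open>R\<close> from one and the integral of \<open>g\<close> from the other.\<close>
  have "(\<integral>\<^sup>+x. f x \<partial>lborel) * (\<integral>\<^sup>+y. g (R y) \<partial>lborel)
      = (\<integral>\<^sup>+x. f x * (\<integral>\<^sup>+y. g (R y) \<partial>lborel) \<partial>lborel)"
    by (rule nn_integral_multc[symmetric]) simp
  also have "\<dots> = (\<integral>\<^sup>+x. f x * (\<integral>\<^sup>+y. g (R (R x + y)) \<partial>lborel) \<partial>lborel)"
    by (simp add: nn_integral_lborel_translate[of "\<lambda>y. g (R y)"])
  also have "\<dots> = (\<integral>\<^sup>+x. (\<integral>\<^sup>+y. f x * g (x + R y) \<partial>lborel) \<partial>lborel)"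
    by (subst nn_integral_cmult[symmetric]) (simp_all add: R_def householder_add)
  also have "\<dots> = (\<integral>\<^sup>+y. (\<integral>\<^sup>+x. f x * g (x + R y) \<partial>lborel) \<partial>lborel)"
    by (rule lborel_pair.Fubini') simp
  also have "\<dots> = (\<integral>\<^sup>+y. (\<integral>\<^sup>+x. f (- R y + x) * g x \<partial>lborel) \<partial>lborel)"
  proof (rule nn_integral_cong)
    fix y
    show "(\<integral>\<^sup>+x. f x * g (x + R y) \<partial>lborel) = (\<integral>\<^sup>+x. f (- R y + x) * g x \<partial>lborel)"
      by (subst nn_integral_lborel_translate[where c = "- R y", symmetric]) simp_all
  qed
  also have "\<dots> = (\<integral>\<^sup>+x. (\<integral>\<^sup>+y. f (- R y + x) * g x \<partial>lborel) \<partial>lborel)"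
    by (rule lborel_pair.Fubini') simp
  also have "\<dots> = (\<integral>\<^sup>+x. (\<integral>\<^sup>+y. f (- R x + y) * g x \<partial>lborel) \<partial>lborel)"
  proof -
    \<comment> \<open>\<open>R\<close> maps \<open>- R y + x\<close> to the negative of
      \<open>- R x + y\<close>, and the unit ball is invariant under \<open>R\<close> and under sign
      change.\<close>
    have "f (- R y + x) = f (- R x + y)" for x y
    proof -
      have "norm (- R y + x) = norm (R (- R y + x))" by (simp add: R_def)
      also have "R (- R y + x) = - (- R x + y)"
        by (simp add: R_def householder_diff)
      finally show ?thesis by (simp add: f_def indicator_def norm_minus_commute)
    qed
    then show ?thesis by simp
  qed
  also have "\<dots> = (\<integral>\<^sup>+x. (\<integral>\<^sup>+y. f (- R x + y) \<partial>lborel) * g x \<partial>lborel)"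
    by (subst nn_integral_multc) simp_all
  also have "\<dots> = (\<integral>\<^sup>+x. f x \<partial>lborel) * (\<integral>\<^sup>+y. g y \<partial>lborel)"
    by (subst nn_integral_lborel_translate) (simp_all add: nn_integral_cmult)
  finally have eq: "(\<integral>\<^sup>+x. f x \<partial>lborel) * (\<integral>\<^sup>+y. g (R y) \<partial>lborel)
      = (\<integral>\<^sup>+x. f x \<partial>lborel) * (\<integral>\<^sup>+y. g y \<partial>lborel)" .
  have f: "(\<integral>\<^sup>+x. f x \<partial>lborel) = emeasure lborel (ball (0::'a) 1)"
    by (simp add: f_def)
  have "emeasure lborel (ball (0::'a) 1) < \<infinity>"
    by (rule emeasure_bounded_finite) simp
  moreover have "emeasure lborel (ball (0::'a) 1) \<noteq> 0"
  proof
    assume "emeasure lborel (ball (0::'a) 1) = 0"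
    then have "ball (0::'a) 1 \<in> null_sets lborel" by auto
    then show False
      by (metis centre_in_ball completion.complete2 empty_iff null_sets_completionI
          open_ball open_not_negligible subset_refl zero_less_one negligible_iff_null_sets)
  qed
  ultimately show ?thesis
    using eq unfolding f by (auto simp: ennreal_mult_cancel_left R_def)
qed

lemma emeasure_lborel_householder:
  assumes [measurable]: "S \<in> sets borel"
  shows "emeasure lborel (householder v -` S) = emeasure lborel (S :: 'a::euclidean_space set)"
proof -
  have "householder v -` S \<in> sets borel"
    using measurable_sets[OF borel_measurable_householder assms] by simp
  then have "emeasure lborel (householder v -` S) = (\<integral>\<^sup>+x. indicator S (householder v x) \<partial>lborel)"
    by (simp add: nn_integral_indicator[symmetric] indicator_def of_bool_def del:
        nn_integral_indicator)
  also have "\<dots> = emeasure lborel S"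
    by (subst nn_integral_lborel_householder) auto
  finally show ?thesis .
qed

section \<open>Cone measure on the sphere\<close>

lemma space_surface_measure [simp]: "space surface_measure = sphere 0 1"
  by (simp add: surface_measure_def space_scale_measure space_restrict_space)

lemma sets_surface_measure [measurable_cong]:
  "sets surface_measure = sets (restrict_space borel (sphere 0 1))"
  by (simp add: surface_measure_def)

lemma sgn_measurable_sphere:
  "sgn \<in> measurable (restrict_space lborel (cball (0::'a::euclidean_space) 1 - {0}))
     (restrict_space borel (sphere 0 1))"
proof (rule measurable_restrict_space2)
  show "sgn \<in> space (restrict_space lborel (cball (0::'a) 1 - {0})) \<rightarrow> sphere 0 1"
    by (auto simp: space_restrict_space norm_sgn)
  have "(\<lambda>x::'a. inverse (norm x) *\<^sub>R x) \<in> borel_measurable borel"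
    by measurable
  then show "sgn \<in> borel_measurable (restrict_space lborel (cball (0::'a) 1 - {0}))"
    by (intro measurable_restrict_space1) (simp add: sgn_div_norm)
qed

lemma emeasure_surface_measure:
  assumes "A \<in> sets (surface_measure :: 'a::euclidean_space measure)"
  shows "emeasure surface_measure A
    = ennreal (real DIM('a)) * emeasure lborel {x \<in> cball 0 1 - {0}. sgn x \<in> A}"
proof -
  let ?M = "restrict_space lborel (cball (0::'a) 1 - {0})"
  have "emeasure surface_measure A = ennreal (real DIM('a)) * emeasure ?M (sgn -` A \<inter> space ?M)"
    using assms unfolding sets_surface_measure
    by (simp add: surface_measure_def emeasure_distr[OF sgn_measurable_sphere])
  also have "emeasure ?M (sgn -` A \<inter> space ?M) = emeasure lborel (sgn -` A \<inter> space ?M)"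
    by (rule emeasure_restrict_space) (auto simp: space_restrict_space)
  also have "sgn -` A \<inter> space ?M = {x \<in> cball 0 1 - {0}. sgn x \<in> A}"
    by (auto simp: space_restrict_space)
  finally show ?thesis .
qed

lemma sets_cone:
  assumes "A \<in> sets (surface_measure :: 'a::euclidean_space measure)"
  shows "{x \<in> cball 0 1 - {0}. sgn x \<in> A} \<in> sets borel"
proof -
  let ?M = "restrict_space lborel (cball (0::'a) 1 - {0})"
  have "sgn -` A \<inter> space ?M \<in> sets ?M"
    using assms unfolding sets_surface_measure by (rule measurable_sets[OF sgn_measurable_sphere])
  moreover have "sgn -` A \<inter> space ?M = {x \<in> cball 0 1 - {0}. sgn x \<in> A}"
    by (auto simp: space_restrict_space)
  ultimately show ?thesis
    by (auto simp: sets_restrict_space)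
qed

lemma finite_surface_measure: "finite_measure (surface_measure :: 'a::euclidean_space measure)"
proof
  have "emeasure (surface_measure :: 'a measure) (sphere 0 1)
      \<le> ennreal (real DIM('a)) * emeasure lborel (cball (0::'a) 1)"
    by (subst emeasure_surface_measure)
       (auto simp: sets_surface_measure sets_restrict_space intro!: mult_left_mono emeasure_mono)
  also have "\<dots> < \<infinity>"
    using emeasure_bounded_finite[of "cball (0::'a) 1"]
    by (simp add: ennreal_mult_less_top)
  finally show "emeasure (surface_measure :: 'a measure) (space surface_measure) \<noteq> \<infinity>"
    by simp
qed

interpretation surface: finite_measure "surface_measure :: 'a::euclidean_space measure"
  by (rule finite_surface_measure)

lemma sphere_volume_pos: "sphere_volume TYPE('a::euclidean_space) > 0"
proof -
  have "emeasure lborel {x \<in> cball 0 1 - {0::'a}. sgn x \<in> sphere 0 1} > 0"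
  proof (rule ccontr)
    have eq: "{x \<in> cball 0 1 - {0::'a}. sgn x \<in> sphere 0 1} = cball 0 1 - {0}"
      by (auto simp: norm_sgn)
    assume "\<not> ?thesis"
    then have "cball 0 1 - {0::'a} \<in> null_sets lborel"
      unfolding eq by (simp add: null_sets_def)
    then have "ball (0::'a) 1 - {0} \<in> null_sets lborel"
      by (rule null_sets_subset) auto
    then have "negligible (ball (0::'a) 1 - {0})"
      by (simp add: negligible_iff_null_sets null_sets_completionI)
    moreover have "open (ball (0::'a) 1 - {0})" by (simp add: open_delete)
    ultimately have "ball (0::'a) 1 - {0} = {}" using open_not_negligible by blast
    moreover obtain b :: 'a where "b \<in> Basis" using nonempty_Basis by blast
    then have "(1/2) *\<^sub>R b \<in> ball (0::'a) 1 - {0}" by (auto simp: nonzero_Basis)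
    ultimately show False by blast
  qed
  then have "emeasure (surface_measure :: 'a measure) (sphere 0 1) > 0"
    by (subst emeasure_surface_measure)
       (auto simp: sets_surface_measure sets_restrict_space ennreal_zero_less_mult_iff)
  then show ?thesis
    unfolding sphere_volume_def by (simp add: surface.emeasure_eq_measure)
qed

lemma householder_measurable_surface [measurable]:
  "householder v \<in> measurable surface_measure surface_measure"
proof -
  have "householder v \<in> measurable (restrict_space borel (sphere 0 1)) (restrict_space borel
      (sphere 0 1))"
    by (rule measurable_restrict_space3) auto
  then show ?thesis
    by (simp add: measurable_cong_sets[OF sets_surface_measure sets_surface_measure])
qed

text \<open>Since \<open>sgn\<close> commutes with reflections, the cone over a reflected set is the
  reflected cone, and invariance is inherited from Lebesgue measure.\<close>

lemma distr_surface_householder: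
  "distr surface_measure surface_measure (householder v)
      = (surface_measure :: 'a::euclidean_space measure)"
proof (rule measure_eqI)
  fix A :: "'a set" assume "A \<in> sets (distr surface_measure surface_measure (householder v))"
  then have A: "A \<in> sets surface_measure" by simp
  let ?B = "householder v -` A \<inter> space surface_measure"
  have B: "?B \<in> sets surface_measure"
    using householder_measurable_surface A by (rule measurable_sets)
  have "{x \<in> cball 0 1 - {0}. sgn x \<in> ?B} = householder v -` {x \<in> cball 0 1 - {0}. sgn x \<in> A}"
    using householder_eq_0_iff[of v] by (auto simp: sgn_householder norm_sgn)
  then show "emeasure (distr surface_measure surface_measure (householder v)) A
      = emeasure surface_measure A"
    using A B emeasure_lborel_householder[OF sets_cone[OF A]]
    by (simp add: emeasure_distr emeasure_surface_measure)
qed simp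

lemma surface_integral_householder:
  fixes f :: "'a::euclidean_space \<Rightarrow> real"
  assumes "f \<in> borel_measurable surface_measure"
  shows "(\<integral>x. f (householder v x) \<partial>surface_measure) = (\<integral>x. f x \<partial>surface_measure)"
  using integral_distr[OF householder_measurable_surface assms, of v]
  by (simp add: distr_surface_householder)

lemma borel_measurable_surface_continuous:
  fixes f :: "'a::euclidean_space \<Rightarrow> real"
  assumes "continuous_on (sphere 0 1) f"
  shows "f \<in> borel_measurable surface_measure"
  using borel_measurable_continuous_on_restrict[OF assms]
  by (simp add: measurable_cong_sets[OF sets_surface_measure refl])

lemma integrable_surface_continuous:
  fixes f :: "'a::euclidean_space \<Rightarrow> real"
  assumes "continuous_on (sphere 0 1) f"
  shows "integrable surface_measure f"
proof -
  have "bounded (f ` sphere 0 1)"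
    by (intro compact_imp_bounded compact_continuous_image assms compact_sphere)
  then obtain B where B: "\<And>x. x \<in> sphere 0 1 \<Longrightarrow> \<bar>f x\<bar> \<le> B"
    unfolding bounded_iff by (metis imageI real_norm_def)
  show ?thesis
    by (rule surface.integrable_const_bound[where B = B])
       (use B in \<open>auto intro!: AE_I2 borel_measurable_surface_continuous assms\<close>)
qed

subsection \<open>Laplacian and spherical harmonics\<close>

text \<open>\<open>G\<close> is the gradient and \<open>A x\<close> the Hessian as a linear map.
  Everything is phrased along lines because \<open>laplacian\<close> iterates \<open>deriv\<close>
  along lines; linearity of \<open>A x\<close> lets the Laplacian be read as a trace.\<close>

lemma real_polynomial_function_second_derivative:
  assumes "real_polynomial_function (f :: 'a::euclidean_space \<Rightarrow> real)"
  shows "\<exists>G A. (\<forall>x. linear (A x))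
    \<and> (\<forall>x b t. ((\<lambda>t. f (x + t *\<^sub>R b)) has_real_derivative G (x + t *\<^sub>R b) \<bullet> b) (at t))
    \<and> (\<forall>x b. ((\<lambda>t. G (x + t *\<^sub>R b) \<bullet> b) has_real_derivative A x b \<bullet> b) (at 0))"
  using assms
proof (induction rule: real_polynomial_function.induct)
  case (linear f)
  then have "linear f" by (simp add: bounded_linear.linear)
  define g where "g = (\<Sum>i\<in>Basis. f i *\<^sub>R i)"
  have f: "f x = g \<bullet> x" for x
    by (subst euclidean_representation[of x, symmetric], subst linear_sum[OF \<open>linear f\<close>])
       (simp add: g_def inner_sum_left inner_sum_right linear_scale[OF \<open>linear f\<close>] inner_commute
       mult.commute)
  have "((\<lambda>t. f (x + t *\<^sub>R b)) has_real_derivative g \<bullet> b) (at t)" for x b t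
    unfolding f inner_add_right inner_scaleR_right by (auto intro!: derivative_eq_intros)
  then show ?case
    by (intro exI[of _ "\<lambda>_. g"] exI[of _ "\<lambda>_ _. 0"]) (auto simp: linear_zero)
next
  case (const c)
  then show ?case
    by (intro exI[of _ "\<lambda>_. 0"] exI[of _ "\<lambda>_ _. 0"]) (auto simp: linear_zero)
next
  case (add f g)
  then obtain G A H B where
    "\<forall>x. linear (A x)" "\<forall>x. linear (B x)"
    "\<forall>x b t. ((\<lambda>t. f (x + t *\<^sub>R b)) has_real_derivative G (x + t *\<^sub>R b) \<bullet> b) (at t)"
    "\<forall>x b. ((\<lambda>t. G (x + t *\<^sub>R b) \<bullet> b) has_real_derivative A x b \<bullet> b) (at 0)"
    "\<forall>x b t. ((\<lambda>t. g (x + t *\<^sub>R b)) has_real_derivative H (x + t *\<^sub>R b) \<bullet> b) (at t)"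
    "\<forall>x b. ((\<lambda>t. H (x + t *\<^sub>R b) \<bullet> b) has_real_derivative B x b \<bullet> b) (at 0)"
    by metis
  then show ?case
    by (intro exI[of _ "\<lambda>x. G x + H x"] exI[of _ "\<lambda>x b. A x b + B x b"])
       (auto simp: inner_add_left intro!: linear_compose_add DERIV_add)
next
  case (mult f g)
  then obtain G A H B where
    lin: "\<And>x. linear (A x)" "\<And>x. linear (B x)" and
    d: "\<And>x b t. ((\<lambda>t. f (x + t *\<^sub>R b)) has_real_derivative G (x + t *\<^sub>R b) \<bullet> b) (at t)"
    "\<And>x b t. ((\<lambda>t. g (x + t *\<^sub>R b)) has_real_derivative H (x + t *\<^sub>R b) \<bullet> b) (at t)" and
    d2: "\<And>x b. ((\<lambda>t. G (x + t *\<^sub>R b) \<bullet> b) has_real_derivative A x b \<bullet> b) (at 0)"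
    "\<And>x b. ((\<lambda>t. H (x + t *\<^sub>R b) \<bullet> b) has_real_derivative B x b \<bullet> b) (at 0)"
    by metis
  define C where "C = (\<lambda>x b. f x *\<^sub>R B x b + g x *\<^sub>R A x b + (G x \<bullet> b) *\<^sub>R H x + (H x \<bullet> b) *\<^sub>R G x)"
  have "linear (C x)" for x
    unfolding C_def using lin[of x]
    by (intro linear_compose_add linear_compose_scale_right)
       (auto intro!: linearI simp: inner_simps algebra_simps)
  moreover have "((\<lambda>t. f (x + t *\<^sub>R b) * g (x + t *\<^sub>R b)) has_real_derivative
      (f (x + t *\<^sub>R b) *\<^sub>R H (x + t *\<^sub>R b) + g (x + t *\<^sub>R b) *\<^sub>R G (x + t *\<^sub>R b)) \<bullet> b) (at t)"
      for x b t
    using DERIV_mult[OF d(1)[of x b t] d(2)[of x b t]] by (simp add: inner_simps algebra_simps)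
  moreover have "((\<lambda>t. (f (x + t *\<^sub>R b) *\<^sub>R H (x + t *\<^sub>R b) + g (x + t *\<^sub>R b) *\<^sub>R G (x + t
      *\<^sub>R b)) \<bullet> b)
      has_real_derivative C x b \<bullet> b) (at 0)" for x b
    using DERIV_add[OF DERIV_mult[OF d(1)[of x b 0] d2(2)[of x b]]
        DERIV_mult[OF d(2)[of x b 0] d2(1)[of x b]]]
    by (simp add: C_def inner_simps algebra_simps)
  ultimately show ?case by (intro exI) auto
qed

lemma second_deriv_eq:
  assumes "\<And>t. ((\<lambda>t. f t) has_real_derivative g t) (at t)" "(g has_real_derivative a) (at 0)"
  shows "deriv (deriv f) 0 = a"
proof -
  have "deriv f = g" using assms(1) DERIV_imp_deriv by blast
  then show ?thesis using assms(2) DERIV_imp_deriv by blast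
qed

lemma laplacian_add:
  assumes "real_polynomial_function f" "real_polynomial_function g"
  shows "laplacian (\<lambda>x. f x + g x) x = laplacian f x + laplacian g x"
proof -
  obtain G A where f: "\<And>x b t. ((\<lambda>t. f (x + t *\<^sub>R b))
      has_real_derivative G (x + t *\<^sub>R b) \<bullet> b) (at t)"
    "\<And>x b. ((\<lambda>t. G (x + t *\<^sub>R b) \<bullet> b) has_real_derivative A x b \<bullet> b) (at 0)"
    using real_polynomial_function_second_derivative[OF assms(1)] by metis
  obtain H B where g: "\<And>x b t. ((\<lambda>t. g (x + t *\<^sub>R b))
      has_real_derivative H (x + t *\<^sub>R b) \<bullet> b) (at t)"
    "\<And>x b. ((\<lambda>t. H (x + t *\<^sub>R b) \<bullet> b) has_real_derivative B x b \<bullet> b) (at 0)"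
    using real_polynomial_function_second_derivative[OF assms(2)] by metis
  show ?thesis
    unfolding laplacian_def
    by (simp add: second_deriv_eq[OF f] second_deriv_eq[OF g]
        second_deriv_eq[OF DERIV_add[OF f(1) g(1)] DERIV_add[OF f(2) g(2)]] sum.distrib)
qed

lemma laplacian_cmult:
  assumes "real_polynomial_function f"
  shows "laplacian (\<lambda>x. c * f x) x = c * laplacian f x"
proof -
  obtain G A where f: "\<And>x b t. ((\<lambda>t. f (x + t *\<^sub>R b))
      has_real_derivative G (x + t *\<^sub>R b) \<bullet> b) (at t)"
    "\<And>x b. ((\<lambda>t. G (x + t *\<^sub>R b) \<bullet> b) has_real_derivative A x b \<bullet> b) (at 0)"
    using real_polynomial_function_second_derivative[OF assms(1)] by metis
  show ?thesis
    unfolding laplacian_def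
    by (simp add: second_deriv_eq[OF f] second_deriv_eq[OF DERIV_cmult[OF f(1)] DERIV_cmult[OF
        f(2)]]
        sum_distrib_left)
qed

lemma laplacian_sum:
  assumes "finite I" "\<And>i. i \<in> I \<Longrightarrow> real_polynomial_function (f i)"
  shows "laplacian (\<lambda>x. \<Sum>i\<in>I. f i x) x = (\<Sum>i\<in>I. laplacian (f i) x)"
  using assms
proof (induction I rule: finite_induct)
  case empty
  then show ?case using laplacian_cmult[of "\<lambda>_. 0" 0 x]
      by (auto simp: real_polynomial_function.intros(2))
next
  case (insert i I)
  then show ?case
    by (simp add: laplacian_add real_polynomial_function_sum)
qed

text \<open>Conjugation by a reflection preserves the trace: the two cross terms contribute
  \<open>- c * (A v \<bullet> v)\<close> each, and \<open>c * (v \<bullet> v) = 2\<close> makes the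
  quadratic term cancel them.\<close>

lemma trace_householder:
  fixes A :: "'a::euclidean_space \<Rightarrow> 'a"
  assumes "linear A"
  shows "(\<Sum>b\<in>Basis. A (householder v b) \<bullet> householder v b) = (\<Sum>b\<in>Basis. A b \<bullet> b)"
proof (cases "v = 0")
  case False
  define c where "c = 2 / (v \<bullet> v)"
  have c: "c * (v \<bullet> v) = 2" using False by (simp add: c_def)
  have h: "householder v b = b - (c * (b \<bullet> v)) *\<^sub>R v" for b
    by (simp add: householder_def c_def)
  have "A (householder v b) \<bullet> householder v b
      = A b \<bullet> b - c * (A ((v \<bullet> b) *\<^sub>R b) \<bullet> v) - c * (A v \<bullet> ((v \<bullet> b) *\<^sub>R b)) + c * c * (A v \<bullet> v) *
      ((v \<bullet> b) * (v \<bullet> b))" for b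
    unfolding h linear_diff[OF assms] linear_scale[OF assms]
    by (simp add: inner_simps inner_commute[of v b] algebra_simps)
  then have "(\<Sum>b\<in>Basis. A (householder v b) \<bullet> householder v b)
      = (\<Sum>b\<in>Basis. A b \<bullet> b) - c * (A (\<Sum>b\<in>Basis. (v \<bullet> b) *\<^sub>R b) \<bullet> v)
        - c * (A v \<bullet> (\<Sum>b\<in>Basis. (v \<bullet> b) *\<^sub>R b)) + c * c * (A v \<bullet> v) * (\<Sum>b\<in>Basis. (v \<bullet> b) * (v \<bullet> b))"
    by (simp add: sum.distrib sum_subtractf linear_sum[OF assms] inner_sum_left inner_sum_right
        sum_distrib_left)
  also have "\<dots> = (\<Sum>b\<in>Basis. A b \<bullet> b) - 2 * c * (A v \<bullet> v) + c * (A v \<bullet> v) * (c * (v \<bullet> v))"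
    by (simp add: euclidean_representation euclidean_inner[symmetric])
  finally show ?thesis by (simp add: c)
qed (simp add: householder_def)

lemma laplacian_householder:
  assumes "real_polynomial_function f"
  shows "laplacian (\<lambda>x. f (householder v x)) x = laplacian f (householder v x)"
proof -
  obtain G A where lin: "\<And>x. linear (A x)" and
    f: "\<And>x b t. ((\<lambda>t. f (x + t *\<^sub>R b)) has_real_derivative G (x + t *\<^sub>R b) \<bullet> b) (at t)"
    "\<And>x b. ((\<lambda>t. G (x + t *\<^sub>R b) \<bullet> b) has_real_derivative A x b \<bullet> b) (at 0)"
    using real_polynomial_function_second_derivative[OF assms(1)] by metis
  show ?thesis
    unfolding laplacian_def
    by (simp add: second_deriv_eq[OF f] householder_add householder_scaleR trace_householder[OF
        lin])
qed

section \<open>Homogeneous polynomials and harmonics under reflection\<close>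

lemma homogeneous_polynomial_cmult:
  "homogeneous_polynomial k p \<Longrightarrow> homogeneous_polynomial k (\<lambda>x. c * p x)"
  by (auto simp: homogeneous_polynomial_def intro: real_polynomial_function.intros)

lemma homogeneous_polynomial_mult:
  "homogeneous_polynomial j p \<Longrightarrow> homogeneous_polynomial k q
      \<Longrightarrow> homogeneous_polynomial (j + k) (\<lambda>x. p x * q x)"
  by (auto simp: homogeneous_polynomial_def power_add intro: real_polynomial_function.intros(4))

lemma homogeneous_polynomial_sum:
  "(\<And>i. i \<in> I \<Longrightarrow> homogeneous_polynomial k (p i)) \<Longrightarrow> finite I
      \<Longrightarrow> homogeneous_polynomial k (\<lambda>x. \<Sum>i\<in>I. p i x)"
  by (auto simp: homogeneous_polynomial_def sum_distrib_left intro: real_polynomial_function_sum)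

lemma homogeneous_polynomial_householder:
  assumes "homogeneous_polynomial k p"
  shows "homogeneous_polynomial k (\<lambda>x. p (householder v x))"
proof -
  have "polynomial_function (householder v)"
    by (rule polynomial_function_bounded_linear)
       (simp add: linear_conv_bounded_linear[symmetric] linear_householder)
  then have "real_polynomial_function (p \<circ> householder v)"
    using assms by (auto simp: homogeneous_polynomial_def)
  then show ?thesis
    using assms unfolding homogeneous_polynomial_def
    by (auto simp: householder_scaleR o_def)
qed

lemma spherical_harmonics_iff:
  "f \<in> spherical_harmonics k \<longleftrightarrow>
     (\<exists>p. homogeneous_polynomial k p \<and> (\<forall>x. laplacian p x = 0) \<and> f = sphere_restrict p)"
  by (auto simp: spherical_harmonics_def)

lemma spherical_harmonics_outside: "f \<in> spherical_harmonics k \<Longrightarrow> x \<notin> sphere 0 1 \<Longrightarrow> f x = 0"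
  by (auto simp: spherical_harmonics_def sphere_restrict_def)

lemma spherical_harmonics_cmult:
  assumes "f \<in> spherical_harmonics k"
  shows "(\<lambda>x. c * f x) \<in> spherical_harmonics k"
proof -
  obtain p where p: "homogeneous_polynomial k p" "\<forall>x. laplacian p x = 0" "f = sphere_restrict p"
    using assms unfolding spherical_harmonics_iff by blast
  show ?thesis unfolding spherical_harmonics_iff
    using p by (intro exI[of _ "\<lambda>x. c * p x"])
      (auto simp: homogeneous_polynomial_cmult laplacian_cmult homogeneous_polynomial_def
      sphere_restrict_def)
qed

lemma spherical_harmonics_sum:
  assumes "\<And>i. i \<in> I \<Longrightarrow> f i \<in> spherical_harmonics k" "finite I"
  shows "(\<lambda>x. \<Sum>i\<in>I. f i x) \<in> spherical_harmonics k"
proof -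
  obtain p where p: "\<And>i. i \<in> I \<Longrightarrow> homogeneous_polynomial k (p i) \<and> (\<forall>x. laplacian (p i) x = 0) \<and> f i
      = sphere_restrict (p i)"
    using assms(1) unfolding spherical_harmonics_iff by metis
  show ?thesis unfolding spherical_harmonics_iff
  proof (intro exI[of _ "\<lambda>x. \<Sum>i\<in>I. p i x"] conjI allI)
    show "homogeneous_polynomial k (\<lambda>x. \<Sum>i\<in>I. p i x)"
      using p assms(2) by (intro homogeneous_polynomial_sum) auto
    show "laplacian (\<lambda>x. \<Sum>i\<in>I. p i x) x = 0" for x
      using p assms(2) by (subst laplacian_sum) (auto simp: homogeneous_polynomial_def)
    show "(\<lambda>x. \<Sum>i\<in>I. f i x) = sphere_restrict (\<lambda>x. \<Sum>i\<in>I. p i x)"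
      using p by (auto simp: sphere_restrict_def fun_eq_iff)
  qed
qed

lemma spherical_harmonics_householder:
  assumes "f \<in> spherical_harmonics k"
  shows "(\<lambda>x. f (householder v x)) \<in> spherical_harmonics k"
proof -
  obtain p where p: "homogeneous_polynomial k p" "\<forall>x. laplacian p x = 0" "f = sphere_restrict p"
    using assms unfolding spherical_harmonics_iff by blast
  show ?thesis unfolding spherical_harmonics_iff
    using p by (intro exI[of _ "\<lambda>x. p (householder v x)"])
      (use p homogeneous_polynomial_householder[OF p(1)] in
        \<open>auto simp: laplacian_householder homogeneous_polynomial_def sphere_restrict_def\<close>)
qed

lemma spherical_harmonics_continuous:
  assumes "f \<in> spherical_harmonics k"
  shows "continuous_on (sphere 0 1) f"
proof -
  obtain p where p: "homogeneous_polynomial k p" "f = sphere_restrict p"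
    using assms unfolding spherical_harmonics_iff by blast
  have "continuous_on (sphere 0 1) p"
    using p(1) by (auto simp: homogeneous_polynomial_def real_polynomial_function_eq
        intro: continuous_on_polymonial_function)
  then show ?thesis
    by (rule continuous_on_eq) (auto simp: p sphere_restrict_def)
qed

text \<open>The form in which exactness of the rule is applied: to products of two
  harmonics.\<close>

lemma spherical_polynomials_harmonic_mult:
  assumes "f \<in> spherical_harmonics j" "g \<in> spherical_harmonics k" "j + k \<le> s"
  shows "(\<lambda>x. f x * g x) \<in> spherical_polynomials s"
proof -
  obtain p q where p: "homogeneous_polynomial j p" "f = sphere_restrict p"
    and q: "homogeneous_polynomial k q" "g = sphere_restrict q"
    using assms unfolding spherical_harmonics_iff by blast
  have "polynomial_degree_le s (\<lambda>x. p x * q x)"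
    unfolding polynomial_degree_le_def
  proof (intro exI[of _ "\<lambda>i x. if i = j + k then p x * q x else 0"] conjI allI impI)
    fix i assume "i \<le> s"
    \<comment> \<open>The zero function is homogeneous of every degree and fills the components
      other than \<open>j + k\<close>.\<close>
    have "homogeneous_polynomial i (\<lambda>x::'a. 0)"
      by (auto simp: homogeneous_polynomial_def real_polynomial_function.intros(2))
    with homogeneous_polynomial_mult[OF p(1) q(1)]
    show "homogeneous_polynomial i (\<lambda>x. if i = j + k then p x * q x else 0)" by (cases "i
        = j + k") auto
  qed (use assms(3) in auto)
  moreover have "(\<lambda>x. f x * g x) = sphere_restrict (\<lambda>x. p x * q x)"
    by (auto simp: p q sphere_restrict_def)
  ultimately show ?thesis by (auto simp: spherical_polynomials_def)
qed

subsection \<open>Zonal harmonics\<close>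

text \<open>Laplace's equation for the sum of \<open>c i * (e \<bullet> y) ^ (k - 2 * i) * (y
  \<bullet> y - (e \<bullet> y)^2) ^ i\<close> forces this recursion. It stops by itself: the factor
  vanishes once \<open>k - 2 * i\<close> is 0 or 1.\<close>

fun zonal_coeff :: "nat \<Rightarrow> nat \<Rightarrow> nat \<Rightarrow> real" where
  "zonal_coeff n k 0 = 1"
| "zonal_coeff n k (Suc i) =
     - (real (k - 2 * i) * (real (k - 2 * i) - 1) / (2 * (real i + 1) * (2 * real i + real n - 1)))
       * zonal_coeff n k i"

definition zonal_poly :: "nat \<Rightarrow> nat \<Rightarrow> real poly" where
  "zonal_poly n k = (\<Sum>i\<le>k div 2. smult (zonal_coeff n k i) (monom 1 (k - 2 * i) * [:1, 0,
      -1:] ^ i))"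

lemma poly_zonal_poly:
  "poly (zonal_poly n k) t = (\<Sum>i\<le>k div 2. zonal_coeff n k i * (t ^ (k - 2 * i) * (1 - t\<^sup>2) ^ i))"
  by (simp add: zonal_poly_def poly_sum poly_monom algebra_simps power2_eq_square)

lemma sum_Basis_inner_sq: "(\<Sum>b\<in>Basis. (e \<bullet> b)\<^sup>2) = (norm (e::'a::euclidean_space))\<^sup>2"
  unfolding power2_norm_eq_inner euclidean_inner[of e e] by (simp add: power2_eq_square)

lemma sum_Basis_inner_mult: "(\<Sum>b\<in>Basis. (x \<bullet> b) * (y \<bullet> b)) = (x::'a::euclidean_space) \<bullet> y"
  by (simp add: euclidean_inner[of x y])

text \<open>Along a line \<open>e \<bullet> y\<close> is affine and the squared distance to the axis
  is quadratic. Its gradient is orthogonal to \<open>e\<close>, so the mixed term drops out of the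
  sum over the basis. The truncated exponents \<open>m - 2\<close> and \<open>i - 1\<close> are
  harmless, since their coefficients vanish there.\<close>

lemma laplacian_zonal_monomial:
  fixes e y :: "'a::euclidean_space"
  assumes e: "norm e = 1"
  shows "laplacian (\<lambda>y. (e \<bullet> y) ^ m * (y \<bullet> y - (e \<bullet> y)\<^sup>2) ^ i) y
    = real m * (real m - 1) * ((e \<bullet> y) ^ (m - 2) * (y \<bullet> y - (e \<bullet> y)\<^sup>2) ^ i)
      + 2 * real i * (2 * real i + real DIM('a) - 3) * ((e \<bullet> y) ^ m * (y \<bullet> y - (e \<bullet> y)\<^sup>2) ^ (i
      - 1))"
proof -
  define A where "A = e \<bullet> y"
  define \<rho> where "\<rho> = y \<bullet> y - A\<^sup>2"
  define \<beta> where "\<beta> b = e \<bullet> b" for b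
  define \<sigma> where "\<sigma> b = y \<bullet> b - A * \<beta> b" for b
  define \<tau> where "\<tau> b = b \<bullet> b - (\<beta> b)\<^sup>2" for b
  define D where "D b = real m * (real m - 1) * (\<beta> b)\<^sup>2 * A ^ (m - 2) * \<rho> ^ i
      + 4 * real m * real i * A ^ (m - 1) * \<rho> ^ (i - 1) * (\<beta> b * \<sigma> b)
      + A ^ m * (4 * real i * (real i - 1) * \<rho> ^ (i - 2) * (\<sigma> b)\<^sup>2 + 2 * real i * \<rho> ^ (i - 1)
      * \<tau> b)" for b
  have b2: "(\<Sum>b\<in>Basis. (\<beta> b)\<^sup>2) = 1"
    by (simp add: \<beta>_def sum_Basis_inner_sq e)
  have yb: "(\<Sum>b\<in>Basis. (y \<bullet> b) * \<beta> b) = A"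
    using sum_Basis_inner_mult[of y e] by (simp add: \<beta>_def A_def inner_commute[of e y])
  have "deriv (deriv (\<lambda>t. (e \<bullet> (y + t *\<^sub>R b)) ^ m * ((y + t *\<^sub>R b) \<bullet> (y + t *\<^sub>R b) - (e \<bullet> (y + t
      *\<^sub>R b))\<^sup>2) ^ i)) 0
      = D b" for b
  proof -
    define r where "r t = \<rho> + 2 * t * \<sigma> b + t\<^sup>2 * \<tau> b" for t
    have r: "(r has_real_derivative 2 * \<sigma> b + 2 * t * \<tau> b) (at t)" for t
      unfolding r_def by (auto intro!: derivative_eq_intros)
    have a: "((\<lambda>t. A + t * \<beta> b) has_real_derivative \<beta> b) (at t)" for t
      by (auto intro!: derivative_eq_intros)
    have q: "((\<lambda>t. 2 * \<sigma> b + 2 * t * \<tau> b) has_real_derivative 2 * \<tau> b) (at t)" for t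
      by (auto intro!: derivative_eq_intros)
    have r0: "r 0 = \<rho>" by (simp add: r_def)
    have p1: "e \<bullet> (y + t *\<^sub>R b) = A + t * \<beta> b" for t
      by (simp add: A_def \<beta>_def inner_add_right)
    have p2: "(y + t *\<^sub>R b) \<bullet> (y + t *\<^sub>R b) = y \<bullet> y + 2 * t * (y \<bullet> b) + t\<^sup>2 * (b \<bullet> b)" for t
      by (simp add: inner_add_left inner_add_right inner_commute power2_eq_square algebra_simps)
    have p3: "(y + t *\<^sub>R b) \<bullet> (y + t *\<^sub>R b) - (e \<bullet> (y + t *\<^sub>R b))\<^sup>2 = r t" for t
      unfolding p1 p2 by (simp add: r_def \<rho>_def \<sigma>_def \<tau>_def power2_eq_square algebra_simps)
    show ?thesis unfolding p3 unfolding p1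
    proof (rule second_deriv_eq)
      fix t
      show "((\<lambda>t. (A + t * \<beta> b) ^ m * r t ^ i) has_real_derivative
          real m * \<beta> b * (A + t * \<beta> b) ^ (m - 1) * r t ^ i
          + (A + t * \<beta> b) ^ m * (real i * r t ^ (i - 1) * (2 * \<sigma> b + 2 * t * \<tau> b))) (at t)"
        by (rule DERIV_cong[OF DERIV_mult[OF DERIV_power[OF a] DERIV_power[OF r]]]) simp
    next
      show "((\<lambda>t. real m * \<beta> b * (A + t * \<beta> b) ^ (m - 1) * r t ^ i
          + (A + t * \<beta> b) ^ m * (real i * r t ^ (i - 1) * (2 * \<sigma> b + 2 * t * \<tau> b)))
          has_real_derivative D b) (at 0)"
        by (rule DERIV_cong[OF DERIV_add[OF DERIV_mult[OF DERIV_cmult[OF DERIV_power[OF a]]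
            DERIV_power[OF r]]
              DERIV_mult[OF DERIV_power[OF a] DERIV_mult[OF DERIV_cmult[OF DERIV_power[OF r]] q]]]])
           (cases m; cases i; simp add: D_def power2_eq_square r0 algebra_simps)
    qed
  qed
  then have "laplacian (\<lambda>y. (e \<bullet> y) ^ m * (y \<bullet> y - (e \<bullet> y)\<^sup>2) ^ i) y = (\<Sum>b\<in>Basis. D b)"
    by (simp add: laplacian_def)
  also have "\<dots> = real m * (real m - 1) * A ^ (m - 2) * \<rho> ^ i * (\<Sum>b\<in>Basis. (\<beta> b)\<^sup>2)
      + 4 * real m * real i * A ^ (m - 1) * \<rho> ^ (i - 1) * (\<Sum>b\<in>Basis. \<beta> b * \<sigma> b)
      + A ^ m * (4 * real i * (real i - 1) * \<rho> ^ (i - 2) * (\<Sum>b\<in>Basis. (\<sigma> b)\<^sup>2)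
          + 2 * real i * \<rho> ^ (i - 1) * (\<Sum>b\<in>Basis. \<tau> b))"
  proof -
    define a1 a2 a3 a4 where "a1 = real m * (real m - 1) * A ^ (m - 2) * \<rho> ^ i"
      and "a2 = 4 * real m * real i * A ^ (m - 1) * \<rho> ^ (i - 1)"
      and "a3 = A ^ m * (4 * real i * (real i - 1) * \<rho> ^ (i - 2))"
      and "a4 = A ^ m * (2 * real i * \<rho> ^ (i - 1))"
    have "D b = a1 * (\<beta> b)\<^sup>2 + a2 * (\<beta> b * \<sigma> b) + (a3 * (\<sigma> b)\<^sup>2 + a4 * \<tau> b)" for b
      by (simp add: D_def a1_def a2_def a3_def a4_def algebra_simps)
    then have "(\<Sum>b\<in>Basis. D b) = a1 * (\<Sum>b\<in>Basis. (\<beta> b)\<^sup>2) + a2 * (\<Sum>b\<in>Basis. \<beta> b * \<sigma> b)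
        + (a3 * (\<Sum>b\<in>Basis. (\<sigma> b)\<^sup>2) + a4 * (\<Sum>b\<in>Basis. \<tau> b))"
      by (simp add: sum.distrib sum_distrib_left)
    then show ?thesis
      by (simp only: a1_def a2_def a3_def a4_def distrib_left mult.assoc)
  qed
  also note b2
  also have "(\<Sum>b\<in>Basis. \<beta> b * \<sigma> b) = 0"
    using b2 yb by (simp add: \<sigma>_def algebra_simps sum_subtractf power2_eq_square flip:
        sum_distrib_left)
  also have "(\<Sum>b\<in>Basis. (\<sigma> b)\<^sup>2) = (\<Sum>b\<in>Basis. (y \<bullet> b)\<^sup>2 - 2 * A * ((y \<bullet> b) * \<beta> b) + A\<^sup>2 * (\<beta> b)\<^sup>2)"
    by (simp add: \<sigma>_def power2_eq_square algebra_simps)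
  also have "\<dots> = \<rho>"
    using sum_Basis_inner_sq[of y] b2 yb
    by (simp add: sum.distrib sum_subtractf \<rho>_def power2_norm_eq_inner power2_eq_square[of A] del:
        dot_square_norm
        flip: sum_distrib_left)
  also have "(\<Sum>b\<in>Basis. \<tau> b) = real DIM('a) - 1"
    using b2 by (simp add: \<tau>_def sum_subtractf)
  also have "4 * real i * (real i - 1) * \<rho> ^ (i - 2) * \<rho> = 4 * real i * (real i - 1) * \<rho> ^ (i - 1)"
  proof (cases "i \<le> 1")
    case True then show ?thesis by (cases i) auto
  next
    case False
    then have "i - 1 = Suc (i - 2)" by simp
    then show ?thesis by simp
  qed
  finally show ?thesis
    by (simp add: A_def \<rho>_def algebra_simps)
qed

lemma zonal_coeff_Suc_eq:
  assumes "n \<ge> 2"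
  shows "zonal_coeff n k (Suc i) * (2 * real (Suc i) * (2 * real (Suc i) + real n - 3))
    = - (real (k - 2 * i) * (real (k - 2 * i) - 1) * zonal_coeff n k i)"
proof -
  define D where "D = 2 * (real i + 1) * (2 * real i + real n - 1)"
  have "2 * real i + real n - 1 \<noteq> 0" "real i + 1 \<noteq> 0" using assms by linarith+
  then have "D \<noteq> 0" by (simp add: D_def)
  moreover have "2 * real (Suc i) * (2 * real (Suc i) + real n - 3) = D"
    by (simp add: D_def algebra_simps)
  moreover have "zonal_coeff n k (Suc i)
      = - (real (k - 2 * i) * (real (k - 2 * i) - 1) / D) * zonal_coeff n k i"
    by (simp only: zonal_coeff.simps D_def)
  ultimately show ?thesis using \<open>D \<noteq> 0\<close> by (simp del: zonal_coeff.simps of_nat_Suc)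
qed

text \<open>
  The common telescoping behind harmonicity (where \<open>F\<close>, \<open>G\<close> come from \<open>laplacian_zonal_monomial\<close>)
  and behind the Gegenbauer differential equation.
\<close>

lemma zonal_coeff_telescope:
  fixes T :: "nat \<Rightarrow> real"
  assumes "n \<ge> 2"
  shows "(\<Sum>i\<le>k div 2. zonal_coeff n k i *
      (real (k - 2 * i) * (real (k - 2 * i) - 1) * T i + 2 * real i * (2 * real i + real n - 3) * T
      (i - 1))) = 0"
proof -
  define u where "u i = zonal_coeff n k i * (real (k - 2 * i) * (real (k - 2 * i) - 1)) * T i" for i
  have "(\<Sum>i\<le>K. zonal_coeff n k i *
      (real (k - 2 * i) * (real (k - 2 * i) - 1) * T i + 2 * real i * (2 * real i + real n - 3) * T
      (i - 1))) = u K" for K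
  proof (induction K)
    case (Suc K)
    have "zonal_coeff n k (Suc K) * (2 * real (Suc K) * (2 * real (Suc K) + real n - 3) * T K)
        = - u K"
      using zonal_coeff_Suc_eq[OF assms, of k K]
          by (simp add: u_def mult.assoc[symmetric] del: zonal_coeff.simps of_nat_Suc)
    then show ?case using Suc
      by (simp add: distrib_left mult.assoc u_def del: zonal_coeff.simps of_nat_Suc)
  qed (simp add: u_def)
  \<comment> \<open>The telescoped sum leaves only its last term, where the remaining exponent is 0
    or 1.\<close>
  moreover have "u (k div 2) = 0"
  proof -
    have "k - 2 * (k div 2) = 0 \<or> k - 2 * (k div 2) = 1" by presburger
    then show ?thesis by (auto simp: u_def)
  qed
  ultimately show ?thesis by (simp only:)
qed

lemma homogeneous_zonal_monomial:
  "homogeneous_polynomial (m + 2 * i) (\<lambda>y::'a::euclidean_space. (e \<bullet> y) ^ m * (y \<bullet> y -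
      (e \<bullet> y)\<^sup>2) ^ i)"
proof -
  have e: "real_polynomial_function (\<lambda>y::'a. e \<bullet> y)" for e :: 'a
    by (intro real_polynomial_function.intros(1) bounded_linear_inner_right)
  have "real_polynomial_function (\<lambda>y::'a. \<Sum>b\<in>Basis. (y \<bullet> b) * (y \<bullet> b))"
    by (intro real_polynomial_function_sum real_polynomial_function.intros(4)
        real_polynomial_function.intros(1) bounded_linear_inner_left) auto
  then have "real_polynomial_function (\<lambda>y::'a. y \<bullet> y)"
    by (simp only: sum_Basis_inner_mult)
  then have "real_polynomial_function (\<lambda>y::'a. (e \<bullet> y) ^ m * (y \<bullet> y - (e \<bullet> y)\<^sup>2) ^ i)"
    using e by (intro real_polynomial_function.intros(4) real_polynomial_function_power
      real_polynomial_function_diff) auto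
  moreover have "(t * t * (y \<bullet> y) - (t * (e \<bullet> y))\<^sup>2) ^ i = t ^ (2 * i) * (y \<bullet> y - (e \<bullet> y)\<^sup>2) ^ i"
      for t and y :: 'a
  proof -
    have "t * t * (y \<bullet> y) - (t * (e \<bullet> y))\<^sup>2 = t\<^sup>2 * (y \<bullet> y - (e \<bullet> y)\<^sup>2)"
      by (simp add: power2_eq_square algebra_simps)
    then show ?thesis by (simp add: power_mult_distrib power_mult)
  qed
  ultimately show ?thesis
    by (auto simp: homogeneous_polynomial_def power_add power_mult_distrib mult.assoc[symmetric])
qed

text \<open>Reading \<open>1 - t^2\<close> as \<open>y \<bullet> y - (e \<bullet> y)^2\<close> makes
  the expression homogeneous of degree \<open>k\<close> without changing it on the sphere.\<close>

lemma zonal_poly_harmonic: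
  fixes e :: "'a::euclidean_space"
  assumes "norm e = 1" "DIM('a) \<ge> 2"
  shows "sphere_restrict (\<lambda>y. poly (zonal_poly DIM('a) k) (e \<bullet> y)) \<in> spherical_harmonics k"
proof -
  define T where "T i = (\<lambda>y::'a. (e \<bullet> y) ^ (k - 2 * i) * (y \<bullet> y - (e \<bullet> y)\<^sup>2) ^ i)" for i
  define c where "c = zonal_coeff DIM('a) k"
  have hom: "homogeneous_polynomial k (T i)" if "i \<le> k div 2" for i
    using homogeneous_zonal_monomial[of "k - 2 * i" i e] that by (simp add: T_def)
  have "homogeneous_polynomial k (\<lambda>y. \<Sum>i\<le>k div 2. c i * T i y)"
    using hom by (intro homogeneous_polynomial_sum homogeneous_polynomial_cmult) auto
  moreover have "laplacian (\<lambda>y. \<Sum>i\<le>k div 2. c i * T i y) y = 0" for y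
  proof -
    have pf: "real_polynomial_function (T i)" if "i \<le> k div 2" for i
      using hom[OF that] by (simp add: homogeneous_polynomial_def)
    \<comment> \<open>\<open>S (i - 1)\<close> carries the exponents of the second Laplacian term
      because \<open>k - 2 * (i - 1) - 2 = k - 2 * i\<close>, which is the shape that
      \<open>zonal_coeff_telescope\<close> expects.\<close>
    define S where "S i = (e \<bullet> y) ^ (k - 2 * i - 2) * (y \<bullet> y - (e \<bullet> y)\<^sup>2) ^ i" for i
    have "laplacian (T i) y = real (k - 2 * i) * (real (k - 2 * i) - 1) * S i
        + 2 * real i * (2 * real i + real DIM('a) - 3) * S (i - 1)" if "i \<le> k div 2" for i
    proof (cases i)
      case (Suc j)
      then show ?thesis unfolding T_def laplacian_zonal_monomial[OF assms(1)]
        by (simp add: S_def)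
    qed (use laplacian_zonal_monomial[OF assms(1), of k 0 y] in \<open>simp add: T_def S_def\<close>)
    then have "laplacian (\<lambda>y. \<Sum>i\<le>k div 2. c i * T i y) y = (\<Sum>i\<le>k div 2. c i *
        (real (k - 2 * i) * (real (k - 2 * i) - 1) * S i + 2 * real i * (2 * real i + real DIM('a)
        - 3) * S (i - 1)))"
      using pf by (subst laplacian_sum) (auto simp: laplacian_cmult)
    then show ?thesis unfolding c_def by (simp only: zonal_coeff_telescope[OF assms(2)])
  qed
  moreover have "sphere_restrict (\<lambda>y. poly (zonal_poly DIM('a) k) (e \<bullet> y))
      = sphere_restrict (\<lambda>y. \<Sum>i\<le>k div 2. c i * T i y)"
    by (auto simp: sphere_restrict_def fun_eq_iff poly_zonal_poly T_def c_def norm_eq_1)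
  ultimately show ?thesis unfolding spherical_harmonics_iff by blast
qed

lemma exists_orthogonal_unit:
  fixes e :: "'a::euclidean_space"
  assumes "DIM('a) \<ge> 2"
  obtains f :: 'a where "norm f = 1" "e \<bullet> f = 0"
proof -
  have "dim (span {e}) < DIM('a)"
    using assms dim_le_card'[of "{e}"] by simp
  then obtain x where x: "x \<noteq> 0" "\<And>y. y \<in> span {e} \<Longrightarrow> orthogonal x y"
    using orthogonal_to_subspace_exists[of "span {e}"] by (metis span_span)
  then have "e \<bullet> sgn x = 0"
    by (simp add: sgn_div_norm orthogonal_def inner_commute span_base)
  then show thesis using that[of "sgn x"] x(1) by (simp add: norm_sgn)
qed

lemma even_poly_sum:
  assumes "degree (H :: real poly) \<le> k" "\<And>x. poly H (- x) = poly H x"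
  shows "poly H x = (\<Sum>i\<le>k div 2. coeff H (2 * i) * x ^ (2 * i))"
proof -
  have "pcompose H [:0, -1:] = H"
    using assms(2) by (intro poly_ext) (simp add: poly_pcompose)
  then have c: "(-1) ^ i * coeff H i = coeff H i" for i
    using coeff_pcompose_linear[of H "-1" i] by simp
  have odd: "coeff H i = 0" if "odd i" for i
    using c[of i] that by simp
  have "poly H x = (\<Sum>i\<le>k. coeff H i * x ^ i)"
    unfolding poly_altdef using assms(1)
    by (intro sum.mono_neutral_left) (auto simp: coeff_eq_0)
  also have "\<dots> = (\<Sum>i\<in>(*) 2 ` {..k div 2}. coeff H i * x ^ i)"
  proof (rule sum.mono_neutral_right)
    show "\<forall>i\<in>{..k} - (*) 2 ` {..k div 2}. coeff H i * x ^ i = 0"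
    proof
      fix i assume i: "i \<in> {..k} - (*) 2 ` {..k div 2}"
      then have "odd i" by (auto elim!: evenE)
      then show "coeff H i * x ^ i = 0" by (simp add: odd)
    qed
  qed auto
  also have "\<dots> = (\<Sum>i\<le>k div 2. coeff H (2 * i) * x ^ (2 * i))"
    by (subst sum.reindex) (auto simp: inj_on_def)
  finally show ?thesis .
qed

lemma real_polynomial_function_line:
  assumes "real_polynomial_function (p :: 'a::euclidean_space \<Rightarrow> real)"
  obtains H where "\<And>t. p (x + t *\<^sub>R y) = poly H t"
proof -
  have "polynomial_function (\<lambda>t::real. x + t *\<^sub>R y)"
    by (intro polynomial_function_add polynomial_function_const polynomial_function_mult) auto
  then have "real_polynomial_function (p \<circ> (\<lambda>t. x + t *\<^sub>R y))"
    using assms by auto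
  then obtain a n where "p \<circ> (\<lambda>t. x + t *\<^sub>R y) = (\<lambda>t. \<Sum>i\<le>n. a i * t ^ i)"
    using real_polynomial_function_imp_sum by blast
  then have "p (x + t *\<^sub>R y) = poly (\<Sum>i\<le>n. monom (a i) i) t" for t
    by (simp add: fun_eq_iff poly_sum poly_monom)
  then show thesis using that by blast
qed

text \<open>Bounds the degree of a homogeneous polynomial along a line that misses the origin.
  Clearing the negative powers turns \<open>Q\<close> into \<open>reflect_poly Q\<close>, and
  degrees can be compared.\<close>

lemma degree_le_of_reversal:
  fixes H Q :: "real poly"
  assumes "\<And>t. t \<noteq> 0 \<Longrightarrow> poly H t = t ^ k * poly Q (inverse t)"
  shows "degree H \<le> k"
proof (cases "H = 0")
  case False
  \<comment> \<open>The extra power of \<open>t\<close> on both sides makes them agree at 0, where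
    the assumption is silent.\<close>
  have "monom 1 (degree Q + 1) * H = monom 1 (k + 1) * reflect_poly Q"
  proof (rule poly_ext)
    fix t
    show "poly (monom 1 (degree Q + 1) * H) t = poly (monom 1 (k + 1) * reflect_poly Q) t"
      by (cases "t = 0") (simp_all add: poly_monom poly_reflect_poly_nz assms)
  qed
  moreover from this have "reflect_poly Q \<noteq> 0" using False by (auto simp: monom_eq_0_iff)
  ultimately have "degree Q + 1 + degree H = k + 1 + degree (reflect_poly Q)"
    using False by (metis degree_mult_eq degree_monom_eq monom_eq_0_iff zero_neq_one)
  then show ?thesis using degree_reflect_poly_le[of Q] by linarith
qed simp

text \<open>Invariance reduces the harmonic to a plane through the axis \<open>e\<close>,
  homogeneity and evenness reduce it there to a combination of zonal monomials, and Laplace's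
  equation leaves one free constant, the value at \<open>e\<close>.\<close>

lemma zonal_harmonic_eq:
  fixes e y :: "'a::euclidean_space"
  assumes n: "DIM('a) \<ge> 2" and e: "norm e = 1" and u: "u \<in> spherical_harmonics k"
    and inv: "\<And>v y. v \<bullet> e = 0 \<Longrightarrow> u (householder v y) = u y"
    and y: "norm y = 1"
  shows "u y = u e * poly (zonal_poly DIM('a) k) (e \<bullet> y)"
proof -
  define n where "n = DIM('a)"
  have n2: "n \<ge> 2" using n by (simp add: n_def)
  obtain p where p: "homogeneous_polynomial k p" "\<And>x. laplacian p x = 0" "u = sphere_restrict p"
    using u unfolding spherical_harmonics_iff by blast
  have pf: "real_polynomial_function p" and hom: "\<And>t x. p (t *\<^sub>R x) = t ^ k * p x"
    using p(1) by (auto simp: homogeneous_polynomial_def)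
  \<comment> \<open>The invariance is assumed on the sphere only; homogeneity carries it to the
    whole space.\<close>
  have pinv: "p (householder v x) = p x" if "v \<bullet> e = 0" for v x
  proof (cases "x = 0")
    case False
    then have x: "x = norm x *\<^sub>R sgn x" by (simp add: sgn_div_norm)
    have "u (householder v (sgn x)) = u (sgn x)" using inv[OF that] .
    then have "p (householder v (sgn x)) = p (sgn x)"
      using False by (simp add: p(3) sphere_restrict_def norm_sgn)
    then have "norm x ^ k * p (householder v (sgn x)) = norm x ^ k * p (sgn x)" by simp
    then show ?thesis
      unfolding hom[symmetric] householder_scaleR[symmetric] x[symmetric] .
  qed (simp add: householder_def)
  obtain f :: 'a where f: "norm f = 1" "e \<bullet> f = 0" using exists_orthogonal_unit[OF n] by blast
  \<comment> \<open>A reflection fixing the axis carries \<open>z\<close> to the multiple of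
    \<open>f\<close> of the same length.\<close>
  have prot: "p (a *\<^sub>R e + z) = p (a *\<^sub>R e + norm z *\<^sub>R f)" if "e \<bullet> z = 0" for a z
  proof -
    define v where "v = z - norm z *\<^sub>R f"
    have v: "v \<bullet> e = 0" using that f by (simp add: v_def inner_diff_right inner_commute[of _ e])
    have "householder v z = norm z *\<^sub>R f"
      unfolding v_def by (rule householder_swap) (simp add: f)
    moreover have "householder v (a *\<^sub>R e) = a *\<^sub>R e"
      by (rule householder_fix) (use v in \<open>simp add: inner_commute\<close>)
    ultimately show ?thesis using pinv[OF v, of "a *\<^sub>R e + z"] by (simp add: householder_add)
  qed
  obtain H where H: "\<And>t. p (e + t *\<^sub>R f) = poly H t"
    using real_polynomial_function_line[OF pf] by blast
  obtain Q where Q: "\<And>t. p (f + t *\<^sub>R e) = poly Q t"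
    using real_polynomial_function_line[OF pf] by blast
  have degH: "degree H \<le> k"
  proof (rule degree_le_of_reversal)
    fix t :: real assume t: "t \<noteq> 0"
    have "e + t *\<^sub>R f = t *\<^sub>R (f + inverse t *\<^sub>R e)" using t by (simp add: scaleR_add_right)
    then show "poly H t = t ^ k * poly Q (inverse t)" unfolding H[symmetric] Q[symmetric]
        by (simp add: hom)
  qed
  have Heven: "poly H (- t) = poly H t" for t
    using prot[of "t *\<^sub>R f" 1] prot[of "(- t) *\<^sub>R f" 1] f by (simp flip: H)
  define c where "c i = coeff H (2 * i)" for i
  define K where "K = k div 2"
  have Hsum: "poly H t = (\<Sum>i\<le>K. c i * t ^ (2 * i))" for t
    using even_poly_sum[OF degH Heven] by (simp add: c_def K_def)
  have plane0: "p (a *\<^sub>R e + b *\<^sub>R f) = (\<Sum>i\<le>K. c i * (a ^ (k - 2 * i) * b ^ (2 * i)))" if a: "a \<noteq> 0"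
      for a b
  proof -
    have "a *\<^sub>R e + b *\<^sub>R f = a *\<^sub>R (e + (b / a) *\<^sub>R f)" using a by (simp add: scaleR_add_right)
    then have "p (a *\<^sub>R e + b *\<^sub>R f) = a ^ k * poly H (b / a)" by (simp only: hom H)
    also have "\<dots> = (\<Sum>i\<le>K. c i * (a ^ (k - 2 * i) * b ^ (2 * i)))"
      unfolding Hsum sum_distrib_left
    proof (rule sum.cong[OF refl])
      fix i assume "i \<in> {..K}"
      then have "a ^ k = a ^ (k - 2 * i) * a ^ (2 * i)"
        by (simp add: K_def power_add[symmetric])
      then show "a ^ k * (c i * (b / a) ^ (2 * i)) = c i * (a ^ (k - 2 * i) * b ^ (2 * i))"
        using a by (simp add: power_divide)
    qed
    finally show ?thesis .
  qed
  \<comment> \<open>The case \<open>a = 0\<close>, excluded above by a division, follows from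
    continuity of both sides in \<open>a\<close>.\<close>
  have plane: "p (a *\<^sub>R e + b *\<^sub>R f) = (\<Sum>i\<le>K. c i * (a ^ (k - 2 * i) * b ^ (2 * i)))" for a b
  proof (cases "a = 0")
    case True
    obtain L where L: "\<And>t. p (b *\<^sub>R f + t *\<^sub>R e) = poly L t"
      using real_polynomial_function_line[OF pf] by blast
    define R where "R a = (\<Sum>i\<le>K. c i * (a ^ (k - 2 * i) * b ^ (2 * i)))" for a :: real
    have LR: "poly L a = R a" if "a \<noteq> 0" for a
      using plane0[OF that, of b] by (simp add: L[symmetric] R_def add.commute)
    have "(poly L \<longlongrightarrow> poly L 0) (at 0)" by (intro isContD poly_isCont)
    moreover have "(R \<longlongrightarrow> R 0) (at 0)" unfolding R_def by (intro isContD continuous_intros)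
    then have "(poly L \<longlongrightarrow> R 0) (at 0)"
      by (rule Lim_transform_eventually) (auto simp: LR eventually_at_filter)
    ultimately have "poly L 0 = R 0" by (rule tendsto_unique[OF at_neq_bot])
    then show ?thesis using True by (simp add: L[symmetric] R_def)
  qed (rule plane0)
  have full: "p x = (\<Sum>i\<le>K. c i * ((e \<bullet> x) ^ (k - 2 * i) * (x \<bullet> x - (e \<bullet> x)\<^sup>2) ^ i))" for x
  proof -
    define z where "z = x - (e \<bullet> x) *\<^sub>R e"
    have ee: "e \<bullet> e = 1" using e by (simp add: norm_eq_1)
    have z: "e \<bullet> z = 0" by (simp add: z_def inner_diff_right ee)
    have nz: "(norm z)\<^sup>2 = x \<bullet> x - (e \<bullet> x)\<^sup>2"
      unfolding power2_norm_eq_inner z_def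
      by (simp add: inner_diff_left inner_diff_right ee inner_commute[of x e] power2_eq_square)
    have "x = (e \<bullet> x) *\<^sub>R e + z" by (simp add: z_def)
    then have "p x = p ((e \<bullet> x) *\<^sub>R e + norm z *\<^sub>R f)" using prot[OF z] by metis
    then show ?thesis by (simp add: plane power_mult nz)
  qed
  have rec: "c (Suc i) * (2 * real (Suc i) * (2 * real (Suc i) + real n - 3))
      = - (real (k - 2 * i) * (real (k - 2 * i) - 1) * c i)" if i: "Suc i \<le> K" for i
  proof -
    define A where "A i = real (k - 2 * i) * (real (k - 2 * i) - 1)" for i
    define B where "B i = 2 * real i * (2 * real i + real n - 3)" for i
    \<comment> \<open>On the line \<open>e + b *\<^sub>R f\<close> the Laplacian is the polynomial
      \<open>W\<close> in \<open>b\<^sup>2\<close>. It vanishes at every nonnegative argument, hence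
      identically, and its coefficients give the recursion. Since \<open>B 0 = 0\<close>, the
      truncated exponent \<open>i - 1\<close> at \<open>i = 0\<close> does no harm.\<close>
    define W where "W = (\<Sum>i\<le>K. monom (c i * A i) i + monom (c i * B i) (i - 1))"
    have "poly W (b\<^sup>2) = 0" for b
    proof -
      let ?y = "e + b *\<^sub>R f"
      have ey: "e \<bullet> ?y = 1" and yy: "?y \<bullet> ?y - 1\<^sup>2 = b\<^sup>2"
        using e f by (simp_all add: inner_simps inner_commute[of f e] norm_eq_1 power2_eq_square)
      have "0 = laplacian p ?y" by (simp add: p(2))
      also have "p = (\<lambda>x. \<Sum>i\<le>K. c i * ((e \<bullet> x) ^ (k - 2 * i) * (x \<bullet> x - (e \<bullet> x)\<^sup>2) ^ i))"
        using full by blast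
      also have "laplacian (\<lambda>x. \<Sum>i\<le>K. c i * ((e \<bullet> x) ^ (k - 2 * i) * (x \<bullet> x - (e \<bullet> x)\<^sup>2) ^ i)) ?y
          = (\<Sum>i\<le>K. c i * laplacian (\<lambda>x. (e \<bullet> x) ^ (k - 2 * i) * (x \<bullet> x - (e \<bullet> x)\<^sup>2) ^ i) ?y)"
      proof -
        have rp: "real_polynomial_function (\<lambda>x. (e \<bullet> x) ^ m * (x \<bullet> x - (e \<bullet> x)\<^sup>2) ^ i)" for m i
          using homogeneous_zonal_monomial[of m i e] by (simp add: homogeneous_polynomial_def)
        have "real_polynomial_function (\<lambda>x. c i * ((e \<bullet> x) ^ m * (x \<bullet> x - (e \<bullet> x)\<^sup>2) ^ i))" for m i
          by (rule real_polynomial_function.intros(4)[OF real_polynomial_function.intros(2) rp])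
        then show ?thesis by (subst laplacian_sum) (auto simp: laplacian_cmult[OF rp])
      qed
      also have "\<dots> = (\<Sum>i\<le>K. c i * (A i * (b\<^sup>2) ^ i + B i * (b\<^sup>2) ^ (i - 1)))"
        unfolding laplacian_zonal_monomial[OF e] ey yy by (simp add: A_def B_def n_def)
      also have "\<dots> = poly W (b\<^sup>2)"
        by (simp add: W_def poly_sum poly_monom algebra_simps)
      finally show ?thesis by simp
    qed
    then have root: "poly W x = 0" if "x \<ge> 0" for x using that by (metis real_sqrt_pow2)
    have "W = 0"
    proof (rule ccontr)
      assume "W \<noteq> 0"
      then have "finite {x. poly W x = 0}" by (rule poly_roots_finite)
      then have "finite {0::real..}" by (rule finite_subset[rotated]) (auto simp: root)
      then show False by (simp add: infinite_Ici)
    qed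
    then have "0 = coeff W i" by simp
    also have "\<dots> = (\<Sum>j\<le>K. (if j = i then c j * A j else 0) + (if j = Suc i then c j * B j else 0))"
      unfolding W_def coeff_sum
    proof (rule sum.cong[OF refl])
      fix j show "coeff (monom (c j * A j) j + monom (c j * B j) (j - 1)) i
          = (if j = i then c j * A j else 0) + (if j = Suc i then c j * B j else 0)"
        by (cases j) (auto simp: B_def)
    qed
    also have "\<dots> = c i * A i + c (Suc i) * B (Suc i)"
      using i by (simp add: sum.distrib)
    finally show ?thesis unfolding A_def B_def by (simp add: algebra_simps)
  qed
  have ceq: "c i = c 0 * zonal_coeff n k i" if "i \<le> K" for i
    using that
  proof (induction i)
    case (Suc i)
    define D where "D = 2 * real (Suc i) * (2 * real (Suc i) + real n - 3)"
    have "2 * real (Suc i) + real n - 3 \<noteq> 0" using n2 by simp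
    then have D: "D \<noteq> 0" by (simp add: D_def)
    define X where "X = real (k - 2 * i) * (real (k - 2 * i) - 1)"
    have r1: "c (Suc i) * D = - (X * c i)"
      using rec[OF Suc.prems] unfolding D_def X_def .
    have r2: "zonal_coeff n k (Suc i) * D = - (X * zonal_coeff n k i)"
      using zonal_coeff_Suc_eq[OF n2] unfolding D_def X_def .
    have ih: "c i = c 0 * zonal_coeff n k i" by (rule Suc.IH[OF Suc_leD[OF Suc.prems]])
    have "c (Suc i) * D = (c 0 * zonal_coeff n k (Suc i)) * D"
      unfolding r1 mult.assoc r2 unfolding ih by (simp only: mult_minus_right mult.left_commute)
    then show ?case using D mult_right_cancel by blast
  qed simp
  have "p y = (\<Sum>i\<le>K. c i * ((e \<bullet> y) ^ (k - 2 * i) * (1 - (e \<bullet> y)\<^sup>2) ^ i))"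
  proof -
    have "y \<bullet> y = 1" using y by (simp add: norm_eq_1)
    then show ?thesis using full[of y] by (simp only:)
  qed
  also have "\<dots> = (\<Sum>i\<le>K. c 0 * (zonal_coeff n k i * ((e \<bullet> y) ^ (k - 2 * i) * (1 - (e \<bullet> y)\<^sup>2) ^ i)))"
  proof (rule sum.cong[OF refl])
    fix i assume "i \<in> {..K}"
    then have "c i = c 0 * zonal_coeff n k i" by (intro ceq) simp
    then show "c i * ((e \<bullet> y) ^ (k - 2 * i) * (1 - (e \<bullet> y)\<^sup>2) ^ i)
        = c 0 * (zonal_coeff n k i * ((e \<bullet> y) ^ (k - 2 * i) * (1 - (e \<bullet> y)\<^sup>2) ^ i))"
      by (simp only: mult.assoc)
  qed
  finally have "p y = c 0 * poly (zonal_poly n k) (e \<bullet> y)"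
    unfolding poly_zonal_poly K_def sum_distrib_left .
  moreover have "p e = c 0"
    using H[of 0] by (simp add: c_def poly_0_coeff_0)
  ultimately have "p y = p e * poly (zonal_poly n k) (e \<bullet> y)" by (simp only:)
  moreover have "u y = p y" "u e = p e" unfolding p(3) using y e
      by (simp_all add: sphere_restrict_def)
  ultimately show ?thesis unfolding n_def by (simp only:)
qed

subsection \<open>Gegenbauer equation and Legendre polynomials\<close>

lemma poly_zonal_poly_1 [simp]: "poly (zonal_poly n k) 1 = 1"
proof -
  have "poly (zonal_poly n k) 1 = (\<Sum>i\<le>k div 2. if i = 0 then 1 else 0)"
    unfolding poly_zonal_poly by (intro sum.cong) (auto simp: power_0_left)
  then show ?thesis by simp
qed

text \<open>The signs match the leading coefficients \<open>(-1) ^ i\<close> of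
  \<open>(1 - t^2) ^ i\<close>, so the leading terms in \<open>zonal_poly\<close> cannot cancel and
  its degree is exactly \<open>k\<close>.\<close>

lemma zonal_coeff_sign:
  assumes "n \<ge> 2" "i \<le> k div 2"
  shows "(-1) ^ i * zonal_coeff n k i \<ge> 0"
  using assms(2)
proof (induction i)
  case (Suc i)
  define q where "q = real (k - 2 * i) * (real (k - 2 * i) - 1) / (2 * (real i + 1) * (2 * real i
      + real n - 1))"
  have "k - 2 * i \<ge> 1" using Suc.prems by linarith
  then have "q \<ge> 0" using assms(1) by (simp add: q_def)
  moreover have "(-1) ^ Suc i * zonal_coeff n k (Suc i) = q * ((-1) ^ i * zonal_coeff n k i)"
    by (simp add: q_def)
  ultimately show ?case using Suc by simp
qed simp

lemma zonal_monomial_poly: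
  "degree (monom (1::real) m * [:1, 0, -1:] ^ i) = m + 2 * i"
  "coeff (monom (1::real) m * [:1, 0, -1:] ^ i) (m + 2 * i) = (-1) ^ i"
proof -
  have dm: "degree (monom (1::real) m) = m" by (rule degree_monom_eq) simp
  have "degree ([:1, 0, -1::real:] ^ i) = 2 * i" by (simp add: degree_power_eq)
  moreover have "degree (monom (1::real) m * [:1, 0, -1:] ^ i)
      = degree (monom (1::real) m) + degree ([:1, 0, -1::real:] ^ i)"
    by (rule degree_mult_eq) (auto simp: monom_eq_0_iff)
  ultimately show deg: "degree (monom (1::real) m * [:1, 0, -1:] ^ i) = m + 2 * i"
    using dm by (simp only:)
  have "lead_coeff (monom (1::real) m * [:1, 0, -1:] ^ i) = (-1) ^ i"
    unfolding lead_coeff_mult lead_coeff_power dm by simp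
  then show "coeff (monom (1::real) m * [:1, 0, -1:] ^ i) (m + 2 * i) = (-1) ^ i"
    by (simp only: deg)
qed

lemma degree_zonal_poly:
  assumes "n \<ge> 2"
  shows "degree (zonal_poly n k) = k"
proof (rule antisym)
  show "degree (zonal_poly n k) \<le> k"
    unfolding zonal_poly_def
  proof (rule degree_sum_le)
    fix i assume "i \<in> {..k div 2}"
    then show "degree (smult (zonal_coeff n k i) (monom 1 (k - 2 * i) * [:1, 0, -1:] ^ i)) \<le> k"
      by (intro order.trans[OF degree_smult_le]) (simp add: zonal_monomial_poly)
  qed simp
  have "coeff (zonal_poly n k) k = (\<Sum>i\<le>k div 2. (-1) ^ i * zonal_coeff n k i)"
    unfolding zonal_poly_def coeff_sum
  proof (rule sum.cong[OF refl])
    fix i assume "i \<in> {..k div 2}"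
    then show "coeff (smult (zonal_coeff n k i) (monom 1 (k - 2 * i) * [:1, 0, -1:] ^ i)) k
        = (-1) ^ i * zonal_coeff n k i"
      using zonal_monomial_poly(2)[of "k - 2 * i" i] by simp
  qed
  also have "\<dots> \<ge> (-1) ^ 0 * zonal_coeff n k 0"
    by (rule member_le_sum) (auto simp: zonal_coeff_sign assms)
  finally have "coeff (zonal_poly n k) k \<noteq> 0" by simp
  then show "k \<le> degree (zonal_poly n k)" by (rule le_degree)
qed

lemma poly_zonal_expansion:
  assumes "n \<ge> 2" "degree q \<le> m"
  shows "\<exists>a. q = (\<Sum>j\<le>m. smult (a j) (zonal_poly n j))"
  using assms(2)
proof (induction m arbitrary: q)
  case 0
  have "zonal_poly n 0 = 1"
    by (simp add: zonal_poly_def monom_0 one_pCons)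
  moreover obtain c where "q = [:c:]" using 0 degree_eq_zeroE by blast
  ultimately show ?case by (intro exI[of _ "\<lambda>_. c"]) (simp add: one_pCons)
next
  case (Suc m)
  define P where "P = zonal_poly n (Suc m)"
  define c where "c = coeff q (Suc m) / coeff P (Suc m)"
  have dP: "degree P = Suc m" by (simp add: P_def degree_zonal_poly assms(1))
  then have "coeff P (Suc m) \<noteq> 0" by (metis leading_coeff_0_iff degree_0 nat.distinct(1))
  then have "coeff (q - smult c P) (Suc m) = 0" by (simp add: c_def)
  moreover have "degree (q - smult c P) \<le> Suc m"
    using Suc.prems dP by (intro degree_diff_le) auto
  ultimately have "degree (q - smult c P) \<le> m"
    by (metis eq_zero_or_degree_less le_SucE less_Suc_eq_le degree_0 zero_le)
  then obtain a where a: "q - smult c P = (\<Sum>j\<le>m. smult (a j) (zonal_poly n j))"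
    using Suc.IH by blast
  have "q = (\<Sum>j\<le>m. smult (a j) (zonal_poly n j)) + smult c P"
    using a by (simp add: algebra_simps)
  then show ?case
    by (intro exI[of _ "a(Suc m := c)"]) (simp add: P_def)
qed

text \<open>The Laplace-Beltrami operator of the unit sphere in dimension \<open>n\<close>, acting
  on functions of the form \<open>p (e \<bullet> y)\<close>.\<close>

definition gegenbauer_op :: "nat \<Rightarrow> real poly \<Rightarrow> real poly" where
  "gegenbauer_op n p = [:1, 0, -1:] * pderiv (pderiv p) - smult (real n - 1) ([:0, 1:] * pderiv p)"

lemma gegenbauer_op_add: "gegenbauer_op n (p + q) = gegenbauer_op n p + gegenbauer_op n q"
  by (simp add: gegenbauer_op_def pderiv_add smult_add_right algebra_simps)

lemma gegenbauer_op_smult: "gegenbauer_op n (smult c p) = smult c (gegenbauer_op n p)"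
  by (rule poly_ext) (simp add: gegenbauer_op_def pderiv_smult algebra_simps)

lemma gegenbauer_op_sum: "gegenbauer_op n (\<Sum>i\<in>I. f i) = (\<Sum>i\<in>I. gegenbauer_op n (f i))"
proof (induction I rule: infinite_finite_induct)
  case (insert x F)
  then show ?case by (simp add: gegenbauer_op_add)
qed (simp_all add: gegenbauer_op_def)

lemma poly_gegenbauer_op:
  "poly (gegenbauer_op n p) t
    = (1 - t\<^sup>2) * poly (pderiv (pderiv p)) t - (real n - 1) * t * poly (pderiv p) t"
  by (simp add: gegenbauer_op_def power2_eq_square algebra_simps)

text \<open>The first two terms are those of \<open>laplacian_zonal_monomial\<close> on the sphere;
  the third removes the radial part of the Laplacian of a function homogeneous of degree
  \<open>m + 2 * i\<close>.\<close>

lemma gegenbauer_op_zonal_monomial: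
  "poly (gegenbauer_op n (monom 1 m * [:1, 0, -1:] ^ i)) t
    = real m * (real m - 1) * (t ^ (m - 2) * (1 - t\<^sup>2) ^ i)
      + 2 * real i * (2 * real i + real n - 3) * (t ^ m * (1 - t\<^sup>2) ^ (i - 1))
      - real (m + 2 * i) * (real (m + 2 * i) + real n - 2) * (t ^ m * (1 - t\<^sup>2) ^ i)"
proof -
  define q where "q = [:1, 0, -1::real:]"
  have q: "poly q t = 1 - t\<^sup>2" by (simp add: q_def power2_eq_square)
  have pq: "pderiv q = [:0, -2:]" by (simp add: q_def pderiv_pCons)
  define g where "g m i = monom 1 m * q ^ i" for m i :: nat
  define Q where "Q = 1 - t\<^sup>2"
  have tt: "t * t = 1 - Q" by (simp add: Q_def power2_eq_square)
  have g: "poly (g m i) t = t ^ m * Q ^ i" for m i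
    by (simp add: g_def poly_monom q Q_def)
  have d: "pderiv (g m i) = smult (real m) (g (m - 1) i) - smult (2 * real i) (g (m + 1) (i - 1))"
      for m i
  proof (rule poly_ext)
    fix x
    have "pderiv (g m i) = monom (real m) (m - 1) * q ^ i + monom 1 m * (smult (real i) (q ^ (i
        - 1)) * [:0, -2:])"
      by (simp only: g_def pderiv_mult pderiv_power pq pderiv_monom mult_1_right)
          (simp add: algebra_simps)
    then show "poly (pderiv (g m i)) x = poly (smult (real m) (g (m - 1) i) - smult (2 * real i) (g
        (m + 1) (i - 1))) x"
      by (simp add: g_def poly_monom algebra_simps)
  qed
  define G where "G m i \<longleftrightarrow> Q * poly (pderiv (pderiv (g m i))) t - (real n - 1) * t * poly (pderiv
      (g m i)) t
      = real m * (real m - 1) * (t ^ (m - 2) * Q ^ i)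
      + 2 * real i * (2 * real i + real n - 3) * (t ^ m * Q ^ (i - 1))
      - real (m + 2 * i) * (real (m + 2 * i) + real n - 2) * (t ^ m * Q ^ i)" for m i
  \<comment> \<open>The cases 0, 1 and at least 2 remove the truncated subtractions from the
    exponents; in each case the claim is a polynomial identity with
    \<open>t * t = 1 - Q\<close>.\<close>
  have "G 0 0" "G 0 1" "G 0 (l + 2)" "G 1 0" "G 1 1" "G 1 (l + 2)"
    "G (j + 2) 0" "G (j + 2) 1" "G (j + 2) (l + 2)" for j l
  proof -
    define a b where "a = t ^ j" "b = Q ^ l"
    note S = d pderiv_diff pderiv_add pderiv_minus pderiv_smult g power_add power2_eq_square
    show "G 0 0" "G 0 1" "G 0 (l + 2)" "G 1 0" "G 1 1" "G 1 (l + 2)"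
      "G (j + 2) 0" "G (j + 2) 1" "G (j + 2) (l + 2)"
      unfolding G_def
      by (simp add: S; (simp only: flip: a_b_def)?; (use tt in algebra)?)+
  qed
  moreover have "m = 0 \<or> m = 1 \<or> (\<exists>j. m = j + 2)" for m :: nat
    by (metis One_nat_def add_2_eq_Suc' not0_implies_Suc)
  ultimately have "G m i" by metis
  then show ?thesis
    unfolding G_def g_def q_def Q_def poly_gegenbauer_op .
qed

lemma gegenbauer_op_zonal_poly:
  assumes "n \<ge> 2"
  shows "gegenbauer_op n (zonal_poly n k) = smult (- (real k * (real k + real n - 2)))
      (zonal_poly n k)"
proof (rule poly_ext)
  fix t :: real
  define T where "T i = t ^ (k - 2 * i - 2) * (1 - t\<^sup>2) ^ i" for i
  define L where "L = real k * (real k + real n - 2)"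
  have "poly (gegenbauer_op n (monom 1 (k - 2 * i) * [:1, 0, -1:] ^ i)) t
      = real (k - 2 * i) * (real (k - 2 * i) - 1) * T i + 2 * real i * (2 * real i + real n - 3) * T
      (i - 1)
        - L * (t ^ (k - 2 * i) * (1 - t\<^sup>2) ^ i)" if "i \<le> k div 2" for i
  proof -
    have k: "k - 2 * i + 2 * i = k" using that by simp
    show ?thesis
    proof (cases i)
      case 0
      then show ?thesis using gegenbauer_op_zonal_monomial[of n k 0 t] by (simp add: T_def L_def)
    next
      case (Suc j)
      then have "k - 2 * i = k - 2 * j - 2" by simp
      then show ?thesis
        unfolding gegenbauer_op_zonal_monomial k by (simp add: T_def L_def Suc del: of_nat_diff)
    qed
  qed
  then have "poly (gegenbauer_op n (zonal_poly n k)) t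
      = (\<Sum>i\<le>k div 2. zonal_coeff n k i * (real (k - 2 * i) * (real (k - 2 * i) - 1) * T i + 2
      * real i * (2 * real i + real n - 3) * T (i - 1))
           - L * (zonal_coeff n k i * (t ^ (k - 2 * i) * (1 - t\<^sup>2) ^ i)))"
    unfolding zonal_poly_def gegenbauer_op_sum gegenbauer_op_smult poly_sum poly_smult
    by (intro sum.cong) (simp_all add: right_diff_distrib del: of_nat_diff)
  also have "\<dots> = - L * poly (zonal_poly n k) t"
    unfolding sum_subtractf zonal_coeff_telescope[OF assms] poly_zonal_poly
        by (simp add: sum_distrib_left sum_negf)
  finally show "poly (gegenbauer_op n (zonal_poly n k)) t
      = poly (smult (- (real k * (real k + real n - 2))) (zonal_poly n k)) t"
    by (simp add: L_def)
qed

lemma one_minus_sq_pos: "-1 < t \<Longrightarrow> t < 1 \<Longrightarrow> 0 < 1 - (t::real)\<^sup>2"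
  using abs_square_less_1[of t] by auto

text \<open>The exponent is at least \<open>- 1 / 2\<close>, its value for \<open>n = 2\<close>.
  There the weight is the derivative of \<open>arcsin\<close>, and this dominates all other
  cases.\<close>

lemma jacobi_weight_integrable:
  fixes p :: "real poly"
  assumes "n \<ge> 2"
  shows "set_integrable lborel {-1<..<1} (\<lambda>t. poly p t * (1 - t\<^sup>2) powr ((real n - 3) / 2))"
proof -
  have arcsin: "set_integrable lborel (einterval (ereal (-1)) (ereal 1)) (\<lambda>t. inverse (sqrt (1
      - t\<^sup>2)))"
  proof (rule interval_integral_FTC_nonneg(1)[where F = arcsin and A = "- pi / 2" and B = "pi / 2"])
    fix x assume "ereal (-1) < ereal x" "ereal x < ereal 1"
    then have x: "-1 < x" "x < 1" by simp_all
    then show "DERIV arcsin x :> inverse (sqrt (1 - x\<^sup>2))" by (rule DERIV_arcsin)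
    show "isCont (\<lambda>t. inverse (sqrt (1 - t\<^sup>2))) x"
      using one_minus_sq_pos[OF x] by (intro continuous_intros) auto
  next
    show "AE x in lborel. ereal (-1) < ereal x \<longrightarrow> ereal x < ereal 1 \<longrightarrow> 0 \<le> inverse (sqrt (1 - x\<^sup>2))"
      using one_minus_sq_pos by (intro AE_I2) (auto intro: less_imp_le)
    have cont: "continuous_on {-1..1} arcsin" by (rule continuous_on_arcsin')
    have "(arcsin \<longlongrightarrow> arcsin (-1)) (at (-1) within {-1..1})"
      using cont unfolding continuous_on_def by (rule bspec) simp
    then show "((arcsin \<circ> real_of_ereal) \<longlongrightarrow> - pi / 2) (at_right (ereal (-1)))"
      by (simp add: ereal_tendsto_simps at_within_Icc_at_right)
    have "(arcsin \<longlongrightarrow> arcsin 1) (at 1 within {-1..1})"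
      using cont unfolding continuous_on_def by (rule bspec) simp
    then show "((arcsin \<circ> real_of_ereal) \<longlongrightarrow> pi / 2) (at_left (ereal 1))"
      by (simp add: ereal_tendsto_simps at_within_Icc_at_left)
  qed simp
  have "compact (poly p ` {-1..1})"
    by (intro compact_continuous_image continuous_intros) simp
  then have "bounded (poly p ` {-1..1})" by (rule compact_imp_bounded)
  then obtain B where B: "\<And>t. t \<in> {-1..1} \<Longrightarrow> \<bar>poly p t\<bar> \<le> B"
    unfolding bounded_iff by (metis imageI real_norm_def)
  have B0: "B \<ge> 0" using B[of 0] by simp
  have "set_integrable lborel {-1<..<1} (\<lambda>t. B * inverse (sqrt (1 - t\<^sup>2)))"
    using arcsin by (auto intro: set_integrable_mult_right)
  then show ?thesis
  proof (rule set_integrable_bound)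
    have [measurable]: "poly p \<in> borel_measurable borel"
      by (intro borel_measurable_continuous_onI continuous_at_imp_continuous_on) simp
    show "set_borel_measurable lborel {-1<..<1} (\<lambda>t. poly p t * (1 - t\<^sup>2) powr ((real n - 3) / 2))"
      unfolding set_borel_measurable_def
      by measurable
    show "AE t in lborel. t \<in> {-1<..<1} \<longrightarrow>
        norm (poly p t * (1 - t\<^sup>2) powr ((real n - 3) / 2)) \<le> norm (B * inverse (sqrt (1 - t\<^sup>2)))"
    proof (intro AE_I2 impI)
      fix t :: real assume t: "t \<in> {-1<..<1}"
      define u where "u = 1 - t\<^sup>2"
      have u: "0 < u" "u \<le> 1" using one_minus_sq_pos[of t] t by (auto simp: u_def)
      have "u powr ((real n - 3) / 2) \<le> u powr (- (1 / 2))"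
        using u assms by (intro powr_mono') (auto simp: field_simps)
      also have "\<dots> = inverse (sqrt u)"
        using u by (simp add: powr_minus powr_half_sqrt)
      finally have "\<bar>poly p t\<bar> * u powr ((real n - 3) / 2) \<le> B * inverse (sqrt u)"
        using B[of t] t B0 by (intro mult_mono) auto
      then show "norm (poly p t * (1 - t\<^sup>2) powr ((real n - 3) / 2))
          \<le> norm (B * inverse (sqrt (1 - t\<^sup>2)))"
        using B0 u by (simp add: abs_mult u_def[symmetric])
    qed
  qed
qed

definition jacobi_integral :: "nat \<Rightarrow> real poly \<Rightarrow> real" where
  "jacobi_integral n p = (LINT t:{-1<..<1}|lborel. poly p t * (1 - t\<^sup>2) powr ((real n - 3) / 2))"

lemma jacobi_integral_add:
  "n \<ge> 2 \<Longrightarrow> jacobi_integral n (p + q) = jacobi_integral n p + jacobi_integral n q"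
  unfolding jacobi_integral_def poly_add distrib_right
  by (intro set_integral_add jacobi_weight_integrable)

lemma jacobi_integral_smult: "jacobi_integral n (smult c p) = c * jacobi_integral n p"
  unfolding jacobi_integral_def poly_smult mult.assoc by simp

lemma jacobi_integral_sum:
  "n \<ge> 2 \<Longrightarrow> jacobi_integral n (\<Sum>i\<in>I. f i) = (\<Sum>i\<in>I. jacobi_integral n (f i))"
  by (induction I rule: infinite_finite_induct)
     (simp_all add: jacobi_integral_add, simp_all add: jacobi_integral_def)

text \<open>The integrand is the derivative of \<open>(1 - t^2) powr a\<close> times the Wronskian
  \<open>W\<close>, with \<open>a = (n - 1) / 2\<close>. As \<open>a > 0\<close>, the boundary terms
  vanish.\<close>

lemma jacobi_integral_gegenbauer_symmetric:
  assumes "n \<ge> 2"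
  shows "jacobi_integral n (gegenbauer_op n p * q - p * gegenbauer_op n q) = 0"
proof -
  define W where "W = pderiv p * q - p * pderiv q"
  define a where "a = (real n - 1) / 2"
  have a: "a > 0" using assms by (simp add: a_def)
  define F where "F t = (1 - t\<^sup>2) powr a * poly W t" for t :: real
  define f where "f t = poly (gegenbauer_op n p * q - p * gegenbauer_op n q) t * (1 - t\<^sup>2) powr
      ((real n - 3) / 2)" for t
  have "(LBINT t=ereal (-1)..ereal 1. f t) = 0 - 0"
  proof (rule interval_integral_FTC_integrable)
    fix x assume "ereal (-1) < ereal x" "ereal x < ereal 1"
    then have x: "-1 < x" "x < 1" by simp_all
    define u where "u = 1 - x\<^sup>2"
    have u: "u > 0" using one_minus_sq_pos[OF x] by (simp add: u_def)
    have pw: "u powr a = u * u powr ((real n - 3) / 2)" "u powr (a - 1) = u powr ((real n - 3) / 2)"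
    proof -
      have "a = 1 + (real n - 3) / 2" "a - 1 = (real n - 3) / 2"
          by (simp_all add: a_def field_simps)
      then show "u powr a = u * u powr ((real n - 3) / 2)" "u powr (a - 1)
          = u powr ((real n - 3) / 2)"
        using u by (simp_all only: powr_add powr_one)
    qed
    have "((\<lambda>t. (1 - t\<^sup>2) powr a) has_real_derivative a * u powr (a - 1) * (- 2 * x)) (at x)"
      using u unfolding u_def by (auto intro!: derivative_eq_intros simp: u_def)
    then have "(F has_real_derivative a * u powr (a - 1) * (- 2 * x) * poly W x + poly (pderiv W) x
        * u powr a) (at x)"
      unfolding F_def u_def by (rule DERIV_mult[OF _ poly_DERIV])
    moreover have "a * u powr (a - 1) * (- 2 * x) * poly W x + poly (pderiv W) x * u powr a = f x"
    proof -
      have na: "real n - 1 = 2 * a" by (simp add: a_def)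
      show ?thesis
        unfolding pw f_def poly_diff poly_mult poly_gegenbauer_op W_def na u_def[symmetric]
        by (simp add: pderiv_diff pderiv_mult algebra_simps)
    qed
    ultimately show "(F has_vector_derivative f x) (at x)"
      by (simp add: has_real_derivative_iff_has_vector_derivative)
    show "isCont f x"
      unfolding f_def using u by (intro continuous_intros) (auto simp: u_def)
  next
    show "set_integrable lborel (einterval (ereal (-1)) (ereal 1)) f"
      unfolding f_def einterval_eq by (rule jacobi_weight_integrable[OF assms])
    have lim: "(F \<longlongrightarrow> 0) (at c within {-1..1})" if "c = -1 \<or> c = 1" for c
    proof -
      have "((\<lambda>t. 1 - t\<^sup>2) \<longlongrightarrow> 1 - c\<^sup>2) (at c within {-1..1})" by (intro tendsto_intros)
      moreover have "\<forall>\<^sub>F t in at c within {-1..1}. 0 \<le> 1 - (t::real)\<^sup>2"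
        by (auto simp: eventually_at_filter power2_le_iff_abs_le abs_le_iff intro!:
            always_eventually abs_square_le_1[THEN iffD2])
      ultimately have "((\<lambda>t. (1 - t\<^sup>2) powr a) \<longlongrightarrow> 0) (at c within {-1..1})"
        using that a by (intro tendsto_zero_powrI[where b = a]) auto
      moreover have "(poly W \<longlongrightarrow> poly W c) (at c within {-1..1})" by (intro tendsto_intros)
      ultimately show ?thesis
        unfolding F_def using tendsto_mult[of _ 0 _ "poly W" "poly W c"] by simp
    qed
    show "((F \<circ> real_of_ereal) \<longlongrightarrow> 0) (at_right (ereal (-1)))"
      using lim[of "-1"] by (simp add: ereal_tendsto_simps at_within_Icc_at_right)
    show "((F \<circ> real_of_ereal) \<longlongrightarrow> 0) (at_left (ereal 1))"
      using lim[of 1] by (simp add: ereal_tendsto_simps at_within_Icc_at_left)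
  qed simp
  then show ?thesis
    by (simp add: jacobi_integral_def f_def interval_lebesgue_integral_le_eq)
qed

lemma zonal_poly_orthogonal:
  assumes "n \<ge> 2" "j \<noteq> k"
  shows "jacobi_integral n (zonal_poly n j * zonal_poly n k) = 0"
proof -
  define L where "L k = real k * (real k + real n - 2)" for k
  have "gegenbauer_op n (zonal_poly n j) * zonal_poly n k - zonal_poly n j * gegenbauer_op n
      (zonal_poly n k)
      = smult (L k - L j) (zonal_poly n j * zonal_poly n k)"
    unfolding gegenbauer_op_zonal_poly[OF assms(1)] L_def[symmetric]
    by (rule poly_ext) (simp add: algebra_simps)
  then have "0 = jacobi_integral n (smult (L k - L j) (zonal_poly n j * zonal_poly n k))"
    using jacobi_integral_gegenbauer_symmetric[OF assms(1), of "zonal_poly n j" "zonal_poly n k"]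
        by simp
  then have "(L k - L j) * jacobi_integral n (zonal_poly n j * zonal_poly n k) = 0"
    by (simp only: jacobi_integral_smult)
  moreover have "L k - L j = (real k - real j) * (real k + real j + real n - 2)"
    by (simp add: L_def algebra_simps)
  \<comment> \<open>\<open>j \<noteq> k\<close> gives \<open>j + k \<ge> 1\<close>, so the
    eigenvalues of distinct degrees differ even for \<open>n = 2\<close>.\<close>
  moreover have "real k + real j + real n - 2 \<noteq> 0" using assms by linarith
  ultimately show ?thesis using assms(2) by simp
qed

lemma jacobi_integral_square_nonzero:
  assumes "n \<ge> 2" "p \<noteq> 0"
  shows "jacobi_integral n (p * p) \<noteq> 0"
proof
  assume "jacobi_integral n (p * p) = 0"
  let ?f = "\<lambda>t. indicator {-1<..<1} t *\<^sub>R (poly (p * p) t * (1 - t\<^sup>2) powr ((real n - 3) / 2))"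
  have "integrable lborel ?f"
    using jacobi_weight_integrable[OF assms(1), of "p * p"] by (simp add: set_integrable_def)
  moreover have "(\<integral>t. ?f t \<partial>lborel) = 0"
    using \<open>jacobi_integral n (p * p) = 0\<close> by (simp add: jacobi_integral_def
        set_lebesgue_integral_def)
  ultimately have "AE t in lborel. ?f t = 0"
    by (subst integral_nonneg_eq_0_iff_AE[symmetric]) (auto simp: indicator_def)
  moreover have "AE t in lborel. t \<notin> {t. poly p t = 0}"
    using poly_roots_finite[OF assms(2)] by (intro AE_not_in finite_imp_null_set_lborel)
  ultimately have "AE t in lborel. t \<notin> {-1<..<1::real}"
  proof eventually_elim
    case (elim t)
    show ?case
    proof
      assume t: "t \<in> {-1<..<1}"
      then have "0 < 1 - t\<^sup>2" by (intro one_minus_sq_pos) auto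
      then show False using elim t by simp
    qed
  qed
  then have "{-1<..<1::real} \<in> null_sets lborel"
    by (subst AE_iff_null_sets) auto
  then show False by (auto simp: null_sets_def)
qed

text \<open>Discharges the definite description. A candidate expands in zonal polynomials; testing
  against those of lower degree removes all terms but the last, and the value at 1 fixes the
  remaining factor.\<close>

lemma legendre_poly_eq_zonal_poly:
  assumes "n \<ge> 2"
  shows "legendre_poly n k = zonal_poly n k"
proof -
  have orth: "(LINT t:{-1<..<1}|lborel. poly p t * poly q t * (1 - t\<^sup>2) powr ((real n - 3) / 2))
      = jacobi_integral n (p * q)" for p q
    by (simp add: jacobi_integral_def)
  show ?thesis
    unfolding legendre_poly_def orth
  proof (rule the_equality)
    have "jacobi_integral n (zonal_poly n k * q) = 0" if q: "degree q < k" for q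
    proof -
      have "degree q \<le> k - 1" using q by simp
      then obtain a where "q = (\<Sum>j\<le>k - 1. smult (a j) (zonal_poly n j))"
        using poly_zonal_expansion[OF assms] by blast
      then show ?thesis
        using q by (auto simp: sum_distrib_left jacobi_integral_sum[OF assms] jacobi_integral_smult
            intro!: sum.neutral zonal_poly_orthogonal[OF assms])
    qed
    then show "degree (zonal_poly n k) = k \<and> poly (zonal_poly n k) 1 = 1 \<and>
        (\<forall>q. degree q < k \<longrightarrow> jacobi_integral n (zonal_poly n k * q) = 0)"
      by (simp add: degree_zonal_poly[OF assms])
  next
    fix p assume p: "degree p = k \<and> poly p 1 = 1 \<and> (\<forall>q. degree q < k \<longrightarrow> jacobi_integral n (p * q)
        = 0)"
    then obtain a where a: "p = (\<Sum>j\<le>k. smult (a j) (zonal_poly n j))"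
      using poly_zonal_expansion[OF assms, of p k] by auto
    have "a j = 0" if j: "j < k" for j
    proof -
      have "0 = jacobi_integral n (p * zonal_poly n j)"
        using p j by (simp add: degree_zonal_poly[OF assms])
      also have "\<dots> = (\<Sum>i\<le>k. a i * jacobi_integral n (zonal_poly n i * zonal_poly n j))"
        unfolding a by (simp add: sum_distrib_right jacobi_integral_sum[OF assms]
            jacobi_integral_smult)
      also have "\<dots> = (\<Sum>i\<le>k. if i = j then a j * jacobi_integral n (zonal_poly n j
          * zonal_poly n j) else 0)"
        by (intro sum.cong) (auto simp: zonal_poly_orthogonal[OF assms])
      also have "\<dots> = a j * jacobi_integral n (zonal_poly n j * zonal_poly n j)"
        using j by simp
      finally have "a j * jacobi_integral n (zonal_poly n j * zonal_poly n j) = 0" by simp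
      moreover have "zonal_poly n j \<noteq> 0" by (metis poly_0 poly_zonal_poly_1 zero_neq_one)
      ultimately show ?thesis using jacobi_integral_square_nonzero[OF assms] by simp
    qed
    then have "p = smult (a k) (zonal_poly n k)"
      unfolding a by (subst sum.remove[of _ k]) (auto intro!: sum.neutral)
    moreover from this have "a k = 1" using p by (metis mult.right_neutral poly_smult
        poly_zonal_poly_1)
    ultimately show "p = zonal_poly n k" by simp
  qed
qed

subsection \<open>Addition theorem\<close>

locale harmonic_basis =
  fixes Y :: "nat \<Rightarrow> nat \<Rightarrow> 'a::euclidean_space \<Rightarrow> real"
  assumes dim_ge_2: "DIM('a) \<ge> 2"
    and basis: "harmonic_orthonormal_basis Y"
begin

text \<open>The reproducing kernel of the degree-\<open>k\<close> harmonics for the surface measure;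
  as such it does not depend on the chosen basis.\<close>

definition Z :: "nat \<Rightarrow> 'a \<Rightarrow> 'a \<Rightarrow> real" where
  "Z k x y = (\<Sum>l=1..harmonic_dim TYPE('a) k. Y k l x * Y k l y)"

lemma Y_harmonic: "l \<in> {1..harmonic_dim TYPE('a) k} \<Longrightarrow> Y k l \<in> spherical_harmonics k"
  using basis by (auto simp: harmonic_orthonormal_basis_def)

lemma Y_orthonormal:
  "l \<in> {1..harmonic_dim TYPE('a) k} \<Longrightarrow> m \<in> {1..harmonic_dim TYPE('a) k} \<Longrightarrow>
    (\<integral>x. Y k l x * Y k m x \<partial>surface_measure) = (if l = m then 1 else 0)"
  using basis unfolding harmonic_orthonormal_basis_def by blast

lemma Y_outside: "l \<in> {1..harmonic_dim TYPE('a) k} \<Longrightarrow> x \<notin> sphere 0 1 \<Longrightarrow> Y k l x = 0"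
  using Y_harmonic spherical_harmonics_outside by blast

lemma integrable_harmonic_mult:
  assumes "f \<in> spherical_harmonics j" "g \<in> spherical_harmonics k"
  shows "integrable surface_measure (\<lambda>x. f x * g x)"
  using assms by (intro integrable_surface_continuous continuous_on_mult
      spherical_harmonics_continuous)

lemma harmonic_coeff_lincomb:
  assumes "l \<in> {1..harmonic_dim TYPE('a) k}"
  shows "harmonic_coeff Y (\<lambda>x. \<Sum>m=1..harmonic_dim TYPE('a) k. a m * Y k m x) k l = a l"
proof -
  have "harmonic_coeff Y (\<lambda>x. \<Sum>m=1..harmonic_dim TYPE('a) k. a m * Y k m x) k l
      = (\<integral>x. (\<Sum>m=1..harmonic_dim TYPE('a) k. a m * (Y k m x * Y k l x)) \<partial>surface_measure)"
    unfolding harmonic_coeff_def sum_distrib_right by (simp only: mult.assoc)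
  also have "\<dots> = (\<Sum>m=1..harmonic_dim TYPE('a) k. a m * (\<integral>x. Y k m x * Y k l x \<partial>surface_measure))"
    by (subst Bochner_Integration.integral_sum)
       (use assms in \<open>auto intro!: integrable_mult_right integrable_harmonic_mult Y_harmonic\<close>)
  also have "\<dots> = (\<Sum>m=1..harmonic_dim TYPE('a) k. if m = l then a l else 0)"
    using assms by (intro sum.cong) (auto simp: Y_orthonormal)
  also have "\<dots> = a l" using assms by simp
  finally show ?thesis .
qed

lemma harmonic_expansion:
  assumes "u \<in> spherical_harmonics k"
  shows "u x = (\<Sum>l=1..harmonic_dim TYPE('a) k. harmonic_coeff Y u k l * Y k l x)"
proof -
  obtain c where c: "\<And>x. u x = (\<Sum>l=1..harmonic_dim TYPE('a) k. c l * Y k l x)"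
    using basis assms unfolding harmonic_orthonormal_basis_def by blast
  then have u: "u = (\<lambda>x. \<Sum>l=1..harmonic_dim TYPE('a) k. c l * Y k l x)" by blast
  have "harmonic_coeff Y u k l = c l" if "l \<in> {1..harmonic_dim TYPE('a) k}" for l
    unfolding u by (rule harmonic_coeff_lincomb[OF that])
  then show ?thesis unfolding c by simp
qed

lemma harmonic_eqI:
  assumes "u \<in> spherical_harmonics k" "w \<in> spherical_harmonics k"
    "\<And>l. l \<in> {1..harmonic_dim TYPE('a) k} \<Longrightarrow> harmonic_coeff Y u k l = harmonic_coeff Y w k l"
  shows "u x = w x"
  unfolding harmonic_expansion[OF assms(1), of x] harmonic_expansion[OF assms(2), of x]
  using assms(3) by simp

lemma Z_outside: "norm x \<noteq> 1 \<Longrightarrow> Z k x y = 0"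
  unfolding Z_def by (rule sum.neutral) (auto simp: Y_outside)

lemma Z_harmonic: "Z k x \<in> spherical_harmonics k"
proof -
  have "Z k x = (\<lambda>y. \<Sum>l\<in>{1..harmonic_dim TYPE('a) k}. Y k l x * Y k l y)"
      by (simp add: Z_def fun_eq_iff)
  then show ?thesis
    using Y_harmonic by (auto intro!: spherical_harmonics_sum spherical_harmonics_cmult)
qed

lemma harmonic_coeff_Z: "l \<in> {1..harmonic_dim TYPE('a) k} \<Longrightarrow> harmonic_coeff Y (Z k x) k l = Y k l x"
  using harmonic_coeff_lincomb[of l k "\<lambda>l. Y k l x"] by (simp add: Z_def[abs_def])

lemma Z_reproducing:
  assumes "u \<in> spherical_harmonics k"
  shows "(\<integral>y. Z k x y * u y \<partial>surface_measure) = u x"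
proof -
  have "(\<integral>y. Z k x y * u y \<partial>surface_measure)
      = (\<integral>y. (\<Sum>l=1..harmonic_dim TYPE('a) k. Y k l x * (u y * Y k l y)) \<partial>surface_measure)"
    by (simp add: Z_def sum_distrib_right sum_distrib_left mult_ac)
  also have "\<dots> = (\<Sum>l=1..harmonic_dim TYPE('a) k. Y k l x * harmonic_coeff Y u k l)"
    unfolding harmonic_coeff_def
    by (subst Bochner_Integration.integral_sum)
       (use assms in \<open>auto intro!: integrable_mult_right integrable_harmonic_mult Y_harmonic\<close>)
  also have "\<dots> = u x" by (subst harmonic_expansion[OF assms, of x]) (simp add: mult.commute)
  finally show ?thesis .
qed

text \<open>The reflected kernel reproduces as well, since reflections preserve the harmonics and
  the surface measure, and a reproducing kernel is unique.\<close>

lemma Z_householder: "Z k (householder v x) (householder v y) = Z k x y"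
proof (rule harmonic_eqI)
  show "(\<lambda>y. Z k (householder v x) (householder v y)) \<in> spherical_harmonics k"
    by (rule spherical_harmonics_householder[OF Z_harmonic])
  show "Z k x \<in> spherical_harmonics k" by (rule Z_harmonic)
  fix l assume l: "l \<in> {1..harmonic_dim TYPE('a) k}"
  have Yh: "(\<lambda>y. Y k l (householder v y)) \<in> spherical_harmonics k"
    by (rule spherical_harmonics_householder[OF Y_harmonic[OF l]])
  have "harmonic_coeff Y (\<lambda>y. Z k (householder v x) (householder v y)) k l
      = (\<integral>y. Z k (householder v x) y * Y k l (householder v y) \<partial>surface_measure)"
    unfolding harmonic_coeff_def
    using surface_integral_householder[of "\<lambda>y. Z k (householder v x) y * Y k l (householder v y)" v]
      integrable_harmonic_mult[OF Z_harmonic Yh] by simp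
  also have "\<dots> = Y k l x" using Z_reproducing[OF Yh, of "householder v x"] by simp
  finally show "harmonic_coeff Y (\<lambda>y. Z k (householder v x) (householder v y)) k l
      = harmonic_coeff Y (Z k x) k l"
    by (simp add: harmonic_coeff_Z[OF l])
qed

lemma exists_householder:
  fixes x y :: 'a
  assumes "norm x = 1" "norm y = 1"
  obtains v where "householder v x = y" "householder v y = x"
  using householder_swap[of x y] assms that[of "x - y"] householder_invol by metis

lemma legendre_zonal: "legendre_poly DIM('a) k = zonal_poly DIM('a) k"
  by (rule legendre_poly_eq_zonal_poly[OF dim_ge_2])

lemma zonal_harmonic_legendre:
  fixes e y :: 'a
  assumes "norm e = 1" "norm y = 1" "u \<in> spherical_harmonics k"
    and "\<And>v y. v \<bullet> e = 0 \<Longrightarrow> u (householder v y) = u y"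
  shows "u y = u e * poly (legendre_poly DIM('a) k) (e \<bullet> y)"
  unfolding legendre_zonal by (rule zonal_harmonic_eq) (use assms dim_ge_2 in auto)

text \<open>By transitivity of the reflections the diagonal is constant, and its integral counts the
  basis functions.\<close>

lemma Z_diag:
  assumes "norm x = 1"
  shows "Z k x x = real (harmonic_dim TYPE('a) k) / sphere_volume TYPE('a)"
proof -
  have const: "Z k y y = Z k x x" if "norm y = 1" for y
    using exists_householder[OF that assms] Z_householder by metis
  have "real (harmonic_dim TYPE('a) k) = (\<Sum>l=1..harmonic_dim TYPE('a) k. (\<integral>y. Y k l y
      * Y k l y \<partial>surface_measure))"
    by (simp add: Y_orthonormal)
  also have "\<dots> = (\<integral>y. Z k y y \<partial>surface_measure)"
    unfolding Z_def by (subst Bochner_Integration.integral_sum)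
        (auto intro!: integrable_harmonic_mult Y_harmonic)
  also have "\<dots> = (\<integral>y. Z k x x \<partial>(surface_measure :: 'a measure))"
    by (intro Bochner_Integration.integral_cong) (auto simp: const)
  also have "\<dots> = sphere_volume TYPE('a) * Z k x x"
    by (simp add: sphere_volume_def)
  finally show ?thesis using sphere_volume_pos[where 'a = 'a] by simp
qed

theorem addition_theorem:
  assumes "norm x = 1" "norm y = 1"
  shows "Z k x y = real (harmonic_dim TYPE('a) k) / sphere_volume TYPE('a) * poly
      (legendre_poly DIM('a) k) (x \<bullet> y)"
proof -
  have "Z k x y = Z k x x * poly (legendre_poly DIM('a) k) (x \<bullet> y)"
  proof (rule zonal_harmonic_legendre[OF assms Z_harmonic])
    fix v y assume "v \<bullet> x = 0"
    then have "householder v x = x" by (intro householder_fix) (simp add: inner_commute)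
    then show "Z k x (householder v y) = Z k x y" using Z_householder[of k v x y] by simp
  qed
  then show ?thesis using Z_diag[OF assms(1)] by simp
qed

lemma legendre_poly_one: "poly (legendre_poly DIM('a) k) 1 = 1"
  by (simp add: legendre_zonal)

lemma legendre_harmonic:
  fixes x :: 'a
  assumes "norm x = 1"
  shows "sphere_restrict (\<lambda>y. poly (legendre_poly DIM('a) k) (x \<bullet> y)) \<in> spherical_harmonics k"
  unfolding legendre_zonal by (rule zonal_poly_harmonic[OF assms dim_ge_2])

text \<open>The zonal Legendre function takes the value 1 at its pole, so the space is not zero.
  This justifies the later divisions by \<open>harmonic_dim\<close>.\<close>

lemma hdim_pos: "harmonic_dim TYPE('a) k > 0"
proof (rule ccontr)
  assume "\<not> harmonic_dim TYPE('a) k > 0"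
  obtain x :: 'a where x: "norm x = 1" using vector_choose_size[of 1] by auto
  let ?u = "sphere_restrict (\<lambda>y::'a. poly (legendre_poly DIM('a) k) (x \<bullet> y))"
  have "?u x = 0"
    using harmonic_expansion[OF legendre_harmonic[OF x], where x
        = x] \<open>\<not> harmonic_dim TYPE('a) k > 0\<close> by simp
  then show False using x legendre_poly_one by (simp add: sphere_restrict_def norm_eq_1)
qed

lemma Y_orthogonal:
  assumes "j \<noteq> k" and l: "l \<in> {1..harmonic_dim TYPE('a) k}" and m: "m
      \<in> {1..harmonic_dim TYPE('a) j}"
  shows "(\<integral>x. Y k l x * Y j m x \<partial>surface_measure) = 0"
proof -
  \<comment> \<open>In \<open>x\<close> this is a harmonic of degree \<open>k\<close>, in
    \<open>e\<close> one of degree \<open>j\<close>; each view makes it a constant times the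
    Legendre polynomial of that degree in \<open>x \<bullet> e\<close>.\<close>
  define G where "G x e = (\<integral>y. Z k x y * Z j e y \<partial>surface_measure)" for x e
  have Gh: "G (householder v x) (householder v e) = G x e" for v x e
  proof -
    have "G (householder v x) (householder v e)
        = (\<integral>y. Z k (householder v x) (householder v y) * Z j (householder v e)
        (householder v y) \<partial>surface_measure)"
      unfolding G_def
      using surface_integral_householder[of "\<lambda>y. Z k (householder v x) y * Z j
          (householder v e) y" v]
        integrable_harmonic_mult[OF Z_harmonic Z_harmonic] by simp
    then show ?thesis by (simp add: Z_householder G_def)
  qed
  have Gx: "G x e = (\<Sum>l=1..harmonic_dim TYPE('a) k. (\<integral>y. Y k l y * Z j e y \<partial>surface_measure)
      * Y k l x)" for x e
  proof -
    have "G x e = (\<integral>y. (\<Sum>l=1..harmonic_dim TYPE('a) k. Y k l x * (Y k l y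
        * Z j e y)) \<partial>surface_measure)"
      by (simp add: G_def Z_def sum_distrib_right mult.assoc)
    also have "\<dots> = (\<Sum>l=1..harmonic_dim TYPE('a) k. Y k l x * (\<integral>y. Y k l y
        * Z j e y \<partial>surface_measure))"
      by (subst Bochner_Integration.integral_sum)
         (auto intro!: integrable_mult_right integrable_harmonic_mult Y_harmonic Z_harmonic)
    finally show ?thesis by (simp add: mult.commute)
  qed
  have Ge: "G x e = (\<Sum>m=1..harmonic_dim TYPE('a) j. (\<integral>y. Z k x y * Y j m y \<partial>surface_measure)
      * Y j m e)" for x e
  proof -
    have "G x e = (\<integral>y. (\<Sum>m=1..harmonic_dim TYPE('a) j. Y j m e * (Z k x y
        * Y j m y)) \<partial>surface_measure)"
      unfolding G_def Z_def[of j] sum_distrib_left by (simp add: mult_ac)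
    also have "\<dots> = (\<Sum>m=1..harmonic_dim TYPE('a) j. Y j m e * (\<integral>y. Z k x y
        * Y j m y \<partial>surface_measure))"
      by (subst Bochner_Integration.integral_sum)
         (auto intro!: integrable_mult_right integrable_harmonic_mult Y_harmonic Z_harmonic)
    finally show ?thesis by (simp add: mult.commute)
  qed
  have fixv: "householder v e = e" if "v \<bullet> e = 0" for v e :: 'a
    using that by (intro householder_fix) (simp add: inner_commute)
  obtain e :: 'a where e: "norm e = 1" using vector_choose_size[of 1] by auto
  define \<tau> where "\<tau> = G e e"
  have diag: "G x x = \<tau>" if "norm x = 1" for x
    using exists_householder[OF that e] Gh unfolding \<tau>_def by metis
  have G1: "G x y = \<tau> * poly (legendre_poly DIM('a) k) (x \<bullet> y)" if x: "norm x = 1" and y: "norm y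
      = 1" for x y
  proof -
    have "(\<lambda>x. G x y) x = (\<lambda>x. G x y) y * poly (legendre_poly DIM('a) k) (y \<bullet> x)"
    proof (rule zonal_harmonic_legendre[OF y x])
      show "(\<lambda>x. G x y) \<in> spherical_harmonics k"
        unfolding Gx using Y_harmonic by (intro spherical_harmonics_sum spherical_harmonics_cmult)
            auto
      show "G (householder v x) y = G x y" if "v \<bullet> y = 0" for v x
        using Gh[of v x y] fixv[OF that] by simp
    qed
    then show ?thesis using diag[OF y] by (simp add: inner_commute)
  qed
  have G2: "G x y = \<tau> * poly (legendre_poly DIM('a) j) (x \<bullet> y)" if x: "norm x = 1" and y: "norm y
      = 1" for x y
  proof -
    have "G x y = G x x * poly (legendre_poly DIM('a) j) (x \<bullet> y)"
    proof (rule zonal_harmonic_legendre[OF x y])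
      show "G x \<in> spherical_harmonics j"
        unfolding Ge[abs_def] using Y_harmonic
            by (intro spherical_harmonics_sum spherical_harmonics_cmult) auto
      show "G x (householder v y) = G x y" if "v \<bullet> x = 0" for v y
        using Gh[of v x y] fixv[OF that] by simp
    qed
    then show ?thesis using diag[OF x] by simp
  qed
  have "\<tau> = 0"
  proof (rule ccontr)
    assume "\<tau> \<noteq> 0"
    obtain f :: 'a where f: "norm f = 1" "e \<bullet> f = 0" using exists_orthogonal_unit[OF dim_ge_2]
        by blast
    have "poly (legendre_poly DIM('a) k) t = poly (legendre_poly DIM('a) j) t" if t: "t \<in> {-1..1}"
        for t
    proof -
      \<comment> \<open>A unit vector with inner product \<open>t\<close> with \<open>e\<close>, so
        the two Legendre polynomials agree on all of \<open>[-1, 1]\<close> if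
        \<open>\<tau> \<noteq> 0\<close>.\<close>
      define x where "x = t *\<^sub>R e + sqrt (1 - t\<^sup>2) *\<^sub>R f"
      have "t\<^sup>2 \<le> 1" using t by (auto simp: abs_square_le_1)
      then have "x \<bullet> x = 1"
        using e f by (simp add: x_def inner_simps inner_commute[of f e] norm_eq_1
            power2_eq_square[symmetric])
      moreover have "e \<bullet> x = t" using e f by (simp add: x_def inner_simps norm_eq_1)
      ultimately show ?thesis
        using G1[OF e, of x] G2[OF e, of x] \<open>\<tau> \<noteq> 0\<close> by (simp add: norm_eq_1)
    qed
    then have "{-1..1} \<subseteq> {t. poly (legendre_poly DIM('a) k - legendre_poly DIM('a) j) t = 0}"
        by auto
    moreover have "infinite {-1..1::real}" by (simp add: infinite_Icc)
    ultimately have "legendre_poly DIM('a) k - legendre_poly DIM('a) j = 0"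
      using poly_roots_finite finite_subset by blast
    then have "degree (zonal_poly DIM('a) k) = degree (zonal_poly DIM('a) j)"
      by (simp add: legendre_zonal)
    then show False using assms(1) by (simp add: degree_zonal_poly[OF dim_ge_2])
  qed
  then have G0: "G x e = 0" for x e
  proof (cases "norm x = 1 \<and> norm e = 1")
    case False
    then have "Z k x = (\<lambda>_. 0) \<or> Z j e = (\<lambda>_. 0)" by (auto simp: fun_eq_iff Z_outside)
    then show ?thesis by (auto simp: G_def)
  qed (simp add: G1 \<open>\<tau> = 0\<close>)
  \<comment> \<open>The coefficients of the vanishing kernel are extracted first in
    \<open>x\<close>, then in \<open>e\<close>.\<close>
  have *: "(\<integral>y. Y k l y * Z j e y \<partial>surface_measure) = 0" for e
  proof -
    have "(\<integral>y. Y k l y * Z j e y \<partial>surface_measure) = harmonic_coeff Y (\<lambda>x. G x e) k l"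
      unfolding Gx by (rule harmonic_coeff_lincomb[OF l, symmetric])
    then show ?thesis by (simp add: G0 harmonic_coeff_def)
  qed
  have "(\<integral>y. Y k l y * Y j m y \<partial>surface_measure)
      = harmonic_coeff Y (\<lambda>e. \<Sum>m=1..harmonic_dim TYPE('a) j. (\<integral>y. Y k l y
      * Y j m y \<partial>surface_measure) * Y j m e) j m"
    by (rule harmonic_coeff_lincomb[OF m, symmetric])
  also have "(\<lambda>e. \<Sum>m=1..harmonic_dim TYPE('a) j. (\<integral>y. Y k l y * Y j m y \<partial>surface_measure) * Y j m e)
      = (\<lambda>e. \<integral>y. Y k l y * Z j e y \<partial>surface_measure)"
  proof
    fix e
    have "(\<integral>y. Y k l y * Z j e y \<partial>surface_measure)
        = (\<integral>y. (\<Sum>m=1..harmonic_dim TYPE('a) j. Y j m e * (Y k l y * Y j m y)) \<partial>surface_measure)"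
      unfolding Z_def[of j] sum_distrib_left by (simp add: mult_ac)
    also have "\<dots> = (\<Sum>m=1..harmonic_dim TYPE('a) j. Y j m e * (\<integral>y. Y k l y
        * Y j m y \<partial>surface_measure))"
      by (subst Bochner_Integration.integral_sum)
         (use l in \<open>auto intro!: integrable_mult_right integrable_harmonic_mult Y_harmonic\<close>)
    finally show "(\<Sum>m=1..harmonic_dim TYPE('a) j. (\<integral>y. Y k l y * Y j m y \<partial>surface_measure)
        * Y j m e)
      = (\<integral>y. Y k l y * Z j e y \<partial>surface_measure)" by (simp add: mult.commute)
  qed
  finally show ?thesis by (simp add: * harmonic_coeff_def)
qed

end

subsection \<open>Multipliers of the cap kernels\<close>

text \<open>The Funk-Hecke eigenvalue of the kernel \<open>poly q (x \<bullet> y)\<close> on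
  harmonics of degree \<open>k\<close>. By \<open>multiplier_expansion\<close> it is the same for
  every unit vector \<open>e\<close>.\<close>

definition multiplier :: "'a::euclidean_space \<Rightarrow> real poly \<Rightarrow> nat \<Rightarrow> real" where
  "multiplier e q k =
     (\<integral>y. poly q (e \<bullet> y) * poly (legendre_poly DIM('a) k) (e \<bullet> y) \<partial>surface_measure)"

text \<open>On the sphere \<open>(1 + x \<bullet> y) / 2\<close> equals 1 minus a quarter of the
  squared distance of \<open>x\<close> and \<open>y\<close>. It lies in \<open>[0, 1]\<close> and is
  1 only for \<open>x = y\<close>, so its powers decrease in \<open>M\<close> and concentrate on the
  diagonal.\<close>

definition cap_poly :: "nat \<Rightarrow> real poly" where
  "cap_poly M = [:1 / 2, 1 / 2:] ^ M"

lemma poly_cap_poly: "poly (cap_poly M) t = ((1 + t) / 2) ^ M"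
  by (simp add: cap_poly_def poly_power add_divide_distrib)

lemma degree_cap_poly: "degree (cap_poly M) = M"
  by (simp add: cap_poly_def degree_power_eq)

text \<open>In the variable \<open>s = (1 + t) / 2\<close> one has
  \<open>1 - t^2 = 4 * s * (1 - s)\<close>, so the operator lowers the exponent of a power of
  \<open>s\<close> by at most one.\<close>

lemma gegenbauer_op_cap_poly:
  "gegenbauer_op n (cap_poly (Suc M))
    = smult (real (Suc M) * (real M + (real n - 1) / 2)) (cap_poly M)
      - smult (real (Suc M) * (real (Suc M) + real n - 2)) (cap_poly (Suc M))"
proof (rule poly_ext)
  fix t :: real
  define s where "s = (1 + t) / 2"
  have t: "t = 2 * s - 1" by (simp add: s_def field_simps)
  have d: "pderiv (cap_poly m) = smult (real m / 2) (cap_poly (m - 1))" for m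
    by (simp add: cap_poly_def pderiv_power pderiv_pCons)
  have p: "poly (cap_poly m) t = s ^ m" for m by (simp add: poly_cap_poly s_def)
  show "poly (gegenbauer_op n (cap_poly (Suc M))) t
      = poly (smult (real (Suc M) * (real M + (real n - 1) / 2)) (cap_poly M)
      - smult (real (Suc M) * (real (Suc M) + real n - 2)) (cap_poly (Suc M))) t"
    unfolding poly_gegenbauer_op d pderiv_smult poly_smult poly_diff p
    by (cases M) (simp_all add: t power2_eq_square field_simps)
qed

section \<open>Funk-Hecke multipliers and their recurrence\<close>

context harmonic_basis
begin

lemma Z_orthogonal:
  assumes "j \<noteq> k"
  shows "(\<integral>y. Z k x y * Z j e y \<partial>surface_measure) = 0"
proof -
  have "(\<integral>y. Z k x y * Z j e y \<partial>surface_measure)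
      = (\<integral>y. (\<Sum>l=1..harmonic_dim TYPE('a) k. \<Sum>m=1..harmonic_dim TYPE('a) j.
          Y k l x * Y j m e * (Y k l y * Y j m y)) \<partial>surface_measure)"
    unfolding Z_def sum_product by (intro Bochner_Integration.integral_cong sum.cong refl) simp
  also have "\<dots> = (\<Sum>l=1..harmonic_dim TYPE('a) k. \<Sum>m=1..harmonic_dim TYPE('a) j.
          Y k l x * Y j m e * (\<integral>y. Y k l y * Y j m y \<partial>surface_measure))"
  proof -
    have int: "integrable surface_measure (\<lambda>y. Y k l x * Y j m e * (Y k l y * Y j m y))"
      if "l \<in> {1..harmonic_dim TYPE('a) k}" "m \<in> {1..harmonic_dim TYPE('a) j}" for l m
      by (intro integrable_mult_right integrable_harmonic_mult[OF Y_harmonic Y_harmonic] that)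
    have inner: "(\<integral>y. (\<Sum>m=1..harmonic_dim TYPE('a) j. Y k l x * Y j m e * (Y k l y
        * Y j m y)) \<partial>surface_measure)
        = (\<Sum>m=1..harmonic_dim TYPE('a) j. Y k l x * Y j m e * (\<integral>y. Y k l y
        * Y j m y \<partial>surface_measure))"
      if "l \<in> {1..harmonic_dim TYPE('a) k}" for l
      using int[OF that] by (subst Bochner_Integration.integral_sum)
          (simp_all del: integrable_mult_right_iff)
    show ?thesis
      by (subst Bochner_Integration.integral_sum)
         (auto simp del: integrable_mult_right_iff simp: inner[simplified]
           intro!: Bochner_Integration.integrable_sum int)
  qed
  also have "\<dots> = 0"
    by (intro sum.neutral ballI) (simp add: Y_orthogonal[OF assms])
  finally show ?thesis .
qed

lemma legendre_eq_Z:
  assumes "norm x = 1" "norm y = 1"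
  shows "poly (legendre_poly DIM('a) k) (x \<bullet> y)
      = sphere_volume TYPE('a) / real (harmonic_dim TYPE('a) k) * Z k x y"
  using addition_theorem[OF assms, of k] hdim_pos[of k] sphere_volume_pos[where 'a = 'a]
      by (simp add: field_simps)

lemma poly_legendre_expansion:
  assumes "degree q \<le> M"
  obtains a where "q = (\<Sum>j\<le>M. smult (a j) (legendre_poly DIM('a) j))"
  using poly_zonal_expansion[OF dim_ge_2 assms] unfolding legendre_zonal by blast

lemma integrable_surface_poly_mult:
  fixes e x :: 'a
  shows "integrable surface_measure (\<lambda>y. poly p (e \<bullet> y) * poly q (x \<bullet> y))"
  by (intro integrable_surface_continuous continuous_intros)

lemma multiplier_expansion:
  fixes e :: 'a
  assumes e: "norm e = 1" and q: "q = (\<Sum>j\<le>M. smult (a j) (legendre_poly DIM('a) j))" and k: "k \<le> M"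
  shows "multiplier e q k = a k * sphere_volume TYPE('a) / real (harmonic_dim TYPE('a) k)"
proof -
  define c where "c j = sphere_volume TYPE('a) / real (harmonic_dim TYPE('a) j)" for j
  have L: "poly (legendre_poly DIM('a) j) (e \<bullet> y) = c j * Z j e y" if "norm y = 1" for j y
    unfolding c_def by (rule legendre_eq_Z[OF e that])
  have "multiplier e q k = (\<integral>y. (\<Sum>j\<le>M. a j * (poly (legendre_poly DIM('a) j) (e \<bullet> y) * poly
      (legendre_poly DIM('a) k) (e \<bullet> y))) \<partial>surface_measure)"
    by (simp add: multiplier_def q poly_sum sum_distrib_right mult.assoc)
  also have "\<dots> = (\<Sum>j\<le>M. a j * (\<integral>y. poly (legendre_poly DIM('a) j) (e \<bullet> y) * poly
      (legendre_poly DIM('a) k) (e \<bullet> y) \<partial>surface_measure))"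
    by (subst Bochner_Integration.integral_sum) (auto intro!: integrable_mult_right
        integrable_surface_poly_mult)
  also have "\<dots> = (\<Sum>j\<le>M. a j * (c j * c k * (\<integral>y. Z j e y * Z k e y \<partial>surface_measure)))"
  proof (intro sum.cong refl arg_cong2[where f = "(*)"])
    fix j
    have "(\<integral>y. poly (legendre_poly DIM('a) j) (e \<bullet> y) * poly (legendre_poly DIM('a) k)
        (e \<bullet> y) \<partial>surface_measure)
        = (\<integral>y. c j * c k * (Z j e y * Z k e y) \<partial>surface_measure)"
      by (intro Bochner_Integration.integral_cong) (auto simp: L)
    then show "(\<integral>y. poly (legendre_poly DIM('a) j) (e \<bullet> y) * poly (legendre_poly DIM('a) k)
        (e \<bullet> y) \<partial>surface_measure)
        = c j * c k * (\<integral>y. Z j e y * Z k e y \<partial>surface_measure)" by simp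
  qed
  also have "\<dots> = (\<Sum>j\<le>M. if j = k then a k * (c k * c k * Z k e e) else 0)"
  proof (rule sum.cong[OF refl])
    fix j show "a j * (c j * c k * (\<integral>y. Z j e y * Z k e y \<partial>surface_measure)) = (if j
        = k then a k * (c k * c k * Z k e e) else 0)"
      using Z_orthogonal[of k j e e] Z_reproducing[OF Z_harmonic, of k e e] by auto
  qed
  also have "\<dots> = a k * (c k * (c k * Z k e e))" using k by simp
  also have "c k * Z k e e = 1"
    using Z_diag[OF e, of k] hdim_pos[of k] sphere_volume_pos[where 'a = 'a] by (simp add: c_def)
  finally show ?thesis by (simp add: c_def)
qed

lemma poly_Z_expansion:
  fixes e :: 'a
  assumes e: "norm e = 1" and q: "degree q \<le> M" and x: "norm x = 1" and y: "norm y = 1"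
  shows "poly q (x \<bullet> y) = (\<Sum>k\<le>M. multiplier e q k * Z k x y)"
proof -
  obtain a where a: "q = (\<Sum>j\<le>M. smult (a j) (legendre_poly DIM('a) j))"
    using poly_legendre_expansion[OF q] by blast
  have "poly q (x \<bullet> y) = (\<Sum>j\<le>M. a j * poly (legendre_poly DIM('a) j) (x \<bullet> y))"
    by (subst a) (simp add: poly_sum)
  also have "\<dots> = (\<Sum>k\<le>M. multiplier e q k * Z k x y)"
    by (intro sum.cong) (auto simp: multiplier_expansion[OF e a] legendre_eq_Z[OF x y])
  finally show ?thesis .
qed

text \<open>Obtained on Legendre coefficients, where the operator is diagonal, instead of
  integrating by parts on the sphere.\<close>

lemma multiplier_gegenbauer:
  fixes e :: 'a
  assumes e: "norm e = 1"
  shows "multiplier e (gegenbauer_op DIM('a) q) k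
      = - (real k * (real k + real DIM('a) - 2)) * multiplier e q k"
proof -
  define M where "M = max (degree q) k"
  obtain a where a: "q = (\<Sum>j\<le>M. smult (a j) (legendre_poly DIM('a) j))"
    using poly_legendre_expansion[of q M] unfolding M_def by auto
  have "gegenbauer_op DIM('a) q = (\<Sum>j\<le>M. smult (- (real j * (real j + real DIM('a) - 2)) * a j)
      (legendre_poly DIM('a) j))"
    by (subst a) (simp add: gegenbauer_op_sum gegenbauer_op_smult legendre_zonal
        gegenbauer_op_zonal_poly[OF dim_ge_2] mult_ac)
  from multiplier_expansion[OF e this, of k] multiplier_expansion[OF e a, of k]
  show ?thesis by (simp add: M_def)
qed

lemma multiplier_lincomb:
  fixes e :: 'a
  shows "multiplier e (smult c p - smult d q) k = c * multiplier e p k - d * multiplier e q k"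
  unfolding multiplier_def
  by (simp add: left_diff_distrib mult.assoc integrable_surface_poly_mult)

lemma cap_multiplier_rec:
  fixes e :: 'a
  assumes e: "norm e = 1"
  shows "(real (Suc M) * (real (Suc M) + real DIM('a) - 2) - real k * (real k + real DIM('a) - 2))
      * multiplier e (cap_poly (Suc M)) k
    = real (Suc M) * (real M + (real DIM('a) - 1) / 2) * multiplier e (cap_poly M) k"
  using multiplier_gegenbauer[OF e, of "cap_poly (Suc M)" k]
  unfolding gegenbauer_op_cap_poly multiplier_lincomb by (simp add: algebra_simps)

lemma cap_multiplier_0:
  fixes e :: 'a
  assumes e: "norm e = 1"
  shows "(real (Suc M) + real DIM('a) - 2) * multiplier e (cap_poly (Suc M)) 0
      = (real M + (real DIM('a) - 1) / 2) * multiplier e (cap_poly M) 0"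
    and "multiplier e (cap_poly M) 0 > 0"
proof -
  have rec: "(real (Suc M) + real DIM('a) - 2) * multiplier e (cap_poly (Suc M)) 0
      = (real M + (real DIM('a) - 1) / 2) * multiplier e (cap_poly M) 0" for M
  proof -
    have "real (Suc M) * ((real (Suc M) + real DIM('a) - 2) * multiplier e (cap_poly (Suc M)) 0)
      = real (Suc M) * ((real M + (real DIM('a) - 1) / 2) * multiplier e (cap_poly M) 0)"
      using cap_multiplier_rec[OF e, of M 0] by (simp add: mult.assoc del: of_nat_Suc)
    then show ?thesis by (simp del: of_nat_Suc)
  qed
  then show "(real (Suc M) + real DIM('a) - 2) * multiplier e (cap_poly (Suc M)) 0
      = (real M + (real DIM('a) - 1) / 2) * multiplier e (cap_poly M) 0" .
  show "multiplier e (cap_poly M) 0 > 0"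
  proof (induction M)
    case 0
    have "legendre_poly DIM('a) 0 = 1" by (simp add: legendre_zonal zonal_poly_def monom_0
        one_pCons)
    then have "multiplier e (cap_poly 0) 0 = sphere_volume TYPE('a)"
      by (simp add: multiplier_def cap_poly_def sphere_volume_def)
    then show ?case using sphere_volume_pos by metis
  next
    case (Suc M)
    have n: "real DIM('a) \<ge> 2" using dim_ge_2 by simp
    have "(real M + (real DIM('a) - 1) / 2) * multiplier e (cap_poly M) 0 > 0"
      using Suc n by (intro mult_pos_pos add_nonneg_pos) auto
    then have "(real (Suc M) + real DIM('a) - 2) * multiplier e (cap_poly (Suc M)) 0 > 0"
      using rec[of M] by simp
    moreover have "real (Suc M) + real DIM('a) - 2 > 0" using n by simp
    ultimately show ?case by (simp add: zero_less_mult_iff del: of_nat_Suc)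
  qed
qed

text \<open>Solving \<open>cap_ratio_rec\<close> from the limit 1 gives the product over
  \<open>m > M\<close> of \<open>1 - L / (m * (m + n - 2))\<close> with
  \<open>L = k * (k + n - 2)\<close> and \<open>n\<close> the dimension of the space. This is about
  \<open>exp (- L / M)\<close>, the sense in which \<open>1 / M\<close> is a heat time.\<close>

definition cap_ratio :: "'a \<Rightarrow> nat \<Rightarrow> nat \<Rightarrow> real" where
  "cap_ratio e k M = multiplier e (cap_poly M) k / multiplier e (cap_poly M) 0"

lemma cap_ratio_rec:
  fixes e :: 'a
  assumes e: "norm e = 1"
  shows "cap_ratio e k M = cap_ratio e k (Suc M)
    * (1 - real k * (real k + real DIM('a) - 2) / (real (Suc M) * (real (Suc M) + real DIM('a)
    - 2)))"
proof -
  define m where "m = real (Suc M)"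
  define g where "g = m + real DIM('a) - 2"
  define h where "h = real M + (real DIM('a) - 1) / 2"
  define L where "L = real k * (real k + real DIM('a) - 2)"
  define A A' B B' where "A = multiplier e (cap_poly M) k" and "A'
      = multiplier e (cap_poly (Suc M)) k"
    and "B = multiplier e (cap_poly M) 0" and "B' = multiplier e (cap_poly (Suc M)) 0"
  have n: "real DIM('a) \<ge> 2" using dim_ge_2 by simp
  have pos: "m > 0" "g > 0" "h > 0" "B > 0" "B' > 0"
    using n cap_multiplier_0(2)[OF e] by (auto simp: m_def g_def h_def B_def B'_def intro!:
        add_nonneg_pos)
  have 1: "(m * g - L) * A' = m * h * A"
    using cap_multiplier_rec[OF e, of M k] unfolding m_def g_def h_def L_def A_def A'_def .
  have 2: "g * B' = h * B"
    using cap_multiplier_0(1)[OF e, of M] unfolding m_def g_def h_def B_def B'_def .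
  have "A / B = (m * h * A) / (m * (h * B))" using pos by simp
  also have "\<dots> = A' / B' * (1 - L / (m * g))"
    unfolding 1[symmetric] 2[symmetric] using pos by (simp add: field_simps)
  finally show ?thesis
    unfolding cap_ratio_def A_def A'_def B_def B'_def L_def g_def m_def .
qed

text \<open>The Legendre polynomial minus 1 is divisible by \<open>1 - t\<close>, and the mean of
  \<open>1 - t\<close> under the kernel is of order \<open>1 / M\<close>: with
  \<open>s = (1 + t) / 2\<close>, \<open>(1 - t) * s ^ M\<close> is
  \<open>2 * (s ^ M - s ^ Suc M)\<close>, and the degree-0 recurrence compares the two
  masses.\<close>

lemma cap_ratio_tendsto:
  fixes e :: 'a
  assumes e: "norm e = 1"
  shows "cap_ratio e k \<longlonglongrightarrow> 1"
proof -
  define n where "n = real DIM('a)"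
  have n: "n \<ge> 2" using dim_ge_2 by (simp add: n_def)
  define Pk where "Pk = legendre_poly DIM('a) k"
  have "poly (Pk - 1) 1 = 0" by (simp add: Pk_def legendre_poly_one)
  then have "[:-1, 1:] dvd Pk - 1" by (simp only: poly_eq_0_iff_dvd)
  then obtain R where R: "Pk - 1 = [:-1, 1:] * R" by (elim dvdE)
  have "compact (poly R ` {-1..1})"
    by (intro compact_continuous_image continuous_intros) simp
  then have "bounded (poly R ` {-1..1})" by (rule compact_imp_bounded)
  then obtain C where C: "\<And>t. t \<in> {-1..1} \<Longrightarrow> \<bar>poly R t\<bar> \<le> C"
    unfolding bounded_iff by (metis imageI real_norm_def)
  have Pk: "\<bar>poly Pk t - 1\<bar> \<le> C * (1 - t)" if t: "t \<in> {-1..1}" for t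
  proof -
    have "poly Pk t - 1 = (t - 1) * poly R t"
      using arg_cong[OF R, of "\<lambda>p. poly p t"] by (simp add: algebra_simps)
    then have "\<bar>poly Pk t - 1\<bar> = (1 - t) * \<bar>poly R t\<bar>" using t by (simp add: abs_mult)
    moreover have "(1 - t) * \<bar>poly R t\<bar> \<le> (1 - t) * C"
      using C[OF t] t by (intro mult_left_mono) auto
    ultimately show ?thesis by (simp add: mult.commute)
  qed
  have P0: "legendre_poly DIM('a) 0 = 1" by (simp add: legendre_zonal zonal_poly_def monom_0
      one_pCons)
  have int: "integrable surface_measure (\<lambda>y. poly p (e \<bullet> y))" for p
    by (intro integrable_surface_continuous continuous_intros)
  have m0: "multiplier e p 0 = (\<integral>y. poly p (e \<bullet> y) \<partial>surface_measure)" for p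
    by (simp add: multiplier_def P0)
  have bound: "\<bar>cap_ratio e k M - 1\<bar> \<le> C * ((n - 1) / (real M + n - 1))" for M
  proof -
    define B where "B = multiplier e (cap_poly M) 0"
    have B: "B > 0" unfolding B_def by (rule cap_multiplier_0(2)[OF e])
    have "\<bar>multiplier e (cap_poly M) k - B\<bar>
        = \<bar>\<integral>y. poly (cap_poly M * (Pk - 1)) (e \<bullet> y) \<partial>surface_measure\<bar>"
      unfolding B_def m0 unfolding multiplier_def Pk_def[symmetric]
      by (subst Bochner_Integration.integral_diff[symmetric])
         (auto intro!: integrable_surface_poly_mult int simp: algebra_simps)
    also have "\<dots> \<le> (\<integral>y. \<bar>poly (cap_poly M * (Pk - 1)) (e \<bullet> y)\<bar> \<partial>surface_measure)"
      by (rule integral_abs_bound)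
    also have "\<dots> \<le> (\<integral>y. poly (smult (2 * C) (cap_poly M - cap_poly (Suc M)))
        (e \<bullet> y) \<partial>surface_measure)"
    proof (rule integral_mono)
      show "integrable surface_measure (\<lambda>y. \<bar>poly (cap_poly M * (Pk - 1)) (e \<bullet> y)\<bar>)"
        by (intro integrable_abs int)
      show "integrable surface_measure (\<lambda>y. poly (smult (2 * C) (cap_poly M - cap_poly (Suc M)))
          (e \<bullet> y))"
        by (rule int)
      fix y :: 'a assume "y \<in> space surface_measure"
      then have "\<bar>e \<bullet> y\<bar> \<le> 1" using Cauchy_Schwarz_ineq2[of e y] e by simp
      then have t: "e \<bullet> y \<in> {-1..1}" by auto
      have "\<bar>poly (cap_poly M * (Pk - 1)) (e \<bullet> y)\<bar>
          = poly (cap_poly M) (e \<bullet> y) * \<bar>poly Pk (e \<bullet> y) - 1\<bar>"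
        using t by (simp add: abs_mult poly_cap_poly)
      also have "\<dots> \<le> poly (cap_poly M) (e \<bullet> y) * (C * (1 - e \<bullet> y))"
        using Pk[OF t] t by (intro mult_left_mono) (auto simp: poly_cap_poly)
      also have "\<dots> = poly (smult (2 * C) (cap_poly M - cap_poly (Suc M))) (e \<bullet> y)"
        by (simp add: poly_cap_poly field_simps)
      finally show "\<bar>poly (cap_poly M * (Pk - 1)) (e \<bullet> y)\<bar>
          \<le> poly (smult (2 * C) (cap_poly M - cap_poly (Suc M))) (e \<bullet> y)" .
    qed
    also have "\<dots> = 2 * C * (B - multiplier e (cap_poly (Suc M)) 0)"
      unfolding B_def m0 using int by (simp add: Bochner_Integration.integral_diff)
    also have "multiplier e (cap_poly (Suc M)) 0 = (real M + (n - 1) / 2) / (real M + n - 1) * B"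
      using cap_multiplier_0(1)[OF e, of M] n by (simp add: B_def n_def field_simps)
    also have "2 * C * (B - (real M + (n - 1) / 2) / (real M + n - 1) * B)
        = C * ((n - 1) / (real M + n - 1)) * B"
    proof -
      have "real M + n - 1 > 0" using n by linarith
      then show ?thesis by (simp add: field_simps)
    qed
    finally have "\<bar>multiplier e (cap_poly M) k - B\<bar> / B \<le> C * ((n - 1) / (real M + n - 1))"
      using B by (simp add: divide_le_eq)
    moreover have "cap_ratio e k M - 1 = (multiplier e (cap_poly M) k - B) / B"
      using B by (simp add: cap_ratio_def B_def diff_divide_distrib)
    ultimately show ?thesis using B by simp
  qed
  have "(\<lambda>M. cap_ratio e k M - 1) \<longlonglongrightarrow> 0"
  proof (rule Lim_null_comparison)
    show "\<forall>\<^sub>F M in sequentially. norm (cap_ratio e k M - 1) \<le> C * ((n - 1) / (real M + n - 1))"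
      using bound by simp
    have "filterlim (\<lambda>M. real M + (n - 1)) at_top sequentially"
      using filterlim_tendsto_add_at_top[OF tendsto_const filterlim_real_sequentially, of "n - 1"]
          by (simp add: add.commute)
    then have "(\<lambda>M. (n - 1) / (real M + (n - 1))) \<longlonglongrightarrow> 0"
      by (rule real_tendsto_divide_at_top[OF tendsto_const])
    then show "(\<lambda>M. C * ((n - 1) / (real M + n - 1))) \<longlonglongrightarrow> 0"
      using tendsto_mult_left[of "\<lambda>M. (n - 1) / (real M + (n - 1))" 0 sequentially C]
      by (simp only: add_diff_eq mult_zero_right)
  qed
  then show ?thesis by (simp add: LIM_zero_iff)
qed

lemma cap_ratio_step_bounds:
  assumes "k \<le> M"
  shows "0 \<le> 1 - real k * (real k + real DIM('a) - 2) / (real (Suc M) * (real (Suc M) + real DIM('a)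
      - 2))"
    and "1 - real k * (real k + real DIM('a) - 2) / (real (Suc M) * (real (Suc M) + real DIM('a)
        - 2)) \<le> 1"
proof -
  have n: "real DIM('a) \<ge> 2" using dim_ge_2 by simp
  have le: "real k * (real k + real DIM('a) - 2) \<le> real (Suc M) * (real (Suc M) + real DIM('a) - 2)"
    using assms n by (intro mult_mono) auto
  have pos: "real (Suc M) * (real (Suc M) + real DIM('a) - 2) > 0"
    using n by (intro mult_pos_pos) auto
  have nn: "real k * (real k + real DIM('a) - 2) \<ge> 0" using n by (intro mult_nonneg_nonneg) auto
  show "0 \<le> 1 - real k * (real k + real DIM('a) - 2) / (real (Suc M) * (real (Suc M) + real DIM('a)
      - 2))"
    using le pos by (simp add: divide_le_eq_1 del: of_nat_Suc)
  show "1 - real k * (real k + real DIM('a) - 2) / (real (Suc M) * (real (Suc M) + real DIM('a)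
      - 2)) \<le> 1"
    using nn pos by (simp add: divide_nonneg_pos del: of_nat_Suc)
qed

text \<open>The ratios are positive near their limit 1, and each step down in \<open>M\<close>
  multiplies by a factor that \<open>k \<le> M\<close> keeps nonnegative.\<close>

lemma cap_ratio_nonneg:
  fixes e :: 'a
  assumes e: "norm e = 1" and "k \<le> M"
  shows "0 \<le> cap_ratio e k M"
proof -
  have "\<forall>\<^sub>F N in sequentially. cap_ratio e k N > 0"
    using order_tendstoD(1)[OF cap_ratio_tendsto[OF e, of k], of 0] by simp
  then obtain N0 where N0: "\<And>N. N \<ge> N0 \<Longrightarrow> cap_ratio e k N > 0"
    by (auto simp: eventually_sequentially)
  have "M \<le> max M N0" by simp
  then show ?thesis
    using assms(2)
  proof (induction rule: inc_induct)
    case base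
    then show ?case using N0[of "max M N0"] by simp
  next
    case (step m)
    then show ?case
      using cap_ratio_rec[OF e, of k m] cap_ratio_step_bounds(1)[of k m] by simp
  qed
qed

lemma cap_ratio_mono:
  fixes e :: 'a
  assumes e: "norm e = 1" and "k \<le> M"
  shows "cap_ratio e k M \<le> cap_ratio e k (Suc M)"
  unfolding cap_ratio_rec[OF e, of k M]
  using cap_ratio_step_bounds[OF assms(2)] cap_ratio_nonneg[OF e, of k "Suc M"] assms(2)
  by (intro mult_left_le) auto

lemma cap_ratio_le_1:
  fixes e :: 'a
  assumes e: "norm e = 1" and "k \<le> M"
  shows "cap_ratio e k M \<le> 1"
proof (rule LIMSEQ_le_const[OF cap_ratio_tendsto[OF e, of k]])
  have "cap_ratio e k M \<le> cap_ratio e k N" if "M \<le> N" for N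
    using that
  proof (induction rule: dec_induct)
    case (step m)
    then show ?case using cap_ratio_mono[OF e, of k m] assms(2) by simp
  qed simp
  then show "\<exists>N. \<forall>n\<ge>N. cap_ratio e k M \<le> cap_ratio e k n" by blast
qed

text \<open>One step up gains at most \<open>L / (N * (N + 1)) = L * (1 / N - 1 / (N + 1))\<close>.
  This telescopes, and the limit 1 is reached with a total gain of at most
  \<open>L / M\<close>.\<close>

lemma cap_ratio_lower:
  fixes e :: 'a
  assumes e: "norm e = 1" and kM: "k \<le> M" "M \<ge> 1"
  shows "1 - real k * (real k + real DIM('a) - 2) / real M \<le> cap_ratio e k M"
proof -
  define L where "L = real k * (real k + real DIM('a) - 2)"
  have n: "real DIM('a) \<ge> 2" using dim_ge_2 by simp
  have L: "L \<ge> 0" unfolding L_def using n by (intro mult_nonneg_nonneg) auto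
  have step: "cap_ratio e k N - L * (1 / real M - 1 / real N) \<le> cap_ratio e k M" if "M \<le> N" for N
    using that
  proof (induction rule: dec_induct)
    case (step N)
    have N: "real N > 0" using step kM by simp
    define g where "g = real (Suc N) * (real (Suc N) + real DIM('a) - 2)"
    have g: "g \<ge> real N * real (Suc N)"
      unfolding g_def using n by (subst mult.commute, intro mult_left_mono) auto
    have gpos: "g > 0" using g N by (smt (verit) mult_pos_pos of_nat_0_less_iff zero_less_Suc)
    have "cap_ratio e k (Suc N) - cap_ratio e k N = cap_ratio e k (Suc N) * (L / g)"
      using cap_ratio_rec[OF e, of k N] by (simp add: L_def g_def algebra_simps del: of_nat_Suc)
    also have "\<dots> \<le> 1 * (L / g)"
      using cap_ratio_le_1[OF e, of k "Suc N"] step kM L gpos by (intro mult_right_mono) auto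
    also have "\<dots> \<le> L / (real N * real (Suc N))"
      using g gpos L N by (simp add: frac_le del: of_nat_Suc)
    also have "\<dots> = L * (1 / real N - 1 / real (Suc N))"
      using N by (simp add: field_simps)
    finally show ?case using step.IH by (simp add: algebra_simps del: of_nat_Suc)
  qed simp
  have "(\<lambda>N. cap_ratio e k N - L * (1 / real M - 1 / real N)) \<longlonglongrightarrow> 1 - L * (1 / real M - 0)"
    by (intro tendsto_intros cap_ratio_tendsto[OF e] lim_1_over_n)
  then have "1 - L * (1 / real M - 0) \<le> cap_ratio e k M"
    by (rule LIMSEQ_le_const2) (use step in blast)
  then show ?thesis by (simp add: L_def)
qed

text \<open>Each of the \<open>N - M\<close> factors of the recurrence is bounded by the weakest
  damping among them, the one at index \<open>N\<close>, and
  \<open>1 - x \<le> exp (- x)\<close>.\<close>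

lemma cap_ratio_decay:
  fixes e :: 'a
  assumes e: "norm e = 1" and kM: "k \<le> M" "M \<le> N"
  shows "cap_ratio e k M \<le> cap_ratio e k N
    * exp (- (real (N - M) * (real k * (real k + real DIM('a) - 2) / (real N * (real N
    + real DIM('a) - 2)))))"
proof -
  define L where "L = real k * (real k + real DIM('a) - 2)"
  define \<delta> where "\<delta> = L / (real N * (real N + real DIM('a) - 2))"
  have n: "real DIM('a) \<ge> 2" using dim_ge_2 by simp
  have L: "L \<ge> 0" unfolding L_def using n by (intro mult_nonneg_nonneg) auto
  from kM(2) kM(1) have "cap_ratio e k M \<le> cap_ratio e k N * exp (- (real (N - M) * \<delta>))"
  proof (induction rule: inc_induct)
    case (step m)
    define g where "g = real (Suc m) * (real (Suc m) + real DIM('a) - 2)"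
    have g0: "g > 0" unfolding g_def using n by (intro mult_pos_pos) auto
    have g: "g \<le> real N * (real N + real DIM('a) - 2)"
      unfolding g_def using n step.hyps by (intro mult_mono) auto
    have "\<delta> \<le> L / g" unfolding \<delta>_def using L g g0 by (intro frac_le) auto
    then have "1 - L / g \<le> exp (- \<delta>)" using exp_ge_add_one_self[of "- \<delta>"] by linarith
    then have "cap_ratio e k m \<le> cap_ratio e k (Suc m) * exp (- \<delta>)"
      using cap_ratio_rec[OF e, of k m] cap_ratio_nonneg[OF e, of k "Suc m"] step.prems
      unfolding L_def[symmetric] g_def[symmetric] by (simp add: mult_left_mono)
    also have "\<dots> \<le> (cap_ratio e k N * exp (- (real (N - Suc m) * \<delta>))) * exp (- \<delta>)"
      using step.IH step.prems by (intro mult_right_mono) auto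
    also have "\<dots> = cap_ratio e k N * exp (- (real (N - m) * \<delta>))"
    proof -
      have "N - m = Suc (N - Suc m)" using step.hyps by simp
      then have "real (N - m) * \<delta> = real (N - Suc m) * \<delta> + \<delta>" by (simp add: algebra_simps)
      then show ?thesis by (simp add: mult.assoc flip: exp_add)
    qed
    finally show ?case .
  qed simp
  then show ?thesis by (simp add: \<delta>_def L_def)
qed

text \<open>With \<open>n\<close> the dimension of the space, the mass of the kernel decays no
  faster than \<open>M powr (- (n - 1) / 2)\<close> up to a constant, the size of a cap of radius
  \<open>1 / sqrt M\<close>. The degree-0 recurrence has the factors \<open>1 + h / (j + h)\<close>,
  whose logarithms are compared with a logarithm in \<open>j\<close>.\<close>

lemma cap_mean_growth:
  fixes e :: 'a
  assumes e: "norm e = 1" and "M \<le> N"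
  shows "multiplier e (cap_poly M) 0 \<le> multiplier e (cap_poly N) 0
    * exp ((real DIM('a) - 1) / 2 * (ln ((real N + 1) / (real M + 1)) + 4))"
proof -
  define h where "h = (real DIM('a) - 1) / 2"
  have h: "h \<ge> 1 / 2" using dim_ge_2 by (simp add: h_def)
  \<comment> \<open>The increments of \<open>g\<close> dominate \<open>1 / (j + 1 / 2)\<close>:
    those of the logarithm are only known to be at least \<open>1 / (j + 2)\<close>, and
    \<open>- 4 / (j + 1)\<close> supplies the rest, from \<open>j = 0\<close> on. The price is the
    additive 4 in the statement.\<close>
  define g where "g j = ln (real j + 1) - 4 / (real j + 1)" for j :: nat
  have g: "1 / (real j + 1 / 2) \<le> g (Suc j) - g j" for j
  proof -
    define x where "x = real j + 1"
    have x: "x \<ge> 1" by (simp add: x_def)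
    have "ln (x / (x + 1)) \<le> x / (x + 1) - 1"
      using x by (intro ln_le_minus_one) simp
    also have "x / (x + 1) - 1 = - 1 / (x + 1)" using x by (simp add: field_simps)
    finally have ln: "1 / (x + 1) \<le> ln (x + 1) - ln x" using x by (simp add: ln_div)
    have "1 / (x - 1 / 2) - 1 / (x + 1) \<le> 4 / x - 4 / (x + 1)"
      using x by (simp add: divide_simps mult_nonneg_nonneg)
    then show ?thesis using ln by (simp add: g_def x_def algebra_simps)
  qed
  have "multiplier e (cap_poly M) 0 \<le> multiplier e (cap_poly N) 0 * exp (h * (g N - g M))"
    using assms(2)
  proof (induction rule: dec_induct)
    case (step j)
    have m: "multiplier e (cap_poly j) 0 = multiplier e (cap_poly (Suc j)) 0 * ((real j + 2 * h) /
        (real j + h))"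
      using cap_multiplier_0(1)[OF e, of j] h by (simp add: h_def field_simps)
    have "(real j + 2 * h) / (real j + h) = 1 + h / (real j + h)" using h by (simp add: field_simps)
    also have "\<dots> \<le> exp (h / (real j + h))" by (rule exp_ge_add_one_self)
    also have "\<dots> \<le> exp (h * (g (Suc j) - g j))"
    proof -
      have "1 / (real j + h) \<le> 1 / (real j + 1 / 2)" using h by (intro divide_left_mono) auto
      then have "1 / (real j + h) \<le> g (Suc j) - g j" using g[of j] by linarith
      then have "h * (1 / (real j + h)) \<le> h * (g (Suc j) - g j)" using h
          by (intro mult_left_mono) auto
      then show ?thesis by simp
    qed
    finally have "multiplier e (cap_poly j) 0 \<le> multiplier e (cap_poly (Suc j)) 0 * exp (h * (g
        (Suc j) - g j))"
      unfolding m using cap_multiplier_0(2)[OF e, of "Suc j"] by (intro mult_left_mono) auto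
    then have "multiplier e (cap_poly j) 0 * exp (h * (g j - g M))
        \<le> multiplier e (cap_poly (Suc j)) 0 * exp (h * (g (Suc j) - g j)) * exp (h * (g j - g M))"
      by (intro mult_right_mono) auto
    also have "\<dots> = multiplier e (cap_poly (Suc j)) 0 * exp (h * (g (Suc j) - g M))"
      by (simp add: mult.assoc exp_add[symmetric] algebra_simps)
    finally show ?case using step.IH by linarith
  qed simp
  also have "\<dots> \<le> multiplier e (cap_poly N) 0 * exp (h * (ln ((real N + 1) / (real M + 1)) + 4))"
  proof -
    have "4 / (real M + 1) \<le> 4" "4 / (real N + 1) \<ge> 0" by (simp_all add: divide_le_eq)
    then have "g N - g M \<le> ln (real N + 1) - ln (real M + 1) + 4" unfolding g_def by linarith
    also have "\<dots> = ln ((real N + 1) / (real M + 1)) + 4" by (simp add: ln_div)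
    finally show ?thesis
      using h cap_multiplier_0(2)[OF e, of N] by (intro mult_left_mono) auto
  qed
  finally show ?thesis by (simp add: h_def)
qed

end

subsection \<open>The dual Marcinkiewicz--Zygmund inequality\<close>

locale quadrature = harmonic_basis Y for Y :: "nat \<Rightarrow> nat \<Rightarrow> 'a::euclidean_space \<Rightarrow> real" +
  fixes s N :: nat and w :: "nat \<Rightarrow> real" and X :: "nat \<Rightarrow> 'a"
  assumes quad: "positive_quadrature_rule s N w X"
begin

lemma w_nonneg: "i \<in> {1..N} \<Longrightarrow> w i \<ge> 0"
  and X_sphere: "i \<in> {1..N} \<Longrightarrow> norm (X i) = 1"
  using quad by (auto simp: positive_quadrature_rule_def)

text \<open>
  \<open>energy k c\<close> is the squared norm of the degree-\<open>k\<close> part of the measure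
  \<open>\<Sum>i. w i * c i * \<delta>(X i)\<close>.
\<close>

definition energy :: "nat \<Rightarrow> (nat \<Rightarrow> real) \<Rightarrow> real" where
  "energy k c = (\<Sum>l=1..harmonic_dim TYPE('a) k. (\<Sum>i=1..N. w i * c i * Y k l (X i))\<^sup>2)"

definition wnorm2 :: "(nat \<Rightarrow> real) \<Rightarrow> real" where
  "wnorm2 c = (\<Sum>i=1..N. w i * (c i)\<^sup>2)"

lemma energy_nonneg: "energy k c \<ge> 0"
  by (simp add: energy_def sum_nonneg)

lemma wnorm2_nonneg: "wnorm2 c \<ge> 0"
  using w_nonneg by (auto simp: wnorm2_def intro!: sum_nonneg mult_nonneg_nonneg)

lemma wnorm2_abs: "wnorm2 (\<lambda>i. \<bar>c i\<bar>) = wnorm2 c"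
  by (simp add: wnorm2_def)

lemma discrete_orthonormal:
  assumes "j + k \<le> s" "l \<in> {1..harmonic_dim TYPE('a) j}" "m \<in> {1..harmonic_dim TYPE('a) k}"
  shows "(\<Sum>i=1..N. w i * (Y j l (X i) * Y k m (X i))) = (if j = k \<and> l = m then 1 else 0)"
proof -
  have "(\<lambda>x. Y j l x * Y k m x) \<in> spherical_polynomials s"
    using assms by (intro spherical_polynomials_harmonic_mult[OF Y_harmonic Y_harmonic])
  then have "(\<Sum>i=1..N. w i * (Y j l (X i) * Y k m (X i)))
      = (\<integral>x. Y j l x * Y k m x \<partial>surface_measure)"
    using quad by (simp add: positive_quadrature_rule_def)
  then show ?thesis
    using assms Y_orthonormal[of l j m] Y_orthogonal[of k j l m] by (cases "j = k") auto
qed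

definition low :: "nat \<Rightarrow> (nat \<times> nat) set" where
  "low m = (SIGMA k:{..m}. {1..harmonic_dim TYPE('a) k})"

lemma finite_low [simp]: "finite (low m)"
  by (simp add: low_def)

lemma sum_low: "(\<Sum>p\<in>low m. f (fst p) (snd p)) = (\<Sum>k\<le>m. \<Sum>l=1..harmonic_dim TYPE('a) k. f k l)"
  unfolding low_def by (subst sum.Sigma) (auto simp: case_prod_beta)

text \<open>Products of two polynomials of degree \<open>m\<close> are integrated exactly, so
  sampling at the weighted nodes is isometric on degrees up to \<open>s / 2\<close>.\<close>

lemma quadrature_low_exact:
  assumes "2 * m \<le> s"
  shows "(\<Sum>i=1..N. w i * ((\<Sum>p\<in>low m. a p * Y (fst p) (snd p) (X i)) * (\<Sum>p\<in>low m. b p * Y (fst p)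
      (snd p) (X i))))
    = (\<Sum>p\<in>low m. a p * b p)"
proof -
  define y where "y p i = Y (fst p) (snd p) (X i)" for p i
  have orth: "(\<Sum>i=1..N. w i * (y p i * y q i)) = (if p = q then 1 else 0)" if "p \<in> low m" "q
      \<in> low m" for p q
    using that assms discrete_orthonormal[of "fst p" "fst q" "snd p" "snd q"]
    by (auto simp: low_def y_def prod_eq_iff)
  have "(\<Sum>i=1..N. w i * ((\<Sum>p\<in>low m. a p * y p i) * (\<Sum>p\<in>low m. b p * y p i)))
      = (\<Sum>i=1..N. \<Sum>p\<in>low m. \<Sum>q\<in>low m. a p * b q * (w i * (y p i * y q i)))"
    unfolding sum_product unfolding sum_distrib_left
        by (intro sum.cong refl) (simp add: algebra_simps)
  also have "\<dots> = (\<Sum>p\<in>low m. \<Sum>i=1..N. \<Sum>q\<in>low m. a p * b q * (w i * (y p i * y q i)))"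
    by (rule sum.swap)
  also have "\<dots> = (\<Sum>p\<in>low m. \<Sum>q\<in>low m. \<Sum>i=1..N. a p * b q * (w i * (y p i * y q i)))"
    by (intro sum.cong refl sum.swap)
  also have "\<dots> = (\<Sum>p\<in>low m. \<Sum>q\<in>low m. a p * b q * (if p = q then 1 else 0))"
    by (intro sum.cong refl) (simp only: sum_distrib_left[symmetric] orth)
  also have "\<dots> = (\<Sum>p\<in>low m. a p * b p)"
    by (intro sum.cong refl) (simp add: if_distrib[of "(*) _"] cong: if_cong)
  finally show ?thesis by (simp add: y_def)
qed

text \<open>Bessel's inequality: the sampled basis functions of degree at most \<open>m\<close> are
  orthonormal for the weighted inner product on the nodes, and \<open>g\<close> is the projection of
  \<open>c\<close>.\<close>

lemma low_energy_le:
  assumes "2 * m \<le> s"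
  shows "(\<Sum>k\<le>m. energy k c) \<le> wnorm2 c"
proof -
  define a where "a p = (\<Sum>i=1..N. w i * c i * Y (fst p) (snd p) (X i))" for p
  define g where "g i = (\<Sum>p\<in>low m. a p * Y (fst p) (snd p) (X i))" for i
  define S where "S = (\<Sum>p\<in>low m. (a p)\<^sup>2)"
  have S: "(\<Sum>k\<le>m. energy k c) = S"
    using sum_low[of "\<lambda>k l. (a (k, l))\<^sup>2" m] by (simp add: S_def energy_def a_def)
  have g2: "(\<Sum>i=1..N. w i * (g i * g i)) = S"
    unfolding g_def S_def using quadrature_low_exact[OF assms, of a a]
        by (simp add: power2_eq_square)
  have "(\<Sum>i=1..N. w i * (c i * g i)) = (\<Sum>i=1..N. \<Sum>p\<in>low m. a p * (w i * c i * Y (fst p) (snd p)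
      (X i)))"
    unfolding g_def sum_distrib_left by (intro sum.cong refl) (simp add: algebra_simps)
  also have "\<dots> = (\<Sum>p\<in>low m. \<Sum>i=1..N. a p * (w i * c i * Y (fst p) (snd p) (X i)))"
    by (rule sum.swap)
  also have "\<dots> = S"
    unfolding S_def by (simp add: sum_distrib_left[symmetric] power2_eq_square a_def)
  finally have cg: "(\<Sum>i=1..N. w i * (c i * g i)) = S" .
  have "0 \<le> (\<Sum>i=1..N. w i * (c i - g i)\<^sup>2)"
    using w_nonneg by (intro sum_nonneg mult_nonneg_nonneg) auto
  also have "\<dots> = (\<Sum>i=1..N. w i * (c i)\<^sup>2 - 2 * (w i * (c i * g i)) + w i * (g i * g i))"
    by (intro sum.cong refl) (simp add: power2_eq_square algebra_simps)
  also have "\<dots> = wnorm2 c - S"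
    unfolding sum.distrib sum_subtractf sum_distrib_left[symmetric] cg g2 wnorm2_def by simp
  finally show ?thesis using S by simp
qed

lemma energy_Z:
  "(\<Sum>i=1..N. \<Sum>j=1..N. w i * c i * (w j * c j) * Z k (X i) (X j)) = energy k c"
proof -
  have "(\<Sum>i=1..N. \<Sum>j=1..N. w i * c i * (w j * c j) * Z k (X i) (X j))
      = (\<Sum>i=1..N. \<Sum>l=1..harmonic_dim TYPE('a) k. \<Sum>j=1..N. (w i * c i * Y k l (X i)) * (w j * c j
      * Y k l (X j)))"
    unfolding Z_def sum_distrib_left
    by (rule sum.cong[OF refl], subst sum.swap) (intro sum.cong refl, simp add: algebra_simps)
  also have "\<dots> = energy k c"
    unfolding energy_def power2_eq_square sum_product by (rule sum.swap)
  finally show ?thesis .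
qed

text \<open>The quadratic form of the cap kernel on the nodes, normalised by its mass and written
  spectrally; \<open>cap_form_eq\<close> is the spatial version. The spectral side exposes exactness
  and damping, the spatial side nonnegativity of the kernel.\<close>

definition cap_form :: "'a \<Rightarrow> nat \<Rightarrow> (nat \<Rightarrow> real) \<Rightarrow> real" where
  "cap_form e M c = (\<Sum>k\<le>M. cap_ratio e k M * energy k c)"

lemma cap_form_eq:
  assumes e: "norm e = 1"
  shows "multiplier e (cap_poly M) 0 * cap_form e M c
    = (\<Sum>i=1..N. \<Sum>j=1..N. w i * c i * (w j * c j) * ((1 + X i \<bullet> X j) / 2) ^ M)"
proof -
  have "(\<Sum>i=1..N. \<Sum>j=1..N. w i * c i * (w j * c j) * ((1 + X i \<bullet> X j) / 2) ^ M)
      = (\<Sum>i=1..N. \<Sum>j=1..N. \<Sum>k\<le>M. multiplier e (cap_poly M) k * (w i * c i * (w j * c j) * Z k (X i)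
      (X j)))"
  proof (intro sum.cong refl)
    fix i j assume "i \<in> {1..N}" "j \<in> {1..N}"
    then have "((1 + X i \<bullet> X j) / 2) ^ M = (\<Sum>k\<le>M. multiplier e (cap_poly M) k * Z k (X i) (X j))"
      using poly_Z_expansion[OF e, of "cap_poly M" M "X i" "X j"] X_sphere
      by (simp add: degree_cap_poly poly_cap_poly)
    then show "w i * c i * (w j * c j) * ((1 + X i \<bullet> X j) / 2) ^ M
        = (\<Sum>k\<le>M. multiplier e (cap_poly M) k * (w i * c i * (w j * c j) * Z k (X i) (X j)))"
      by (simp add: sum_distrib_left algebra_simps)
  qed
  also have "\<dots> = (\<Sum>i=1..N. \<Sum>k\<le>M. \<Sum>j=1..N. multiplier e (cap_poly M) k * (w i * c i * (w j * c j)
      * Z k (X i) (X j)))"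
    by (intro sum.cong refl sum.swap)
  also have "\<dots> = (\<Sum>k\<le>M. \<Sum>i=1..N. \<Sum>j=1..N. multiplier e (cap_poly M) k * (w i * c i * (w j * c j)
      * Z k (X i) (X j)))"
    by (rule sum.swap)
  also have "\<dots> = (\<Sum>k\<le>M. multiplier e (cap_poly M) k * energy k c)"
    by (simp only: sum_distrib_left[symmetric] energy_Z)
  also have "\<dots> = multiplier e (cap_poly M) 0 * cap_form e M c"
    using cap_multiplier_0(2)[OF e, of M] by (simp add: cap_form_def sum_distrib_left cap_ratio_def)
  finally show ?thesis by simp
qed

lemma cap_base_bounds:
  assumes "i \<in> {1..N}" "j \<in> {1..N}"
  shows "0 \<le> (1 + X i \<bullet> X j) / 2" "(1 + X i \<bullet> X j) / 2 \<le> 1"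
proof -
  have "\<bar>X i \<bullet> X j\<bar> \<le> 1" using Cauchy_Schwarz_ineq2[of "X i" "X j"] X_sphere assms by simp
  then show "0 \<le> (1 + X i \<bullet> X j) / 2" "(1 + X i \<bullet> X j) / 2 \<le> 1" by auto
qed

text \<open>Perron--Frobenius: for nonnegative kernels, quadratic forms are monotone in the kernel.\<close>

lemma cap_form_mono:
  assumes e: "norm e = 1" and "M \<le> M'"
  shows "multiplier e (cap_poly M') 0 * cap_form e M' c
      \<le> multiplier e (cap_poly M) 0 * cap_form e M (\<lambda>i. \<bar>c i\<bar>)"
  unfolding cap_form_eq[OF e]
proof (intro sum_mono)
  fix i j assume ij: "i \<in> {1..N}" "j \<in> {1..N}"
  define t where "t = (1 + X i \<bullet> X j) / 2"
  have t: "0 \<le> t" "t \<le> 1" unfolding t_def using cap_base_bounds[OF ij] by auto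
  have "w i * c i * (w j * c j) * t ^ M' \<le> \<bar>w i * c i * (w j * c j) * t ^ M'\<bar>" by simp
  also have "\<dots> = w i * \<bar>c i\<bar> * (w j * \<bar>c j\<bar>) * t ^ M'"
    using w_nonneg[OF ij(1)] w_nonneg[OF ij(2)] t by (simp add: abs_mult)
  also have "\<dots> \<le> w i * \<bar>c i\<bar> * (w j * \<bar>c j\<bar>) * t ^ M"
    using w_nonneg[OF ij(1)] w_nonneg[OF ij(2)] t assms(2)
        by (intro mult_left_mono power_decreasing) auto
  finally show "w i * c i * (w j * c j) * ((1 + X i \<bullet> X j) / 2) ^ M'
      \<le> w i * \<bar>c i\<bar> * (w j * \<bar>c j\<bar>) * ((1 + X i \<bullet> X j) / 2) ^ M"
    by (simp add: t_def)
qed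

text \<open>A bound that depends on the rule; its task is to be finite, so that the self-improvement
  can start.\<close>

lemma cap_form_finite_bound:
  assumes e: "norm e = 1"
  obtains L where "L \<ge> 0" "\<And>c. cap_form e M c \<le> L * wnorm2 c"
proof -
  define A where "A = multiplier e (cap_poly M) 0"
  have A: "A > 0" unfolding A_def by (rule cap_multiplier_0(2)[OF e])
  define Wt where "Wt = (\<Sum>i=1..N. w i)"
  have Wt: "Wt \<ge> 0" unfolding Wt_def using w_nonneg by (intro sum_nonneg) auto
  have "cap_form e M c \<le> Wt / A * wnorm2 c" for c
  proof -
    have "A * cap_form e M c \<le> (\<Sum>i=1..N. \<Sum>j=1..N. w i * w j * ((c i)\<^sup>2 + (c j)\<^sup>2) / 2)"
      unfolding A_def cap_form_eq[OF e]
    proof (intro sum_mono)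
      fix i j assume ij: "i \<in> {1..N}" "j \<in> {1..N}"
      define t where "t = ((1 + X i \<bullet> X j) / 2) ^ M"
      have t: "0 \<le> t" "t \<le> 1" unfolding t_def using cap_base_bounds[OF ij]
          by (auto intro: power_le_one)
      have "c i * c j * t \<le> \<bar>c i * c j\<bar> * t" using t by (intro mult_right_mono) auto
      also have "\<dots> \<le> \<bar>c i * c j\<bar>" using t by (simp add: mult_left_le)
      also have "\<dots> \<le> ((c i)\<^sup>2 + (c j)\<^sup>2) / 2"
        using sum_squares_bound[of "\<bar>c i\<bar>" "\<bar>c j\<bar>"] by (simp add: abs_mult)
      finally have "w i * w j * (c i * c j * t) \<le> w i * w j * (((c i)\<^sup>2 + (c j)\<^sup>2) / 2)"
        using w_nonneg ij by (intro mult_left_mono) auto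
      then show "w i * c i * (w j * c j) * ((1 + X i \<bullet> X j) / 2) ^ M
          \<le> w i * w j * ((c i)\<^sup>2 + (c j)\<^sup>2) / 2"
        by (simp add: t_def mult_ac)
    qed
    also have "\<dots> = (\<Sum>i=1..N. \<Sum>j=1..N. w j * (w i * (c i)\<^sup>2) / 2 + w i * (w j * (c j)\<^sup>2) / 2)"
      by (intro sum.cong refl) (simp add: field_simps)
    also have "\<dots> = Wt * wnorm2 c / 2 + Wt * wnorm2 c / 2"
      unfolding sum.distrib
      by (simp add: Wt_def wnorm2_def sum_distrib_left[symmetric] sum_distrib_right[symmetric]
          sum_divide_distrib[symmetric])
    finally have "A * cap_form e M c \<le> Wt * wnorm2 c" by simp
    then show ?thesis using A by (simp add: field_simps)
  qed
  then show thesis using that[of "Wt / A"] Wt A by simp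
qed

text \<open>
  Self-improvement: any bound \<open>L\<close> on the form at concentration \<open>M\<close> improves to \<open>1 + L / 2\<close>, since
  the degrees above \<open>s / 2\<close> are damped exponentially relative to concentration \<open>2 * M\<close>.
\<close>

lemma cap_form_improve:
  assumes e: "norm e = 1" and M: "M \<ge> 1" "20 * DIM('a)\<^sup>2 * M \<le> s\<^sup>2"
    and L: "\<And>c. cap_form e M c \<le> L * wnorm2 c"
  shows "cap_form e M c \<le> (1 + L / 2) * wnorm2 c"
proof -
  define n where "n = real DIM('a)"
  have n: "n \<ge> 2" using dim_ge_2 by (simp add: n_def)
  define m where "m = s div 2"
  \<comment> \<open>The loss of mass between \<open>M\<close> and \<open>2 * M\<close> is at most
    \<open>exp ((n - 1) / 2 * 5)\<close> by \<open>cap_mean_growth\<close>. The additional 1 leaves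
    \<open>exp (-1) \<le> 1 / 2\<close> after damping and loss are multiplied.\<close>
  define \<theta> where "\<theta> = exp (- (5 / 2 * (n - 1) + 1))"
  define b where "b k = cap_ratio e k M" for k
  define b2 where "b2 k = cap_ratio e k (2 * M)" for k
  have M1: "real M \<ge> 1" using M(1) by simp
  have b: "0 \<le> b k" "b k \<le> 1" if "k \<le> M" for k
    using cap_ratio_nonneg[OF e that] cap_ratio_le_1[OF e that] by (auto simp: b_def)
  have b2: "0 \<le> b2 k" if "k \<le> 2 * M" for k
    using cap_ratio_nonneg[OF e that] by (auto simp: b2_def)
  have decay: "b k \<le> \<theta> * b2 k" if k: "k \<le> M" "m < k" for k
  proof -
    define L where "L = real k * (real k + n - 2)"
    define g where "g = real (2 * M) * (real (2 * M) + n - 2)"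
    have g: "g > 0" unfolding g_def using n M1 by (intro mult_pos_pos) auto
    have "s < 2 * k" using k(2) by (simp add: m_def)
    then have "real s \<le> 2 * real k" by linarith
    then have "(real s)\<^sup>2 \<le> (2 * real k)\<^sup>2" by (intro power_mono) auto
    then have "(real s)\<^sup>2 \<le> 4 * (real k * real k)" by (simp add: power2_eq_square)
    also have "\<dots> \<le> 4 * L" unfolding L_def using n by (intro mult_left_mono) auto
    finally have sL: "(real s)\<^sup>2 \<le> 4 * L" .
    have "real (20 * DIM('a)\<^sup>2 * M) \<le> real (s\<^sup>2)" using M(2) of_nat_le_iff by blast
    then have sM: "20 * (n * n) * real M \<le> (real s)\<^sup>2" by (simp add: n_def power2_eq_square)
    \<comment> \<open>Here \<open>L\<close> is the local eigenvalue. The right-hand side is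
      \<open>20 * n\<^sup>2 * M / 8\<close>, hence at most \<open>s\<^sup>2 / 8\<close> and at most
      \<open>L / 2\<close>; the 20 in the hypothesis is chosen for this.\<close>
    have "(5 / 2 * (n - 1) + 1) * (real (2 * M) + n - 2) \<le> (5 / 2 * n) * (n * real M)"
    proof (rule mult_mono)
      have "0 \<le> (n - 2) * (real M - 1)" using n M1 by simp
      then show "real (2 * M) + n - 2 \<le> n * real M" by (simp add: algebra_simps)
      have "5 / 2 * (n - 1) = 5 / 2 * n - 5 / 2" by (simp add: right_diff_distrib)
      then show "5 / 2 * (n - 1) + 1 \<le> 5 / 2 * n" by linarith
      show "0 \<le> real (2 * M) + n - 2" using n by simp
      show "0 \<le> 5 / 2 * n" using n by simp
    qed
    also have "\<dots> = 20 * (n * n) * real M / 8" by simp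
    also have "\<dots> \<le> L / 2" using sM sL by simp
    finally have *: "(5 / 2 * (n - 1) + 1) * (real (2 * M) + n - 2) \<le> L / 2" .
    have "real (2 * M) + n - 2 > 0" using n M1 by simp
    then have "5 / 2 * (n - 1) + 1 \<le> L / 2 / (real (2 * M) + n - 2)"
      using * by (simp only: pos_le_divide_eq)
    also have "\<dots> = real (2 * M - M) * (L / g)"
      using M1 by (simp add: g_def)
    finally have "- (real (2 * M - M) * (L / g)) \<le> - (5 / 2 * (n - 1) + 1)" by simp
    then have "exp (- (real (2 * M - M) * (L / g))) \<le> \<theta>" by (simp add: \<theta>_def)
    moreover have "b k \<le> b2 k * exp (- (real (2 * M - M) * (L / g)))"
      using cap_ratio_decay[OF e k(1), of "2 * M"] by (simp add: b_def b2_def L_def g_def n_def)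
    moreover have "b2 k * exp (- (real (2 * M - M) * (L / g))) \<le> b2 k * \<theta>"
      using calculation(1) b2[of k] k by (intro mult_left_mono) auto
    ultimately show ?thesis by (simp add: mult.commute)
  qed
  have "cap_form e M c = (\<Sum>k\<in>{..M} \<inter> {..m}. b k * energy k c) + (\<Sum>k\<in>{..M} - {..m}. b k
      * energy k c)"
    unfolding cap_form_def b_def by (rule sum.Int_Diff) simp
  also have "(\<Sum>k\<in>{..M} \<inter> {..m}. b k * energy k c) \<le> (\<Sum>k\<in>{..M} \<inter> {..m}. energy k c)"
    using b energy_nonneg by (intro sum_mono) (auto intro: mult_left_le_one_le)
  also have "\<dots> \<le> (\<Sum>k\<le>m. energy k c)" by (intro sum_mono2) (auto simp: energy_nonneg)
  also have "\<dots> \<le> wnorm2 c" by (rule low_energy_le) (simp add: m_def)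
  also have "(\<Sum>k\<in>{..M} - {..m}. b k * energy k c) \<le> (\<Sum>k\<in>{..M} - {..m}. \<theta> * (b2 k * energy k c))"
  proof (rule sum_mono)
    fix k assume "k \<in> {..M} - {..m}"
    then have "b k * energy k c \<le> (\<theta> * b2 k) * energy k c"
      using decay energy_nonneg by (intro mult_right_mono) auto
    then show "b k * energy k c \<le> \<theta> * (b2 k * energy k c)" by (simp only: mult.assoc)
  qed
  also have "\<dots> \<le> (\<Sum>k\<le>2 * M. \<theta> * (b2 k * energy k c))"
    using b2 energy_nonneg by (intro sum_mono2) (auto simp: \<theta>_def intro!: mult_nonneg_nonneg)
  also have "\<dots> = \<theta> * cap_form e (2 * M) c"
    by (simp add: cap_form_def b2_def sum_distrib_left)
  also have "\<dots> \<le> L / 2 * wnorm2 c"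
  proof -
    define A where "A = multiplier e (cap_poly M) 0"
    define A2 where "A2 = multiplier e (cap_poly (2 * M)) 0"
    have A: "A > 0" "A2 > 0" unfolding A_def A2_def by (rule cap_multiplier_0(2)[OF e])+
    \<comment> \<open>The sign of \<open>L\<close> is not assumed; the form itself is nonnegative
      because all its multipliers are.\<close>
    have Lnn: "L * wnorm2 c \<ge> 0"
    proof -
      have "0 \<le> cap_form e M (\<lambda>i. \<bar>c i\<bar>)"
        unfolding cap_form_def using cap_ratio_nonneg[OF e] energy_nonneg
            by (intro sum_nonneg mult_nonneg_nonneg) auto
      also have "\<dots> \<le> L * wnorm2 c" using L[of "\<lambda>i. \<bar>c i\<bar>"] by (simp add: wnorm2_abs)
      finally show ?thesis .
    qed
    have "A \<le> A2 * exp ((n - 1) / 2 * (ln ((real (2 * M) + 1) / (real M + 1)) + 4))"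
      using cap_mean_growth[OF e, of M "2 * M"] by (simp add: A_def A2_def n_def)
    also have "\<dots> \<le> A2 * exp ((n - 1) / 2 * 5)"
    proof -
      have "ln ((real (2 * M) + 1) / (real M + 1)) \<le> (real (2 * M) + 1) / (real M + 1) - 1"
        by (rule ln_le_minus_one) simp
      also have "\<dots> \<le> 1" by (simp add: divide_le_eq)
      finally have "(n - 1) / 2 * (ln ((real (2 * M) + 1) / (real M + 1)) + 4) \<le> (n - 1) / 2 * 5"
        using n by (intro mult_left_mono) auto
      then show ?thesis using A by (intro mult_left_mono)
          (simp_all only: exp_le_cancel_iff less_imp_le)
    qed
    finally have A2: "A \<le> A2 * exp ((n - 1) / 2 * 5)" .
    have "A2 * cap_form e (2 * M) c \<le> A * cap_form e M (\<lambda>i. \<bar>c i\<bar>)"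
      unfolding A_def A2_def by (rule cap_form_mono[OF e]) simp
    also have "\<dots> \<le> A * (L * wnorm2 c)"
      using A L[of "\<lambda>i. \<bar>c i\<bar>"] by (intro mult_left_mono) (auto simp: wnorm2_abs)
    also have "\<dots> \<le> (A2 * exp ((n - 1) / 2 * 5)) * (L * wnorm2 c)"
      using A2 Lnn by (intro mult_right_mono) auto
    finally have "cap_form e (2 * M) c \<le> exp ((n - 1) / 2 * 5) * (L * wnorm2 c)"
      using A by (simp add: mult.assoc)
    then have "\<theta> * cap_form e (2 * M) c \<le> \<theta> * (exp ((n - 1) / 2 * 5) * (L * wnorm2 c))"
      by (intro mult_left_mono) (auto simp: \<theta>_def)
    also have "\<dots> = exp (-1) * (L * wnorm2 c)"
    proof -
      have "- (5 / 2 * (n - 1) + 1) + (n - 1) / 2 * 5 = (- 1 :: real)" by (simp add: field_simps)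
      then have "\<theta> * exp ((n - 1) / 2 * 5) = exp (- 1)" unfolding \<theta>_def exp_add[symmetric] by simp
      then show ?thesis by (simp only: mult.assoc[symmetric])
    qed
    also have "\<dots> \<le> 1 / 2 * (L * wnorm2 c)"
    proof (intro mult_right_mono Lnn)
      have "exp (1::real) \<ge> 2" using exp_ge_add_one_self[of 1] by simp
      then show "exp (- 1) \<le> (1 / 2 :: real)" by (simp add: exp_minus field_simps)
    qed
    finally show ?thesis by simp
  qed
  finally show ?thesis by (simp add: algebra_simps)
qed

text \<open>Iterating the map from \<open>L\<close> to \<open>1 + L / 2\<close> drives any initial
  bound to its fixed point 2. For \<open>M = 0\<close> the form is the energy of degree 0, handled
  by \<open>low_energy_le\<close>.\<close>

lemma cap_form_bound:
  assumes e: "norm e = 1" and M: "20 * DIM('a)\<^sup>2 * M \<le> s\<^sup>2"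
  shows "cap_form e M c \<le> 2 * wnorm2 c"
proof (cases "M = 0")
  case True
  have "cap_ratio e 0 0 = 1" using cap_multiplier_0(2)[OF e, of 0] by (simp add: cap_ratio_def)
  then have "cap_form e M c = (\<Sum>k\<le>0. energy k c)" by (simp add: cap_form_def True)
  also have "\<dots> \<le> wnorm2 c" by (rule low_energy_le) simp
  finally show ?thesis using wnorm2_nonneg[of c] by simp
next
  case False
  obtain L where L: "L \<ge> 0" "\<And>c. cap_form e M c \<le> L * wnorm2 c"
    using cap_form_finite_bound[OF e] by blast
  have "cap_form e M c \<le> (2 + L / 2 ^ j) * wnorm2 c" for j c
  proof (induction j arbitrary: c)
    case 0
    have "L * wnorm2 c \<le> (2 + L) * wnorm2 c" using wnorm2_nonneg by (intro mult_right_mono) auto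
    then show ?case using L(2)[of c] by simp
  next
    case (Suc j)
    have "1 + (2 + L / 2 ^ j) / 2 = 2 + L / 2 ^ Suc j" by (simp add: field_simps)
    moreover have "cap_form e M c \<le> (1 + (2 + L / 2 ^ j) / 2) * wnorm2 c"
      using Suc False by (intro cap_form_improve[OF e _ M]) auto
    ultimately show ?case by (simp only:)
  qed
  moreover have "(\<lambda>j. (2 + L / 2 ^ j) * wnorm2 c) \<longlonglongrightarrow> (2 + 0) * wnorm2 c"
    by (intro tendsto_intros LIMSEQ_divide_realpow_zero) simp
  ultimately show ?thesis
    using LIMSEQ_le_const[of "\<lambda>j. (2 + L / 2 ^ j) * wnorm2 c" "2 * wnorm2 c" "cap_form e M c"]
        by auto
qed

end

text \<open>The 4 is 2 from multipliers of at least \<open>1 / 2\<close> times 2 from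
  \<open>cap_form_bound\<close>. The exponent \<open>2 * d\<close> is \<open>d / 2\<close> times the
  additive 4 of \<open>cap_mean_growth\<close>. The last factor bounds
  \<open>(m + 1) / (M + 1)\<close> relative to \<open>(K / s)^2\<close> in
  \<open>energy_sum_bound\<close>, raised to \<open>d / 2\<close>.\<close>

definition mz_const :: "nat \<Rightarrow> real" where
  "mz_const d = 4 * exp (2 * real d) * (20 * (real d + 1)\<^sup>2 * (2 * real d + 1)) powr (real d / 2)"

lemma mz_const_pos: "mz_const d > 0"
  by (simp add: mz_const_def add_nonneg_pos)

section \<open>Energies of degrees beyond the exactness of the rule\<close>

context quadrature
begin

text \<open>The form at concentration \<open>m\<close>, of order \<open>K^2\<close>, sees all
  degrees up to \<open>K\<close>. It is dominated by the one at \<open>M\<close>, of order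
  \<open>s^2\<close>, at the price of the ratio of masses, about
  \<open>(m / M) powr (d / 2)\<close>.\<close>

lemma energy_sum_bound:
  assumes d: "DIM('a) = d + 1" and s: "s \<ge> 1" and K: "K \<ge> 1" "s \<le> 2 * K"
  shows "(\<Sum>k\<le>K. energy k c) \<le> mz_const d * (real K / real s) powr real d * wnorm2 c"
proof -
  obtain e :: 'a where e: "norm e = 1" using vector_choose_size[of 1] by auto
  have d1: "d \<ge> 1" using dim_ge_2 d by simp
  have n: "real DIM('a) = real d + 1" using d by simp
  \<comment> \<open>The largest concentration that \<open>cap_form_bound\<close> admits. It is 0 for
    small \<open>s\<close>, hence the ratios with \<open>real M + 1\<close>.\<close>
  define M where "M = s\<^sup>2 div (20 * DIM('a)\<^sup>2)"
  \<comment> \<open>Twice the eigenvalue \<open>K * (K + n - 2)\<close>, with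
    \<open>n = d + 1\<close>, so that \<open>cap_ratio_lower\<close> keeps the multipliers of degree
    at most \<open>K\<close> above \<open>1 / 2\<close>.\<close>
  define m where "m = 2 * K * (K + d - 1)"
  have M: "20 * DIM('a)\<^sup>2 * M \<le> s\<^sup>2"
    unfolding M_def by (rule times_div_less_eq_dividend)
  have M': "(real s)\<^sup>2 \<le> 20 * (real d + 1)\<^sup>2 * (real M + 1)"
  proof -
    have "20 * DIM('a)\<^sup>2 > 0" using DIM_positive[where 'a = 'a] by simp
    then have "s\<^sup>2 < 20 * DIM('a)\<^sup>2 + M * (20 * DIM('a)\<^sup>2)"
      unfolding M_def by (rule dividend_less_div_times)
    then have "s\<^sup>2 < 20 * DIM('a)\<^sup>2 * (M + 1)" by (simp add: algebra_simps)
    then have "real (s\<^sup>2) \<le> real (20 * DIM('a)\<^sup>2 * (M + 1))" by (intro of_nat_mono) simp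
    also have "real (20 * DIM('a)\<^sup>2 * (M + 1)) = 20 * (real DIM('a))\<^sup>2 * (real M + 1)"
        by (simp add: distrib_left)
    finally show ?thesis unfolding n by simp
  qed
  have mreal: "real m = 2 * real K * (real K + real d - 1)"
    using d1 K by (simp add: m_def of_nat_diff)
  have Mm: "M \<le> m"
  proof -
    have "20 * M \<le> 20 * DIM('a)\<^sup>2 * M" using DIM_positive[where 'a = 'a] by simp
    also have "\<dots> \<le> s\<^sup>2" by (rule M)
    also have "\<dots> \<le> (2 * K)\<^sup>2" using K by (intro power_mono) auto
    also have "\<dots> = 4 * (K * K)" by (simp add: power2_eq_square)
    also have "\<dots> \<le> 4 * (K * (K + d - 1))" using d1 by (intro mult_left_mono) auto
    finally show ?thesis by (simp add: m_def)
  qed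
  have Km: "K \<le> m" "m \<ge> 1"
  proof -
    have "K * 1 \<le> 2 * K * (K + d - 1)" using K d1 by (intro mult_mono) auto
    then show "K \<le> m" by (simp add: m_def)
    then show "m \<ge> 1" using K by simp
  qed
  have half: "1 / 2 \<le> cap_ratio e k m" if k: "k \<le> K" for k
  proof -
    have "real k * (real k + real DIM('a) - 2) \<le> real K * (real K + real d - 1)"
      unfolding n using k d1 by (intro mult_mono) auto
    then have "real k * (real k + real DIM('a) - 2) / real m
        \<le> real K * (real K + real d - 1) / real m"
      by (rule divide_right_mono) simp
    also have "\<dots> = 1 / 2"
    proof -
      define q where "q = real K * (real K + real d - 1)"
      have "q > 0" unfolding q_def using K d1 by (intro mult_pos_pos) auto
      moreover have "real m = 2 * q" unfolding mreal q_def by simp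
      ultimately show ?thesis unfolding q_def[symmetric] by simp
    qed
    finally show ?thesis
      using cap_ratio_lower[OF e order.trans[OF k Km(1)] Km(2)] by linarith
  qed
  define h where "h = real d / 2"
  have "(\<Sum>k\<le>K. energy k c) \<le> (\<Sum>k\<le>K. 2 * (cap_ratio e k m * energy k c))"
  proof (rule sum_mono)
    fix k assume "k \<in> {..K}"
    then have "1 / 2 * energy k c \<le> cap_ratio e k m * energy k c"
      using half energy_nonneg by (intro mult_right_mono) auto
    then show "energy k c \<le> 2 * (cap_ratio e k m * energy k c)" by simp
  qed
  also have "\<dots> \<le> (\<Sum>k\<le>m. 2 * (cap_ratio e k m * energy k c))"
    using Km cap_ratio_nonneg[OF e] energy_nonneg by (intro sum_mono2) auto
  also have "\<dots> = 2 * cap_form e m c" by (simp add: cap_form_def sum_distrib_left)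
  also have "\<dots> \<le> 2 * (exp (h * (ln ((real m + 1) / (real M + 1)) + 4)) * (2 * wnorm2 c))"
  proof -
    define A where "A = multiplier e (cap_poly M) 0"
    define B where "B = multiplier e (cap_poly m) 0"
    have B: "B > 0" unfolding B_def by (rule cap_multiplier_0(2)[OF e])
    have A: "A > 0" unfolding A_def by (rule cap_multiplier_0(2)[OF e])
    have "B * cap_form e m c \<le> A * cap_form e M (\<lambda>i. \<bar>c i\<bar>)"
      unfolding A_def B_def by (rule cap_form_mono[OF e Mm])
    also have "\<dots> \<le> A * (2 * wnorm2 c)"
      using cap_form_bound[OF e M, of "\<lambda>i. \<bar>c i\<bar>"] A
          by (intro mult_left_mono) (auto simp: wnorm2_abs)
    also have "\<dots> \<le> (B * exp (h * (ln ((real m + 1) / (real M + 1)) + 4))) * (2 * wnorm2 c)"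
      using cap_mean_growth[OF e Mm] wnorm2_nonneg[of c]
      by (intro mult_right_mono) (auto simp: A_def B_def h_def n)
    finally have "cap_form e m c \<le> exp (h * (ln ((real m + 1) / (real M + 1)) + 4)) * (2
        * wnorm2 c)"
      using B by (simp add: mult.assoc)
    then show ?thesis by (rule mult_left_mono) simp
  qed
  also have "\<dots> = 4 * exp (2 * real d) * ((real m + 1) / (real M + 1)) powr h * wnorm2 c"
  proof -
    have "exp (h * (ln ((real m + 1) / (real M + 1)) + 4))
        = exp (2 * real d) * ((real m + 1) / (real M + 1)) powr h"
    proof -
      have "h * (ln ((real m + 1) / (real M + 1)) + 4)
          = 2 * real d + h * ln ((real m + 1) / (real M + 1))"
        by (simp add: h_def algebra_simps)
      then show ?thesis by (simp add: powr_def exp_add)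
    qed
    then show ?thesis by simp
  qed
  also have "\<dots> \<le> 4 * exp (2 * real d) * (20 * (real d + 1)\<^sup>2 * (2 * real d + 1) * (real K
      / real s)\<^sup>2) powr h * wnorm2 c"
  proof (intro mult_right_mono mult_left_mono powr_mono2 wnorm2_nonneg)
    have K1: "real K \<ge> 1" using K by simp
    have "real m + 1 \<le> (2 * real d + 1) * (real K)\<^sup>2"
    proof -
      have "2 * (real d - 1) * real K + 1 \<le> (2 * real d - 1) * (real K * real K)"
      proof -
        have "(2 * real d - 2) * real K + 1 * real K \<le> (2 * real d - 1) * (real K * real K)"
          using K1 d1 mult_left_mono[of "real K" "real K * real K" "2 * real d - 1"]
              by (simp add: algebra_simps)
        then show ?thesis using K1 by (simp add: algebra_simps)
      qed
      then show ?thesis unfolding mreal power2_eq_square by (simp add: algebra_simps)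
    qed
    moreover have "(real s)\<^sup>2 / (20 * (real d + 1)\<^sup>2) \<le> real M + 1"
      using M' by (simp add: divide_le_eq mult.commute)
    ultimately have "(real m + 1) / (real M + 1)
        \<le> (2 * real d + 1) * (real K)\<^sup>2 / ((real s)\<^sup>2 / (20 * (real d + 1)\<^sup>2))"
      using s by (intro frac_le) auto
    also have "\<dots> = 20 * (real d + 1)\<^sup>2 * (2 * real d + 1) * (real K / real s)\<^sup>2"
      by (simp add: power_divide)
    finally show "(real m + 1) / (real M + 1) \<le> 20 * (real d + 1)\<^sup>2 * (2 * real d + 1) * (real K
        / real s)\<^sup>2" .
  qed (auto simp: h_def)
  also have "\<dots> = mz_const d * (real K / real s) powr real d * wnorm2 c"
  proof -
    have "((real K / real s)\<^sup>2) powr h = (real K / real s) powr real d"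
    proof -
      have "real K / real s > 0" using K s by simp
      then have "(real K / real s)\<^sup>2 = (real K / real s) powr 2" by simp
      then show ?thesis by (simp only: powr_powr) (simp add: h_def)
    qed
    moreover have "(20 * (real d + 1)\<^sup>2 * (2 * real d + 1) * (real K / real s)\<^sup>2) powr h
        = (20 * (real d + 1)\<^sup>2 * (2 * real d + 1)) powr h * ((real K / real s)\<^sup>2) powr h"
      by (rule powr_mult)
    ultimately show ?thesis
      unfolding mz_const_def h_def by (simp only: mult.assoc)
  qed
  finally show ?thesis .
qed

text \<open>On the dyadic block starting at \<open>2 ^ j * b\<close> the coefficients are of order
  \<open>(2 ^ j * s) powr (-2 * \<gamma>)\<close> and the energies of order
  \<open>2 powr (j * d)\<close>, so the blocks decrease geometrically with ratio
  \<open>2 powr (d - 2 * \<gamma>)\<close>. The resulting bound is uniform in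
  \<open>K\<close>.\<close>

lemma high_energy_bound:
  assumes d: "DIM('a) = d + 1" and s: "s \<ge> 1" and \<gamma>: "\<gamma> > real d / 2" and C: "C \<ge> 0"
    and dec: "\<And>k. k \<ge> 1 \<Longrightarrow> \<phi>hat k \<le> C * real k powr (- 2 * \<gamma>)"
    and pos: "\<And>k. \<phi>hat k \<ge> 0"
  shows "(\<Sum>k\<in>{s div 2<..K}. \<phi>hat k * energy k c)
    \<le> C * mz_const d * 2 powr (2 * \<gamma> + real d) / (1 - 2 powr (real d - 2 * \<gamma>)) * real s powr (- 2
    * \<gamma>) * wnorm2 c"
proof -
  \<comment> \<open>The first degree above \<open>s div 2\<close>. It lies between
    \<open>s / 2\<close> and \<open>s\<close>, so \<open>b\<close> and \<open>s\<close> can be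
    exchanged up to powers of 2.\<close>
  define b where "b = s div 2 + 1"
  define \<rho> where "\<rho> = 2 powr (real d - 2 * \<gamma>)"
  define T where "T = C * mz_const d * 2 powr (2 * \<gamma> + real d) * real s powr (- 2 * \<gamma>) * wnorm2 c"
  have b: "b \<ge> 1" "b \<le> s" "s \<le> 2 * b" using s by (auto simp: b_def)
  have \<rho>: "0 < \<rho>" "\<rho> < 1"
    using \<gamma> powr_less_mono[of "real d - 2 * \<gamma>" 0 2] by (auto simp: \<rho>_def)
  have T: "T \<ge> 0"
    unfolding T_def using C mz_const_pos[of d] wnorm2_nonneg by (intro mult_nonneg_nonneg) auto
  have g: "\<gamma> > 0" using \<gamma> by (smt (verit) divide_nonneg_nonneg of_nat_0_le_iff)
  have block: "(\<Sum>k\<in>{2 ^ j * b..<2 ^ Suc j * b}. \<phi>hat k * energy k c) \<le> T * \<rho> ^ j" for j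
  proof -
    define K where "K = 2 ^ Suc j * b"
    have jb: "2 ^ j * b \<ge> 1" using b by simp
    have K: "K \<ge> 1" "s \<le> 2 * K"
    proof -
      show "K \<ge> 1" using b by (simp add: K_def)
      have "1 * b \<le> 2 ^ Suc j * b" by (intro mult_right_mono) (simp_all del: power_Suc)
      then show "s \<le> 2 * K" using b(3) unfolding K_def by linarith
    qed
    define p where "p = real (2 ^ j * b) powr (- 2 * \<gamma>)"
    have "(\<Sum>k\<in>{2 ^ j * b..<2 ^ Suc j * b}. \<phi>hat k * energy k c)
        \<le> (\<Sum>k\<in>{2 ^ j * b..<2 ^ Suc j * b}. C * p * energy k c)"
    proof (rule sum_mono)
      fix k assume k: "k \<in> {2 ^ j * b..<2 ^ Suc j * b}"
      then have k1: "k \<ge> 1" "2 ^ j * b \<le> k" using jb by auto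
      have "real k powr (- 2 * \<gamma>) \<le> p"
        unfolding p_def using k1 jb g by (intro powr_mono2')
            (auto simp del: of_nat_mult of_nat_power)
      then have "\<phi>hat k \<le> C * p"
        using dec[OF k1(1)] C by (meson mult_left_mono order_trans)
      then show "\<phi>hat k * energy k c \<le> C * p * energy k c"
        by (intro mult_right_mono energy_nonneg)
    qed
    also have "\<dots> = C * p * (\<Sum>k\<in>{2 ^ j * b..<2 ^ Suc j * b}. energy k c)"
      by (simp add: sum_distrib_left)
    also have "\<dots> \<le> C * p * (\<Sum>k\<le>K. energy k c)"
      using C by (intro mult_left_mono sum_mono2) (auto simp: energy_nonneg K_def p_def)
    also have "\<dots> \<le> C * p * (mz_const d * (real K / real s) powr real d * wnorm2 c)"
      using C by (intro mult_left_mono energy_sum_bound[OF d s K]) (auto simp: p_def)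
    also have "\<dots> \<le> C * ((2 ^ j) powr (- 2 * \<gamma>) * (2 powr (2 * \<gamma>) * real s powr (- 2 * \<gamma>))) *
        (mz_const d * (2 ^ Suc j) powr real d * wnorm2 c)"
    proof (intro mult_mono mult_left_mono mult_right_mono powr_mono2 wnorm2_nonneg)
      have "real b powr (- 2 * \<gamma>) \<le> (real s / 2) powr (- 2 * \<gamma>)"
        using b s g by (intro powr_mono2') auto
      also have "\<dots> = 2 powr (2 * \<gamma>) * real s powr (- 2 * \<gamma>)"
        by (simp add: powr_divide powr_minus field_simps)
      finally show "p \<le> (2 ^ j) powr (- 2 * \<gamma>) * (2 powr (2 * \<gamma>) * real s powr (- 2 * \<gamma>))"
        unfolding p_def by (simp add: powr_mult mult_left_mono)
      have "real K / real s = 2 ^ Suc j * (real b / real s)" by (simp add: K_def)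
      also have "\<dots> \<le> 2 ^ Suc j * 1" using b s by (intro mult_left_mono) auto
      finally show "real K / real s \<le> 2 ^ Suc j" by simp
    qed (use C mz_const_pos[of d] wnorm2_nonneg in \<open>auto simp: p_def intro!: mult_nonneg_nonneg\<close>)
    also have "\<dots> = T * \<rho> ^ j"
    proof -
      have 1: "(2 ^ j) powr (- 2 * \<gamma>) = 2 powr (- 2 * \<gamma> * real j)" "(2 ^ Suc j) powr real d
          = 2 powr (real d * real j + real d)"
      proof -
        have "(2::real) ^ i = 2 powr real i" for i by (simp add: powr_realpow)
        then show "(2 ^ j) powr (- 2 * \<gamma>) = 2 powr (- 2 * \<gamma> * real j)" "(2 ^ Suc j) powr real d
            = 2 powr (real d * real j + real d)"
          by (simp_all only: powr_powr) (simp_all add: algebra_simps)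
      qed
      have 2: "\<rho> ^ j = 2 powr ((real d - 2 * \<gamma>) * real j)"
      proof -
        have "\<rho> ^ j = \<rho> powr real j" using \<rho> by (simp add: powr_realpow)
        then show ?thesis by (simp only: \<rho>_def powr_powr)
      qed
      have 3: "2 powr (- 2 * \<gamma> * real j) * 2 powr (2 * \<gamma>) * 2 powr (real d * real j + real d)
          = 2 powr (2 * \<gamma> + real d) * (2 powr ((real d - 2 * \<gamma>) * real j) :: real)"
        unfolding powr_add[symmetric] by (rule arg_cong[where f
            = "\<lambda>x. 2 powr x"]) (simp add: algebra_simps)
      have "C * (2 powr (- 2 * \<gamma> * real j) * (2 powr (2 * \<gamma>) * real s powr (- 2 * \<gamma>))) * (mz_const d
          * 2 powr (real d * real j + real d) * wnorm2 c)
          = (C * mz_const d * real s powr (- 2 * \<gamma>) * wnorm2 c) * (2 powr (- 2 * \<gamma> * real j)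
          * 2 powr (2 * \<gamma>) * 2 powr (real d * real j + real d))"
        by (simp only: mult_ac)
      then show ?thesis
        unfolding T_def 1 2 3 by (simp only: mult_ac)
    qed
    finally show ?thesis .
  qed
  have blocks: "(\<Sum>k\<in>{b..<2 ^ J * b}. \<phi>hat k * energy k c) \<le> (\<Sum>j<J. T * \<rho> ^ j)" for J
  proof (induction J)
    case (Suc J)
    have "b \<le> 2 ^ J * b" "2 ^ J * b \<le> 2 ^ Suc J * b" by simp_all
    then have "(\<Sum>k\<in>{b..<2 ^ Suc J * b}. \<phi>hat k * energy k c)
        = (\<Sum>k\<in>{b..<2 ^ J * b}. \<phi>hat k * energy k c) + (\<Sum>k\<in>{2 ^ J * b..<2 ^ Suc J * b}. \<phi>hat k
        * energy k c)"
      by (rule sum.atLeastLessThan_concat[symmetric])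
    then show ?case using Suc block[of J] by simp
  qed simp
  have "{s div 2<..K} \<subseteq> {b..<2 ^ Suc K * b}"
  proof
    fix k assume k: "k \<in> {s div 2<..K}"
    have "k < 2 ^ k" by (rule less_exp)
    also have "\<dots> \<le> 2 ^ Suc K" using k by (intro power_increasing) auto
    also have "\<dots> \<le> 2 ^ Suc K * b" using b by simp
    finally show "k \<in> {b..<2 ^ Suc K * b}" using k by (simp add: b_def)
  qed
  then have "(\<Sum>k\<in>{s div 2<..K}. \<phi>hat k * energy k c)
      \<le> (\<Sum>k\<in>{b..<2 ^ Suc K * b}. \<phi>hat k * energy k c)"
    using pos energy_nonneg by (intro sum_mono2) auto
  also have "\<dots> \<le> (\<Sum>j<Suc K. T * \<rho> ^ j)" by (rule blocks)
  also have "\<dots> = T * (\<Sum>j<Suc K. \<rho> ^ j)" by (simp only: sum_distrib_left)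
  also have "\<dots> \<le> T * (1 / (1 - \<rho>))"
  proof (intro mult_left_mono T)
    show "(\<Sum>j<Suc K. \<rho> ^ j) \<le> 1 / (1 - \<rho>)"
      using \<rho> sum_le_suminf[OF summable_geometric, of \<rho> "{..<Suc K}"]
          by (simp add: suminf_geometric del: sum.lessThan_Suc)
  qed
  finally show ?thesis by (simp add: T_def \<rho>_def)
qed

end

subsection \<open>The native space\<close>

text \<open>With \<open>b k l = Y k l x\<close> this is the degree-\<open>k\<close> term of an
  expansion at \<open>x\<close>; with two coefficient arrays it is a term of an inner product. One
  notion serves both.\<close>

definition block :: "(nat \<Rightarrow> nat \<Rightarrow> 'a::euclidean_space \<Rightarrow> real) \<Rightarrow> (nat \<Rightarrow> nat \<Rightarrow> real) \<Rightarrow>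
    (nat \<Rightarrow> nat \<Rightarrow> real) \<Rightarrow> nat \<Rightarrow> real" where
  "block Y a b k = (\<Sum>l=1..harmonic_dim TYPE('a) k. a k l * b k l)"

lemma block_commute: "block Y a b k = block Y b a k"
  by (simp add: block_def mult.commute)

lemma block_self_nonneg: "block Y a a k \<ge> 0"
  by (simp add: block_def sum_nonneg)

lemma block_lincomb:
  "block Y (\<lambda>k l. c * a k l + d * b k l) e k = c * block Y a e k + d * block Y b e k"
  by (simp add: block_def sum.distrib sum_distrib_left algebra_simps)

lemma block_cong:
  fixes Y :: "nat \<Rightarrow> nat \<Rightarrow> 'a::euclidean_space \<Rightarrow> real"
  assumes "\<And>l. l \<in> {1..harmonic_dim TYPE('a) k} \<Longrightarrow> a k l = a' k l"
    "\<And>l. l \<in> {1..harmonic_dim TYPE('a) k} \<Longrightarrow> b k l = b' k l"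
  shows "block Y a b k = block Y a' b' k"
  unfolding block_def using assms by (intro sum.cong) auto

lemma weighted_am_gm:
  assumes "t > 0"
  shows "\<bar>a * b :: real\<bar> \<le> (t * a\<^sup>2 + b\<^sup>2 / t) / 2"
proof -
  have "0 \<le> (t * \<bar>a\<bar> - \<bar>b\<bar>)\<^sup>2 / t" using assms by simp
  also have "\<dots> = t * a\<^sup>2 - 2 * \<bar>a * b\<bar> + b\<^sup>2 / t"
    using assms by (simp add: power2_eq_square abs_mult field_simps)
  finally show ?thesis by simp
qed

text \<open>The free parameter distributes the weight of a degree between the factors:
  \<open>1 / \<phi>hat k\<close> for pointwise convergence, \<open>\<eta> / \<phi>hat k\<close> for
  the duality argument.\<close>

lemma block_am_gm:
  assumes "t > 0"
  shows "\<bar>block Y a b k\<bar> \<le> (t * block Y a a k + block Y b b k / t) / 2"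
proof -
  have "\<bar>block Y a b k\<bar> \<le> (\<Sum>l=1..harmonic_dim TYPE('a) k. \<bar>a k l * b k l\<bar>)"
    unfolding block_def by (rule sum_abs)
  also have "\<dots> \<le> (\<Sum>l=1..harmonic_dim TYPE('a) k. (t * (a k l)\<^sup>2 + (b k l)\<^sup>2 / t) / 2)"
    by (intro sum_mono weighted_am_gm assms)
  also have "\<dots> = (t * block Y a a k + block Y b b k / t) / 2"
    by (simp add: block_def sum.distrib sum_distrib_left sum_divide_distrib[symmetric]
        power2_eq_square)
  finally show ?thesis .
qed

locale native_rkhs = harmonic_basis Y for Y :: "nat \<Rightarrow> nat \<Rightarrow> 'a::euclidean_space \<Rightarrow> real" +
  fixes \<phi> :: "real \<Rightarrow> real" and \<phi>hat :: "nat \<Rightarrow> real" and B :: real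
  assumes posdef: "positive_definite_function TYPE('a) \<phi> \<phi>hat"
    and bounded: "\<And>k. \<phi>hat k \<le> B"
begin

lemma \<phi>hat_pos: "\<phi>hat k > 0"
  using posdef by (auto simp: positive_definite_function_def)

lemma B_pos: "B > 0"
  using \<phi>hat_pos[of 0] bounded[of 0] by linarith

lemma summable_kernel: "summable (\<lambda>k. \<phi>hat k * (real (harmonic_dim TYPE('a) k)
    / sphere_volume TYPE('a)))"
  using posdef by (auto simp: positive_definite_function_def)

definition weighted :: "(nat \<Rightarrow> nat \<Rightarrow> real) \<Rightarrow> bool" where
  "weighted a \<longleftrightarrow> summable (\<lambda>k. block Y a a k / \<phi>hat k)"

definition synth :: "(nat \<Rightarrow> nat \<Rightarrow> real) \<Rightarrow> 'a \<Rightarrow> real" where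
  "synth a x = (if x \<in> sphere 0 1 then \<Sum>k. block Y a (\<lambda>k l. Y k l x) k else 0)"

abbreviation hat :: "('a \<Rightarrow> real) \<Rightarrow> nat \<Rightarrow> nat \<Rightarrow> real" where
  "hat \<equiv> harmonic_coeff Y"

abbreviation nnorm :: "('a \<Rightarrow> real) \<Rightarrow> real" where
  "nnorm \<equiv> native_norm Y \<phi>hat"

abbreviation H :: "('a \<Rightarrow> real) set" where "H \<equiv> native_space Y \<phi>hat"

lemma block_Y: "norm x = 1 \<Longrightarrow> block Y (\<lambda>k l. Y k l x) (\<lambda>k l. Y k l x) k
    = real (harmonic_dim TYPE('a) k) / sphere_volume TYPE('a)"
  using Z_diag by (simp add: block_def Z_def)

text \<open>Bounds the degree-\<open>k\<close> term of an expansion at every point of the sphere.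
  Being independent of the point, it serves as Weierstrass majorant and in termwise
  integration.\<close>

definition majorant :: "(nat \<Rightarrow> nat \<Rightarrow> real) \<Rightarrow> nat \<Rightarrow> real" where
  "majorant a k = (block Y a a k / \<phi>hat k + \<phi>hat k * (real (harmonic_dim TYPE('a) k)
      / sphere_volume TYPE('a))) / 2"

lemma summable_majorant: "weighted a \<Longrightarrow> summable (majorant a)"
  unfolding majorant_def weighted_def by (intro summable_divide summable_add summable_kernel)

lemma block_le_majorant:
  assumes "norm x = 1"
  shows "\<bar>block Y a (\<lambda>k l. Y k l x) k\<bar> \<le> majorant a k"
  using block_am_gm[of "1 / \<phi>hat k" Y a "\<lambda>k l. Y k l x" k] \<phi>hat_pos[of k]
  by (simp add: majorant_def block_Y[OF assms] mult.commute)

lemma synth_sums: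
  assumes "weighted a" "norm x = 1"
  shows "(\<lambda>k. block Y a (\<lambda>k l. Y k l x) k) sums synth a x"
proof -
  have "summable (\<lambda>k. block Y a (\<lambda>k l. Y k l x) k)"
    by (rule summable_comparison_test'[OF summable_majorant[OF assms(1)]])
       (use block_le_majorant[OF assms(2)] in simp)
  then show ?thesis using assms(2) by (simp add: synth_def summable_sums)
qed

lemma synth_bound:
  assumes "weighted a"
  shows "\<bar>synth a x\<bar> \<le> suminf (majorant a)"
proof (cases "norm x = 1")
  case True
  have sm: "summable (majorant a)" by (rule summable_majorant[OF assms])
  have sa: "summable (\<lambda>k. \<bar>block Y a (\<lambda>k l. Y k l x) k\<bar>)"
    by (rule summable_comparison_test'[OF sm]) (use block_le_majorant[OF True] in simp)
  have "\<bar>synth a x\<bar> \<le> (\<Sum>k. \<bar>block Y a (\<lambda>k l. Y k l x) k\<bar>)"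
    using True summable_rabs[OF sa] by (simp add: synth_def)
  also have "\<dots> \<le> suminf (majorant a)"
    using block_le_majorant[OF True] by (intro suminf_le sa sm)
  finally show ?thesis .
next
  case False
  have "majorant a k \<ge> 0" for k
    using \<phi>hat_pos[of k] sphere_volume_pos[where 'a = 'a] block_self_nonneg[of Y a k]
    by (auto simp: majorant_def intro!: add_nonneg_nonneg mult_nonneg_nonneg divide_nonneg_nonneg)
  then show ?thesis using False suminf_nonneg[OF summable_majorant[OF assms]]
      by (simp add: synth_def)
qed

lemma block_Y_harmonic: "(\<lambda>x. block Y a (\<lambda>k l. Y k l x) k) \<in> spherical_harmonics k"
  unfolding block_def using Y_harmonic by (intro spherical_harmonics_sum spherical_harmonics_cmult)
      auto

lemma synth_measurable:
  assumes "weighted a"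
  shows "synth a \<in> borel_measurable surface_measure"
proof (rule borel_measurable_LIMSEQ_real)
  fix x :: 'a assume "x \<in> space surface_measure"
  then show "(\<lambda>n. \<Sum>k<n. block Y a (\<lambda>k l. Y k l x) k) \<longlonglongrightarrow> synth a x"
    using synth_sums[OF assms, of x] by (simp add: sums_def)
next
  fix n
  show "(\<lambda>x. \<Sum>k<n. block Y a (\<lambda>k l. Y k l x) k) \<in> borel_measurable surface_measure"
    by (intro borel_measurable_sum borel_measurable_surface_continuous
        spherical_harmonics_continuous[OF block_Y_harmonic])
qed

text \<open>A summable uniform bound suffices because the surface measure is finite.\<close>

lemma integral_termwise:
  fixes f :: "nat \<Rightarrow> 'a \<Rightarrow> real"
  assumes "\<And>k. integrable surface_measure (f k)"
    and "\<And>k x. norm x = 1 \<Longrightarrow> \<bar>f k x\<bar> \<le> m k" and "summable m"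
    and "\<And>x. norm x = 1 \<Longrightarrow> (\<lambda>k. f k x) sums g x"
  shows "(\<lambda>k. \<integral>x. f k x \<partial>surface_measure) sums (\<integral>x. g x \<partial>surface_measure)"
proof -
  have sn: "AE x in surface_measure. summable (\<lambda>k. norm (f k x))"
    using assms(2) by (intro AE_I2 summable_comparison_test'[OF assms(3)]) auto
  have "(\<integral>x. norm (f k x) \<partial>surface_measure) \<le> (\<integral>x. m k \<partial>(surface_measure :: 'a measure))" for k
    using assms(2) by (intro integral_mono integrable_norm assms(1)) auto
  then have "norm (\<integral>x. norm (f k x) \<partial>surface_measure)
      \<le> m k * measure (surface_measure :: 'a measure) (sphere 0 1)" for k
    by (simp add: mult.commute)
  then have "summable (\<lambda>k. \<integral>x. norm (f k x) \<partial>surface_measure)"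
    by (intro summable_comparison_test'[OF summable_mult2[OF assms(3)]])
  from sums_integral[OF assms(1) sn this]
  have "(\<lambda>k. \<integral>x. f k x \<partial>surface_measure) sums (\<integral>x. (\<Sum>k. f k x) \<partial>surface_measure)" .
  also have "(\<integral>x. (\<Sum>k. f k x) \<partial>surface_measure) = (\<integral>x. g x \<partial>surface_measure)"
    using assms(4) by (intro Bochner_Integration.integral_cong) (auto simp: sums_iff)
  finally show ?thesis .
qed

lemma integral_block_Y:
  assumes "l \<in> {1..harmonic_dim TYPE('a) k}"
  shows "(\<integral>x. block Y a (\<lambda>k l. Y k l x) j * Y k l x \<partial>surface_measure) = (if j
      = k then a k l else 0)"
proof -
  have "(\<integral>x. block Y a (\<lambda>k l. Y k l x) j * Y k l x \<partial>surface_measure)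
      = (\<integral>x. (\<Sum>m=1..harmonic_dim TYPE('a) j. a j m * (Y j m x * Y k l x)) \<partial>surface_measure)"
    by (simp add: block_def sum_distrib_right mult.assoc)
  also have "\<dots> = (\<Sum>m=1..harmonic_dim TYPE('a) j. a j m * (\<integral>x. Y j m x * Y k l x \<partial>surface_measure))"
    by (subst Bochner_Integration.integral_sum)
       (use assms in \<open>auto intro!: integrable_mult_right integrable_harmonic_mult Y_harmonic\<close>)
  also have "\<dots> = (\<Sum>m=1..harmonic_dim TYPE('a) j. if j = k \<and> m = l then a k l else 0)"
  proof (rule sum.cong[OF refl])
    fix m assume "m \<in> {1..harmonic_dim TYPE('a) j}"
    then show "a j m * (\<integral>x. Y j m x * Y k l x \<partial>surface_measure) = (if j = k \<and> m
        = l then a k l else 0)"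
      using assms Y_orthonormal[of m k l] Y_orthogonal[of k j m l] by (cases "j = k") auto
  qed
  also have "\<dots> = (if j = k then a k l else 0)" using assms by auto
  finally show ?thesis .
qed

lemma harmonic_coeff_synth:
  assumes a: "weighted a" and l: "l \<in> {1..harmonic_dim TYPE('a) k}"
  shows "hat (synth a) k l = a k l"
proof -
  define C where "C = sqrt (real (harmonic_dim TYPE('a) k) / sphere_volume TYPE('a))"
  have C: "\<bar>Y k l x\<bar> \<le> C" if "norm x = 1" for x
  proof -
    have "(Y k l x)\<^sup>2 \<le> (\<Sum>l=1..harmonic_dim TYPE('a) k. (Y k l x)\<^sup>2)"
      using l by (intro member_le_sum) auto
    also have "\<dots> = real (harmonic_dim TYPE('a) k) / sphere_volume TYPE('a)"
      using Z_diag[OF that, of k] by (simp add: Z_def power2_eq_square)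
    finally show ?thesis unfolding C_def by (intro real_le_rsqrt) simp
  qed
  have "(\<lambda>j. \<integral>x. block Y a (\<lambda>k l. Y k l x) j * Y k l x \<partial>surface_measure)
      sums (\<integral>x. synth a x * Y k l x \<partial>surface_measure)"
  proof (rule integral_termwise)
    show "integrable surface_measure (\<lambda>x. block Y a (\<lambda>k l. Y k l x) j * Y k l x)" for j
      by (rule integrable_harmonic_mult[OF block_Y_harmonic Y_harmonic[OF l]])
    show "\<bar>block Y a (\<lambda>k l. Y k l x) j * Y k l x\<bar> \<le> majorant a j * C" if "norm x = 1" for j x
      unfolding abs_mult using block_le_majorant[OF that, of a j] C[OF that]
          by (intro mult_mono) auto
    show "summable (\<lambda>j. majorant a j * C)" by (intro summable_mult2 summable_majorant[OF a])
    show "(\<lambda>j. block Y a (\<lambda>k l. Y k l x) j * Y k l x) sums (synth a x * Y k l x)" if "norm x = 1"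
        for x
      by (intro sums_mult2 synth_sums[OF a that])
  qed
  then have "(\<lambda>j. if j = k then a k l else 0) sums hat (synth a) k l"
    unfolding integral_block_Y[OF l] harmonic_coeff_def .
  then show ?thesis using sums_single[of k "\<lambda>_. a k l"] sums_unique2 by blast
qed

lemma weighted_cong:
  assumes "\<And>k l. l \<in> {1..harmonic_dim TYPE('a) k} \<Longrightarrow> a k l = a' k l"
  shows "weighted a \<longleftrightarrow> weighted a'" "synth a = synth a'"
proof -
  have "block Y a a k = block Y a' a' k" for k by (rule block_cong[OF assms assms])
  then show "weighted a \<longleftrightarrow> weighted a'" by (simp add: weighted_def)
  have "block Y a (\<lambda>k l. Y k l x) = block Y a' (\<lambda>k l. Y k l x)" for x
    by (rule ext, rule block_cong) (simp_all add: assms)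
  then show "synth a = synth a'" by (intro ext) (simp only: synth_def)
qed

text \<open>A member is recovered pointwise from its coefficients, so that equality can be tested on
  coefficients, as in \<open>H_eqI\<close>.\<close>

lemma native_space_iff:
  "f \<in> H \<longleftrightarrow> weighted (hat f) \<and> f = synth (hat f)"
proof
  assume f: "f \<in> H"
  then have w: "weighted (hat f)"
    by (simp add: native_space_def weighted_def block_def power2_eq_square)
  moreover have "f x = synth (hat f) x" for x
  proof (cases "norm x = 1")
    case True
    then have "(\<lambda>k. block Y (hat f) (\<lambda>k l. Y k l x) k) sums f x"
      using f by (simp add: native_space_def block_def)
    then show ?thesis using synth_sums[OF w True] by (rule sums_unique2)
  next
    case False
    then show ?thesis using f by (simp add: native_space_def synth_def)
  qed
  ultimately show "weighted (hat f) \<and> f = synth (hat f)" by blast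
next
  assume f: "weighted (hat f) \<and> f = synth (hat f)"
  then have w: "weighted (hat f)" by (rule conjunct1)
  have eq: "f x = synth (hat f) x" for x by (rule fun_cong[OF conjunct2[OF f]])
  have "(\<lambda>k. \<Sum>l=1..harmonic_dim TYPE('a) k. hat f k l * Y k l x) sums f x" if "norm x = 1" for x
    unfolding eq[of x] using synth_sums[OF w that] by (simp only: block_def)
  moreover have "f x = 0" if "norm x \<noteq> 1" for x
    unfolding eq[of x] using that by (simp add: synth_def)
  ultimately show "f \<in> H"
    using w by (auto simp: native_space_def weighted_def block_def power2_eq_square)
qed

lemma synth_in_H:
  assumes "weighted a"
  shows "synth a \<in> H"
proof -
  note * = weighted_cong[of "hat (synth a)" a, OF harmonic_coeff_synth[OF assms]]
  show ?thesis unfolding native_space_iff using assms *(1) *(2)[symmetric] by blast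
qed

lemma H_eqI:
  assumes "f \<in> H" "g \<in> H"
    "\<And>k l. l \<in> {1..harmonic_dim TYPE('a) k} \<Longrightarrow> hat f k l = hat g k l"
  shows "f = g"
proof -
  have "f = synth (hat f)" using assms(1) unfolding native_space_iff by (rule conjunct2)
  also have "\<dots> = synth (hat g)" by (rule weighted_cong(2)[OF assms(3)])
  finally have "f = synth (hat g)" .
  moreover have "g = synth (hat g)" using assms(2) unfolding native_space_iff by (rule conjunct2)
  ultimately show ?thesis by (rule trans[OF _ sym])
qed

lemma H_sums:
  assumes "f \<in> H" "norm x = 1"
  shows "(\<lambda>k. block Y (hat f) (\<lambda>k l. Y k l x) k) sums f x"
proof -
  have w: "weighted (hat f)" and eq: "f = synth (hat f)"
    using assms(1) unfolding native_space_iff by (rule conjunct1, rule conjunct2)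
  show ?thesis using synth_sums[OF w assms(2)] unfolding eq[symmetric] .
qed

lemma weighted_lincomb:
  assumes "weighted a" "weighted b"
  shows "weighted (\<lambda>k l. c * a k l + d * b k l)"
  unfolding weighted_def
proof (rule summable_comparison_test')
  show "summable (\<lambda>k. 2 * c\<^sup>2 * (block Y a a k / \<phi>hat k) + 2 * d\<^sup>2 * (block Y b b k / \<phi>hat k))"
    using assms unfolding weighted_def by (intro summable_add summable_mult)
  fix k
  let ?e = "\<lambda>k l. c * a k l + d * b k l"
  have "block Y ?e ?e k \<le> 2 * c\<^sup>2 * block Y a a k + 2 * d\<^sup>2 * block Y b b k"
    unfolding block_def sum_distrib_left sum.distrib[symmetric]
  proof (rule sum_mono)
    fix l
    have "0 \<le> (c * a k l - d * b k l)\<^sup>2" by simp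
    then show "(c * a k l + d * b k l) * (c * a k l + d * b k l)
        \<le> 2 * c\<^sup>2 * (a k l * a k l) + 2 * d\<^sup>2 * (b k l * b k l)"
      by (simp add: power2_eq_square algebra_simps)
  qed
  then have "block Y ?e ?e k / \<phi>hat k \<le> (2 * c\<^sup>2 * block Y a a k + 2 * d\<^sup>2 * block Y b b k)
      / \<phi>hat k"
    using \<phi>hat_pos[of k] by (intro divide_right_mono) auto
  then show "norm (block Y ?e ?e k / \<phi>hat k) \<le> 2 * c\<^sup>2 * (block Y a a k / \<phi>hat k) + 2 * d\<^sup>2 *
      (block Y b b k / \<phi>hat k)"
    using block_self_nonneg[of Y ?e k] \<phi>hat_pos[of k] by (simp add: add_divide_distrib)
qed

lemma H_lincomb:
  assumes f: "f \<in> H" and g: "g \<in> H"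
  shows "(\<lambda>x. c * f x + d * g x) \<in> H"
    and "l \<in> {1..harmonic_dim TYPE('a) k} \<Longrightarrow> hat (\<lambda>x. c * f x + d * g x) k l
        = c * hat f k l + d * hat g k l"
proof -
  define a where "a = (\<lambda>k l. c * hat f k l + d * hat g k l)"
  have wf: "weighted (hat f)" and wg: "weighted (hat g)"
    using f g by (simp_all add: native_space_iff)
  have a: "weighted a" unfolding a_def by (rule weighted_lincomb[OF wf wg])
  have eq: "(\<lambda>x. c * f x + d * g x) = synth a"
  proof
    fix x
    show "c * f x + d * g x = synth a x"
    proof (cases "norm x = 1")
      case True
      have "(\<lambda>k. c * block Y (hat f) (\<lambda>k l. Y k l x) k + d * block Y (hat g) (\<lambda>k l. Y k l x) k)
          sums (c * f x + d * g x)"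
        by (intro sums_add sums_mult H_sums f g True)
      then show ?thesis
        using synth_sums[OF a True] unfolding a_def block_lincomb by (rule sums_unique2)
    next
      case False
      then show ?thesis using f g by (auto simp: native_space_def synth_def)
    qed
  qed
  show "(\<lambda>x. c * f x + d * g x) \<in> H" unfolding eq by (rule synth_in_H[OF a])
  show "hat (\<lambda>x. c * f x + d * g x) k l = c * hat f k l + d * hat g k l"
    if "l \<in> {1..harmonic_dim TYPE('a) k}"
    using harmonic_coeff_synth[OF a that] unfolding eq by (simp only: a_def)
qed

lemma H_zero: "(\<lambda>_. 0) \<in> H"
  by (simp add: native_space_def harmonic_coeff_def)

section \<open>Inner product and norm of the native space\<close>

definition nip :: "('a \<Rightarrow> real) \<Rightarrow> ('a \<Rightarrow> real) \<Rightarrow> real" where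
  "nip f g = (\<Sum>k. block Y (hat f) (hat g) k / \<phi>hat k)"

lemma weighted_H: "f \<in> H \<Longrightarrow> weighted (hat f)"
  by (simp add: native_space_iff)

lemma summable_nip:
  assumes "f \<in> H" "g \<in> H"
  shows "summable (\<lambda>k. \<bar>block Y (hat f) (hat g) k\<bar> / \<phi>hat k)"
    and "summable (\<lambda>k. block Y (hat f) (hat g) k / \<phi>hat k)"
proof -
  let ?a = "hat f" and ?b = "hat g"
  have s: "summable (\<lambda>k. (block Y ?a ?a k / \<phi>hat k + block Y ?b ?b k / \<phi>hat k) / 2)"
    using weighted_H[OF assms(1)] weighted_H[OF assms(2)]
    by (auto simp: weighted_def intro!: summable_divide summable_add)
  have bound: "\<bar>block Y ?a ?b k\<bar> / \<phi>hat k \<le> (block Y ?a ?a k / \<phi>hat k + block Y ?b ?b k / \<phi>hat k)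
      / 2" for k
    using divide_right_mono[OF block_am_gm[of 1 Y ?a ?b k], of "\<phi>hat k"] \<phi>hat_pos[of k]
        by (simp add: add_divide_distrib)
  show "summable (\<lambda>k. \<bar>block Y ?a ?b k\<bar> / \<phi>hat k)"
    by (rule summable_comparison_test'[OF s]) (use bound \<phi>hat_pos in \<open>simp add: less_imp_le\<close>)
  show "summable (\<lambda>k. block Y ?a ?b k / \<phi>hat k)"
    by (rule summable_comparison_test'[OF s]) (use bound \<phi>hat_pos in \<open>simp add: abs_mult
        less_imp_le\<close>)
qed

lemma nip_commute: "nip f g = nip g f"
  by (simp add: nip_def block_commute)

lemma nip_lincomb:
  assumes "f \<in> H" "g \<in> H" "h \<in> H"
  shows "nip (\<lambda>x. c * f x + d * g x) h = c * nip f h + d * nip g h"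
proof -
  have "block Y (hat (\<lambda>x. c * f x + d * g x)) (hat h) k
      = c * block Y (hat f) (hat h) k + d * block Y (hat g) (hat h) k" for k
    unfolding block_lincomb[symmetric] by (rule block_cong)
        (simp_all add: H_lincomb(2)[OF assms(1,2)])
  then have "nip (\<lambda>x. c * f x + d * g x) h = (\<Sum>k. c * (block Y (hat f) (hat h) k / \<phi>hat k)
      + d * (block Y (hat g) (hat h) k / \<phi>hat k))"
    by (simp add: nip_def add_divide_distrib)
  also have "\<dots> = c * nip f h + d * nip g h"
    unfolding nip_def
    by (rule sums_unique[symmetric], intro sums_add sums_mult summable_sums summable_nip(2) assms)
  finally show ?thesis .
qed

lemma nip_self_nonneg: "f \<in> H \<Longrightarrow> nip f f \<ge> 0"
  unfolding nip_def using summable_nip(2)[of f f] \<phi>hat_pos block_self_nonneg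
  by (intro suminf_nonneg divide_nonneg_pos) auto

lemma native_norm_eq: "nnorm f = sqrt (nip f f)"
  by (simp add: native_norm_def nip_def block_def power2_eq_square)

lemma native_norm_nonneg: "f \<in> H \<Longrightarrow> nnorm f \<ge> 0"
  by (simp add: native_norm_eq nip_self_nonneg)

lemma native_norm_sq: "f \<in> H \<Longrightarrow> (nnorm f)\<^sup>2 = nip f f"
  by (simp add: native_norm_eq nip_self_nonneg)

lemma native_norm_zero_imp:
  assumes f: "f \<in> H" and "nnorm f = 0"
  shows "f = (\<lambda>_. 0)"
proof (rule H_eqI[OF f H_zero])
  fix k l assume l: "l \<in> {1..harmonic_dim TYPE('a) k}"
  have "nip f f = 0" using assms by (simp add: native_norm_eq)
  then have "\<forall>k. block Y (hat f) (hat f) k / \<phi>hat k = 0"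
    using suminf_eq_zero_iff[OF summable_nip(2)[OF f f] divide_nonneg_pos[OF block_self_nonneg
        \<phi>hat_pos]]
    unfolding nip_def by blast
  then have "block Y (hat f) (hat f) k = 0"
    using \<phi>hat_pos[of k] by (metis divide_eq_0_iff less_irrefl)
  then have "hat f k l * hat f k l = 0"
    unfolding block_def using l by (subst (asm) sum_nonneg_eq_0_iff) auto
  then show "hat f k l = hat (\<lambda>_. 0) k l"
    by (simp add: harmonic_coeff_def)
qed

text \<open>The absolute values stand inside the sum because \<open>quadrature_error\<close> bounds
  the blocks of the tail individually. The choice \<open>t = G / F\<close> balances the two terms of
  the arithmetic-geometric mean inequality.\<close>

lemma nip_abs_Cauchy_Schwarz:
  assumes f: "f \<in> H" and g: "g \<in> H"
  shows "(\<Sum>k. \<bar>block Y (hat f) (hat g) k\<bar> / \<phi>hat k) \<le> nnorm f * nnorm g"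
proof -
  let ?a = "hat f" and ?b = "hat g"
  define F G where "F = nnorm f" and "G = nnorm g"
  show ?thesis
  proof (cases "F = 0 \<or> G = 0")
    case True
    then have "f = (\<lambda>_. 0) \<or> g = (\<lambda>_. 0)"
      using native_norm_zero_imp f g by (auto simp: F_def G_def)
    then have "block Y ?a ?b k = 0" for k by (auto simp: block_def harmonic_coeff_def)
    then show ?thesis using True by (auto simp: F_def G_def)
  next
    case False
    then have pos: "F > 0" "G > 0"
      using native_norm_nonneg f g by (auto simp: F_def G_def less_le)
    define t where "t = G / F"
    have t: "t > 0" using pos by (simp add: t_def)
    have "(\<Sum>k. \<bar>block Y ?a ?b k\<bar> / \<phi>hat k) \<le> (\<Sum>k. (t * (block Y ?a ?a k / \<phi>hat k) + (block Y ?b ?b k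
        / \<phi>hat k) / t) / 2)"
    proof (rule suminf_le)
      show "summable (\<lambda>k. \<bar>block Y ?a ?b k\<bar> / \<phi>hat k)" by (rule summable_nip(1)[OF f g])
      show "summable (\<lambda>k. (t * (block Y ?a ?a k / \<phi>hat k) + (block Y ?b ?b k / \<phi>hat k) / t) / 2)"
        by (intro summable_divide summable_add summable_mult summable_nip(2) f g)
      show "\<bar>block Y ?a ?b k\<bar> / \<phi>hat k \<le> (t * (block Y ?a ?a k / \<phi>hat k) + (block Y ?b ?b k
          / \<phi>hat k) / t) / 2" for k
        using divide_right_mono[OF block_am_gm[OF t, of Y ?a ?b k], of "\<phi>hat k"] \<phi>hat_pos[of k]
        by (simp add: add_divide_distrib mult_ac)
    qed
    also have "\<dots> = (t * nip f f + nip g g / t) / 2"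
      unfolding nip_def
      by (rule sums_unique[symmetric], intro sums_divide sums_add sums_mult summable_sums
          summable_nip(2) f g)
    also have "\<dots> = (t * F\<^sup>2 + G\<^sup>2 / t) / 2"
      using f g by (simp add: F_def G_def native_norm_sq)
    also have "\<dots> = F * G" using pos by (simp add: t_def power2_eq_square)
    finally show ?thesis by (simp add: F_def G_def)
  qed
qed

lemma nip_Cauchy_Schwarz:
  assumes "f \<in> H" "g \<in> H"
  shows "\<bar>nip f g\<bar> \<le> nnorm f * nnorm g"
proof -
  have "\<bar>nip f g\<bar> \<le> (\<Sum>k. \<bar>block Y (hat f) (hat g) k / \<phi>hat k\<bar>)"
    unfolding nip_def using summable_nip(1)[OF assms] \<phi>hat_pos
    by (intro summable_rabs) (simp add: abs_mult less_imp_le)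
  also have "\<dots> = (\<Sum>k. \<bar>block Y (hat f) (hat g) k\<bar> / \<phi>hat k)"
    using \<phi>hat_pos by (simp add: less_imp_le)
  also note nip_abs_Cauchy_Schwarz[OF assms]
  finally show ?thesis .
qed

lemma native_norm_triangle:
  assumes f: "f \<in> H" and g: "g \<in> H"
  shows "nnorm (\<lambda>x. f x + g x) \<le> nnorm f + nnorm g"
proof (rule power2_le_imp_le)
  have h: "(\<lambda>x. f x + g x) \<in> H" using H_lincomb(1)[OF f g, of 1 1] by simp
  have 1: "nip (\<lambda>x. f x + g x) u = nip f u + nip g u" if "u \<in> H" for u
    using nip_lincomb[OF f g that, of 1 1] by simp
  have "(nnorm (\<lambda>x. f x + g x))\<^sup>2 = nip (\<lambda>x. f x + g x) f + nip (\<lambda>x. f x + g x) g"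
    unfolding native_norm_sq[OF h] 1[OF h] nip_commute[of f] nip_commute[of g] ..
  also have "\<dots> = nip f f + 2 * nip f g + nip g g"
    unfolding 1[OF f] 1[OF g] using nip_commute[of g f] by linarith
  also have "\<dots> \<le> nip f f + 2 * (nnorm f * nnorm g) + nip g g"
    using nip_Cauchy_Schwarz[OF f g] by simp
  also have "\<dots> = (nnorm f + nnorm g)\<^sup>2"
    using native_norm_sq[OF f] native_norm_sq[OF g] by (simp add: power2_sum)
  finally show "(nnorm (\<lambda>x. f x + g x))\<^sup>2 \<le> (nnorm f + nnorm g)\<^sup>2" .
qed (use native_norm_nonneg f g in auto)

end

subsection \<open>Integral and empirical operators\<close>

context native_rkhs
begin

lemma block_scale_right: "block Y a (\<lambda>k l. r k * b k l) k = r k * block Y a b k"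
  by (simp add: block_def sum_distrib_left mult_ac)

lemma block_scale_left: "block Y (\<lambda>k l. r k * a k l) b k = r k * block Y a b k"
  by (simp add: block_def sum_distrib_left mult_ac)

lemma weighted_kernel: "norm x = 1 \<Longrightarrow> weighted (\<lambda>k l. \<phi>hat k * Y k l x)"
  using summable_kernel \<phi>hat_pos
  by (simp add: weighted_def block_scale_right block_scale_left block_Y less_imp_neq[symmetric])

lemma kernel_sums:
  assumes "norm x = 1" "norm y = 1"
  shows "(\<lambda>k. \<phi>hat k * Z k x y) sums \<phi> (x \<bullet> y)"
proof -
  have "\<bar>x \<bullet> y\<bar> \<le> 1" using Cauchy_Schwarz_ineq2[of x y] assms by simp
  then have "x \<bullet> y \<in> {-1..1}" by auto
  then have "(\<lambda>k. \<phi>hat k * (real (harmonic_dim TYPE('a) k) / sphere_volume TYPE('a))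
      * poly (legendre_poly DIM('a) k) (x \<bullet> y)) sums \<phi> (x \<bullet> y)"
    using posdef by (auto simp: positive_definite_function_def)
  then show ?thesis by (simp only: addition_theorem[OF assms] mult.assoc)
qed

definition kernel_at :: "'a \<Rightarrow> 'a \<Rightarrow> real" where
  "kernel_at x = sphere_restrict (\<lambda>y. \<phi> (x \<bullet> y))"

lemma kernel_at_eq:
  assumes x: "norm x = 1"
  shows "kernel_at x = synth (\<lambda>k l. \<phi>hat k * Y k l x)"
proof
  fix y
  show "kernel_at x y = synth (\<lambda>k l. \<phi>hat k * Y k l x) y"
  proof (cases "norm y = 1")
    case True
    have "(\<lambda>k. \<phi>hat k * Z k x y) sums synth (\<lambda>k l. \<phi>hat k * Y k l x) y"
      using synth_sums[OF weighted_kernel[OF x] True]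
      unfolding block_scale_left by (simp only: block_def Z_def)
    then have "\<phi> (x \<bullet> y) = synth (\<lambda>k l. \<phi>hat k * Y k l x) y"
      by (rule sums_unique2[OF kernel_sums[OF x True]])
    then show ?thesis using True by (simp add: kernel_at_def sphere_restrict_def)
  qed (simp add: kernel_at_def sphere_restrict_def synth_def)
qed

lemma kernel_at_in_H: "norm x = 1 \<Longrightarrow> kernel_at x \<in> H"
  by (simp add: kernel_at_eq synth_in_H weighted_kernel)

lemma reproducing:
  assumes f: "f \<in> H" and x: "norm x = 1"
  shows "nip f (kernel_at x) = f x"
proof -
  have "block Y (hat f) (hat (kernel_at x)) k = \<phi>hat k * block Y (hat f) (\<lambda>k l. Y k l x) k" for k
    unfolding block_scale_right[symmetric] kernel_at_eq[OF x]
    by (rule block_cong) (simp_all add: harmonic_coeff_synth[OF weighted_kernel[OF x]])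
  then have "nip f (kernel_at x) = (\<Sum>k. block Y (hat f) (\<lambda>k l. Y k l x) k)"
    using \<phi>hat_pos by (simp add: nip_def less_imp_neq[symmetric])
  then show ?thesis using H_sums[OF f x] by (simp add: sums_iff)
qed

lemma weighted_smoothing:
  assumes "f \<in> H"
  shows "weighted (\<lambda>k l. \<phi>hat k * hat f k l)"
  unfolding weighted_def block_scale_left block_scale_right
proof (rule summable_comparison_test')
  let ?b = "\<lambda>k. block Y (hat f) (hat f) k"
  show "summable (\<lambda>k. B\<^sup>2 * (?b k / \<phi>hat k))"
    using weighted_H[OF assms] unfolding weighted_def by (rule summable_mult)
  fix k
  have "\<phi>hat k * \<phi>hat k \<le> B\<^sup>2"
    unfolding power2_eq_square using bounded[of k] \<phi>hat_pos[of k] by (intro mult_mono) auto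
  then have "(\<phi>hat k * \<phi>hat k) * (?b k / \<phi>hat k) \<le> B\<^sup>2 * (?b k / \<phi>hat k)"
    using block_self_nonneg \<phi>hat_pos[of k] by (intro mult_right_mono divide_nonneg_pos) auto
  moreover have "(\<phi>hat k * \<phi>hat k) * (?b k / \<phi>hat k) = \<phi>hat k * (\<phi>hat k * ?b k) / \<phi>hat k" by simp
  moreover have "0 \<le> \<phi>hat k * (\<phi>hat k * ?b k) / \<phi>hat k"
    using block_self_nonneg \<phi>hat_pos[of k] by (intro divide_nonneg_pos mult_nonneg_nonneg)
        (auto simp: less_imp_le)
  ultimately show "norm (\<phi>hat k * (\<phi>hat k * ?b k) / \<phi>hat k) \<le> B\<^sup>2 * (?b k / \<phi>hat k)"
    by simp
qed

lemma Z_bound: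
  assumes "norm x = 1" "norm y = 1"
  shows "\<bar>Z k x y\<bar> \<le> real (harmonic_dim TYPE('a) k) / sphere_volume TYPE('a)"
  using block_am_gm[of 1 Y "\<lambda>k l. Y k l x" "\<lambda>k l. Y k l y" k] block_Y[OF assms(1), of k] block_Y[OF
      assms(2), of k]
  by (simp add: Z_def block_def)

text \<open>The addition theorem turns the kernel into a series of reproducing kernels; it can be
  integrated termwise because members of the native space are bounded.\<close>

lemma integral_op_eq:
  assumes f: "f \<in> H"
  shows "integral_op \<phi> f = synth (\<lambda>k l. \<phi>hat k * hat f k l)"
proof
  fix x :: 'a
  show "integral_op \<phi> f x = synth (\<lambda>k l. \<phi>hat k * hat f k l) x"
  proof (cases "norm x = 1")
    case x: True
    have w: "weighted (hat f)" and fs: "f = synth (hat f)"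
      using f unfolding native_space_iff by (rule conjunct1, rule conjunct2)
    define C where "C = suminf (majorant (hat f))"
    have C: "\<bar>f y\<bar> \<le> C" for y
      unfolding C_def by (subst fs) (rule synth_bound[OF w])
    have fm: "f \<in> borel_measurable surface_measure"
      by (subst fs) (rule synth_measurable[OF w])
    have fY: "integrable surface_measure (\<lambda>y. Y k l y * f y)" if l: "l
        \<in> {1..harmonic_dim TYPE('a) k}" for k l
    proof (rule Bochner_Integration.integrable_bound)
      note cont = spherical_harmonics_continuous[OF Y_harmonic[OF l]]
      show "integrable surface_measure (\<lambda>y. Y k l y * C)"
        by (intro integrable_mult_left integrable_surface_continuous cont)
      show "(\<lambda>y. Y k l y * f y) \<in> borel_measurable surface_measure"
        by (intro borel_measurable_times borel_measurable_surface_continuous cont fm)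
      have "\<bar>f y\<bar> \<le> \<bar>C\<bar>" for y using C[of y] by linarith
      then show "AE y in surface_measure. norm (Y k l y * f y) \<le> norm (Y k l y * C)"
        by (intro AE_I2) (simp add: abs_mult mult_left_mono)
    qed
    have Zint: "(\<integral>y. \<phi>hat k * Z k x y * f y \<partial>surface_measure)
        = \<phi>hat k * block Y (hat f) (\<lambda>k l. Y k l x) k"
      and Zi: "integrable surface_measure (\<lambda>y. \<phi>hat k * Z k x y * f y)" for k
    proof -
      have eq: "\<phi>hat k * Z k x y * f y = (\<Sum>l=1..harmonic_dim TYPE('a) k. \<phi>hat k * Y k l x * (Y k l y
          * f y))" for y
        by (simp add: Z_def sum_distrib_left sum_distrib_right mult_ac)
      show "integrable surface_measure (\<lambda>y. \<phi>hat k * Z k x y * f y)"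
        unfolding eq by (intro Bochner_Integration.integrable_sum integrable_mult_right fY)
      have "(\<integral>y. \<phi>hat k * Z k x y * f y \<partial>surface_measure)
          = (\<Sum>l=1..harmonic_dim TYPE('a) k. \<phi>hat k * Y k l x * (\<integral>y. Y k l y
          * f y \<partial>surface_measure))"
        unfolding eq by (subst Bochner_Integration.integral_sum)
            (auto intro!: integrable_mult_right fY)
      then show "(\<integral>y. \<phi>hat k * Z k x y * f y \<partial>surface_measure)
          = \<phi>hat k * block Y (hat f) (\<lambda>k l. Y k l x) k"
        by (simp add: block_def harmonic_coeff_def sum_distrib_left mult_ac)
    qed
    have "(\<lambda>k. \<integral>y. \<phi>hat k * Z k x y * f y \<partial>surface_measure)
        sums (\<integral>y. \<phi> (x \<bullet> y) * f y \<partial>surface_measure)"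
    proof (rule integral_termwise)
      show "integrable surface_measure (\<lambda>y. \<phi>hat k * Z k x y * f y)" for k by (rule Zi)
      show "\<bar>\<phi>hat k * Z k x y * f y\<bar> \<le> \<phi>hat k * (real (harmonic_dim TYPE('a) k)
          / sphere_volume TYPE('a)) * C"
        if "norm y = 1" for k y
      proof -
        have D: "0 \<le> real (harmonic_dim TYPE('a) k) / sphere_volume TYPE('a)"
          using Z_bound[OF x that, of k] by linarith
        have "\<bar>\<phi>hat k * Z k x y * f y\<bar> = \<phi>hat k * \<bar>Z k x y\<bar> * \<bar>f y\<bar>"
          using \<phi>hat_pos[of k] by (simp add: abs_mult)
        also have "\<dots> \<le> \<phi>hat k * (real (harmonic_dim TYPE('a) k) / sphere_volume TYPE('a)) * C"
          by (intro mult_mono mult_left_mono Z_bound x that C mult_nonneg_nonneg D less_imp_le[OF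
              \<phi>hat_pos] abs_ge_zero)
        finally show ?thesis .
      qed
      show "summable (\<lambda>k. \<phi>hat k * (real (harmonic_dim TYPE('a) k) / sphere_volume TYPE('a)) * C)"
        by (intro summable_mult2 summable_kernel)
      show "(\<lambda>k. \<phi>hat k * Z k x y * f y) sums (\<phi> (x \<bullet> y) * f y)" if "norm y = 1" for y
        by (intro sums_mult2 kernel_sums[OF x that])
    qed
    then have "(\<lambda>k. block Y (\<lambda>k l. \<phi>hat k * hat f k l) (\<lambda>k l. Y k l x) k)
        sums (\<integral>y. \<phi> (x \<bullet> y) * f y \<partial>surface_measure)"
      unfolding Zint block_scale_left .
    moreover have "(\<lambda>k. block Y (\<lambda>k l. \<phi>hat k * hat f k l) (\<lambda>k l. Y k l x) k)
        sums synth (\<lambda>k l. \<phi>hat k * hat f k l) x"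
      by (rule synth_sums[OF weighted_smoothing[OF f] x])
    ultimately have "(\<integral>y. \<phi> (x \<bullet> y) * f y \<partial>surface_measure) = synth (\<lambda>k l. \<phi>hat k * hat f k l) x"
      by (rule sums_unique2)
    then show ?thesis using x by (simp add: integral_op_def sphere_restrict_def)
  qed (simp add: integral_op_def sphere_restrict_def synth_def)
qed

lemma integral_op_in_H: "f \<in> H \<Longrightarrow> integral_op \<phi> f \<in> H"
  by (simp add: integral_op_eq synth_in_H weighted_smoothing)

lemma harmonic_coeff_integral_op:
  "f \<in> H \<Longrightarrow> l \<in> {1..harmonic_dim TYPE('a) k} \<Longrightarrow> hat (integral_op \<phi> f) k l = \<phi>hat k * hat f k l"
  by (simp add: integral_op_eq harmonic_coeff_synth weighted_smoothing)

lemma nip_integral_op: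
  assumes "f \<in> H"
  shows "nip (integral_op \<phi> f) g = (\<Sum>k. block Y (hat f) (hat g) k)"
proof -
  have "block Y (hat (integral_op \<phi> f)) (hat g) k = \<phi>hat k * block Y (hat f) (hat g) k" for k
    unfolding block_scale_left[symmetric] by (rule block_cong)
        (simp_all add: harmonic_coeff_integral_op[OF assms])
  then show ?thesis using \<phi>hat_pos by (simp add: nip_def less_imp_neq[symmetric])
qed

lemma summable_block:
  assumes "f \<in> H" "g \<in> H"
  shows "summable (\<lambda>k. block Y (hat f) (hat g) k)"
proof (rule summable_comparison_test')
  show "summable (\<lambda>k. B * (\<bar>block Y (hat f) (hat g) k\<bar> / \<phi>hat k))"
    by (intro summable_mult summable_nip(1) assms)
  fix k
  have "\<bar>block Y (hat f) (hat g) k\<bar> = \<phi>hat k * (\<bar>block Y (hat f) (hat g) k\<bar> / \<phi>hat k)"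
    using \<phi>hat_pos[of k] by simp
  also have "\<dots> \<le> B * (\<bar>block Y (hat f) (hat g) k\<bar> / \<phi>hat k)"
    using bounded[of k] \<phi>hat_pos[of k] by (intro mult_right_mono) auto
  finally show "norm (block Y (hat f) (hat g) k) \<le> B * (\<bar>block Y (hat f) (hat g) k\<bar> / \<phi>hat k)"
    by simp
qed

text \<open>What the two operators have in common. Coercivity of the shifted operators is derived
  from this alone, so that one perturbation lemma yields both inequalities.\<close>

definition accretive :: "(('a \<Rightarrow> real) \<Rightarrow> 'a \<Rightarrow> real) \<Rightarrow> bool" where
  "accretive G \<longleftrightarrow> (\<forall>f\<in>H. G f \<in> H \<and> nip (G f) f \<ge> 0) \<and>
     (\<forall>f\<in>H. \<forall>g\<in>H. \<forall>c d. G (\<lambda>x. c * f x + d * g x) = (\<lambda>x. c * G f x + d * G g x))"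

lemma accretive_integral_op: "accretive (integral_op \<phi>)"
  unfolding accretive_def
proof (intro conjI ballI allI)
  fix f assume f: "f \<in> H"
  show "integral_op \<phi> f \<in> H" by (rule integral_op_in_H[OF f])
  show "nip (integral_op \<phi> f) f \<ge> 0"
    unfolding nip_integral_op[OF f] by (intro suminf_nonneg summable_block f block_self_nonneg)
next
  fix f g c d assume f: "f \<in> H" and g: "g \<in> H"
  note fg = H_lincomb(1)[OF f g, of c d]
  note Lfg = H_lincomb[OF integral_op_in_H[OF f] integral_op_in_H[OF g], where c = c and d = d]
  show "integral_op \<phi> (\<lambda>x. c * f x + d * g x) = (\<lambda>x. c * integral_op \<phi> f x + d * integral_op \<phi> g x)"
  proof (rule H_eqI[OF integral_op_in_H[OF fg] Lfg(1)])
    fix k l assume l: "l \<in> {1..harmonic_dim TYPE('a) k}"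
    show "hat (integral_op \<phi> (\<lambda>x. c * f x + d * g x)) k l
        = hat (\<lambda>x. c * integral_op \<phi> f x + d * integral_op \<phi> g x) k l"
      unfolding Lfg(2)[OF l] harmonic_coeff_integral_op[OF fg l] harmonic_coeff_integral_op[OF f l]
        harmonic_coeff_integral_op[OF g l] H_lincomb(2)[OF f g l] by (simp add: algebra_simps)
  qed
qed

lemma shifted_op_lincomb:
  assumes "accretive G" "f \<in> H" "g \<in> H"
  shows "shifted_op G \<mu> (\<lambda>x. c * f x + d * g x)
      = (\<lambda>x. c * shifted_op G \<mu> f x + d * shifted_op G \<mu> g x)"
proof -
  have "G (\<lambda>x. c * f x + d * g x) = (\<lambda>x. c * G f x + d * G g x)"
    using assms unfolding accretive_def by blast
  then show ?thesis by (simp add: shifted_op_def algebra_simps)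
qed

lemma shifted_op_in_H:
  assumes "accretive G" "f \<in> H"
  shows "shifted_op G \<mu> f \<in> H"
  using H_lincomb(1)[of "G f" f 1 \<mu>] assms by (simp add: accretive_def shifted_op_def)

lemma shifted_op_coercive:
  assumes G: "accretive G" and f: "f \<in> H" and \<mu>: "\<mu> > 0"
  shows "\<mu> * nip f f \<le> nip (shifted_op G \<mu> f) f"
    and "\<mu> * nnorm f \<le> nnorm (shifted_op G \<mu> f)"
proof -
  have Gf: "G f \<in> H" "nip (G f) f \<ge> 0" using G f by (auto simp: accretive_def)
  have "nip (shifted_op G \<mu> f) f = nip (G f) f + \<mu> * nip f f"
    using nip_lincomb[OF Gf(1) f f, of 1 \<mu>] by (simp add: shifted_op_def)
  then show *: "\<mu> * nip f f \<le> nip (shifted_op G \<mu> f) f" using Gf(2) by simp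
  have nn: "nnorm f \<ge> 0" "nnorm (shifted_op G \<mu> f) \<ge> 0"
    using native_norm_nonneg f shifted_op_in_H[OF G f] by auto
  have "\<mu> * nnorm f * nnorm f \<le> nnorm (shifted_op G \<mu> f) * nnorm f"
    using * nip_Cauchy_Schwarz[OF shifted_op_in_H[OF G f] f, of \<mu>] native_norm_sq[OF f]
    by (simp add: power2_eq_square mult.assoc)
  then show "\<mu> * nnorm f \<le> nnorm (shifted_op G \<mu> f)"
    using nn by (cases "nnorm f = 0") auto
qed

lemma shifted_op_bij:
  assumes G: "accretive G" and \<mu>: "\<mu> > 0" and surj: "\<And>g. g \<in> H \<Longrightarrow> \<exists>f\<in>H. shifted_op G \<mu> f = g"
  shows "bij_betw (shifted_op G \<mu>) H H"
  unfolding bij_betw_def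
proof
  show "inj_on (shifted_op G \<mu>) H"
  proof (rule inj_onI)
    fix f g assume f: "f \<in> H" and g: "g \<in> H" and eq: "shifted_op G \<mu> f = shifted_op G \<mu> g"
    define h where "h = (\<lambda>x. 1 * f x + (-1) * g x)"
    have h: "h \<in> H" unfolding h_def by (rule H_lincomb(1)[OF f g])
    have "shifted_op G \<mu> h = (\<lambda>_. 0)"
      unfolding h_def shifted_op_lincomb[OF G f g] eq by simp
    then have "nnorm (shifted_op G \<mu> h) = 0"
      by (simp add: native_norm_def harmonic_coeff_def)
    then have "nnorm h = 0"
      using shifted_op_coercive(2)[OF G h \<mu>] native_norm_nonneg[OF h] \<mu> by (simp add: mult_le_0_iff)
    then have "h = (\<lambda>_. 0)" by (rule native_norm_zero_imp[OF h])
    then show "f = g" by (simp add: h_def fun_eq_iff)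
  qed
  show "shifted_op G \<mu> ` H = H"
  proof (intro equalityI subsetI)
    fix g assume "g \<in> H"
    then obtain f where "f \<in> H" "shifted_op G \<mu> f = g" using surj by blast
    then show "g \<in> shifted_op G \<mu> ` H" by blast
  qed (auto intro: shifted_op_in_H[OF G])
qed

text \<open>The inverse of \<open>G + \<mu>\<close> applied to \<open>F + \<mu>\<close> is the
  identity plus that inverse applied to \<open>F - G\<close>, and coercivity bounds the inverse by
  \<open>1 / \<mu>\<close>.\<close>

lemma resolvent_perturbation:
  assumes G: "accretive G" and F: "accretive F" and \<mu>: "\<mu> > 0"
    and bij: "bij_betw (shifted_op G \<mu>) H H"
    and diff: "\<And>f. f \<in> H \<Longrightarrow> nnorm (\<lambda>x. F f x - G f x) \<le> \<epsilon> * nnorm f"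
    and \<epsilon>: "\<epsilon> \<ge> 0"
  shows "native_onorm Y \<phi>hat (inv_into H (shifted_op G \<mu>) \<circ> shifted_op F \<mu>) \<le> ereal (1 + \<epsilon> / \<mu>)"
  unfolding native_onorm_def
proof (rule SUP_least)
  fix f assume f: "f \<in> H"
  define h where "h = inv_into H (shifted_op G \<mu>) (shifted_op F \<mu> f)"
  have Ff: "shifted_op F \<mu> f \<in> shifted_op G \<mu> ` H"
    using bij shifted_op_in_H[OF F f] by (simp add: bij_betw_def)
  have h: "h \<in> H" "shifted_op G \<mu> h = shifted_op F \<mu> f"
    unfolding h_def using inv_into_into[OF Ff] f_inv_into_f[OF Ff] by auto
  define u where "u = (\<lambda>x. 1 * h x + (-1) * f x)"
  have u: "u \<in> H" unfolding u_def by (rule H_lincomb(1)[OF h(1) f])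
  have "shifted_op G \<mu> u = (\<lambda>x. F f x - G f x)"
    unfolding u_def shifted_op_lincomb[OF G h(1) f] h(2) by (simp add: shifted_op_def)
  then have "\<mu> * nnorm u \<le> \<epsilon> * nnorm f"
    using shifted_op_coercive(2)[OF G u \<mu>] diff[OF f] by simp
  then have "nnorm u \<le> \<epsilon> / \<mu> * nnorm f" using \<mu> by (simp add: field_simps)
  moreover have "nnorm h \<le> nnorm f + nnorm u"
    using native_norm_triangle[OF f u] by (simp add: u_def)
  ultimately have "nnorm h \<le> (1 + \<epsilon> / \<mu>) * nnorm f" by (simp add: algebra_simps)
  \<comment> \<open>For \<open>nnorm f = 0\<close> the quotient is 0 by the convention on
    division.\<close>
  then have "nnorm h / nnorm f \<le> 1 + \<epsilon> / \<mu>"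
    using native_norm_nonneg[OF f] \<epsilon> \<mu> by (cases "nnorm f = 0") (auto simp: divide_le_eq less_le)
  then show "ereal (nnorm ((inv_into H (shifted_op G \<mu>) \<circ> shifted_op F \<mu>) f) / nnorm f)
      \<le> ereal (1 + \<epsilon> / \<mu>)"
    by (simp add: h_def)
qed

lemma integral_op_surj:
  assumes \<mu>: "\<mu> > 0" and g: "g \<in> H"
  shows "\<exists>f\<in>H. shifted_op (integral_op \<phi>) \<mu> f = g"
proof
  \<comment> \<open>The integral operator is diagonal in the basis, so its shift is inverted
    coefficientwise.\<close>
  define a where "a = (\<lambda>k l. 1 / (\<phi>hat k + \<mu>) * hat g k l)"
  have pos: "\<phi>hat k + \<mu> > 0" for k using \<phi>hat_pos[of k] \<mu> by simp
  have a: "weighted a"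
    unfolding weighted_def a_def block_scale_left block_scale_right
  proof (rule summable_comparison_test')
    let ?b = "\<lambda>k. block Y (hat g) (hat g) k"
    show "summable (\<lambda>k. 1 / \<mu>\<^sup>2 * (?b k / \<phi>hat k))"
      using weighted_H[OF g] unfolding weighted_def by (rule summable_mult)
    fix k
    have "1 / (\<phi>hat k + \<mu>) * (1 / (\<phi>hat k + \<mu>)) \<le> 1 / \<mu> * (1 / \<mu>)"
      using \<phi>hat_pos[of k] \<mu> pos[of k] by (intro mult_mono divide_left_mono mult_pos_pos) auto
    then have "1 / (\<phi>hat k + \<mu>) * (1 / (\<phi>hat k + \<mu>)) * (?b k / \<phi>hat k)
        \<le> 1 / \<mu> * (1 / \<mu>) * (?b k / \<phi>hat k)"
      using block_self_nonneg \<phi>hat_pos[of k] by (intro mult_right_mono divide_nonneg_pos) auto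
    moreover have "0 \<le> 1 / (\<phi>hat k + \<mu>) * (1 / (\<phi>hat k + \<mu>)) * (?b k / \<phi>hat k)"
      using block_self_nonneg \<phi>hat_pos[of k] pos[of k]
          by (intro mult_nonneg_nonneg divide_nonneg_pos) auto
    moreover have "1 / (\<phi>hat k + \<mu>) * (1 / (\<phi>hat k + \<mu>) * ?b k) / \<phi>hat k
        = 1 / (\<phi>hat k + \<mu>) * (1 / (\<phi>hat k + \<mu>)) * (?b k / \<phi>hat k)"
      "1 / \<mu>\<^sup>2 = 1 / \<mu> * (1 / \<mu>)"
      by (simp_all add: power2_eq_square)
    ultimately show "norm (1 / (\<phi>hat k + \<mu>) * (1 / (\<phi>hat k + \<mu>) * ?b k) / \<phi>hat k)
        \<le> 1 / \<mu>\<^sup>2 * (?b k / \<phi>hat k)"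
      by (simp only: real_norm_def abs_of_nonneg)
  qed
  show f: "synth a \<in> H" by (rule synth_in_H[OF a])
  show "shifted_op (integral_op \<phi>) \<mu> (synth a) = g"
  proof (rule H_eqI[OF shifted_op_in_H[OF accretive_integral_op f] g])
    fix k l assume l: "l \<in> {1..harmonic_dim TYPE('a) k}"
    have "hat (shifted_op (integral_op \<phi>) \<mu> (synth a)) k l
        = hat (integral_op \<phi> (synth a)) k l + \<mu> * hat (synth a) k l"
      using H_lincomb(2)[OF integral_op_in_H[OF f] f l, of 1 \<mu>] by (simp add: shifted_op_def)
    also have "\<dots> = (\<phi>hat k + \<mu>) * a k l"
      unfolding harmonic_coeff_integral_op[OF f l] harmonic_coeff_synth[OF a l]
          by (simp add: algebra_simps)
    also have "\<dots> = hat g k l" using pos[of k] by (simp add: a_def)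
    finally show "hat (shifted_op (integral_op \<phi>) \<mu> (synth a)) k l = hat g k l" .
  qed
qed

lemma native_norm_minus: "nnorm (\<lambda>x. f x - g x) = nnorm (\<lambda>x. g x - f x)"
proof -
  have "hat (\<lambda>x. f x - g x) k l = - hat (\<lambda>x. g x - f x) k l" for k l
    unfolding harmonic_coeff_def by (subst Bochner_Integration.integral_minus[symmetric])
        (simp add: algebra_simps)
  then show ?thesis by (simp add: native_norm_def)
qed

section \<open>The empirical operator and the inverse of its shift\<close>

lemma empirical_op_Suc:
  "empirical_op \<phi> (Suc N) w X f x = empirical_op \<phi> N w X f x + w (Suc N) * f (X (Suc N)) * kernel_at
      (X (Suc N)) x"
  by (simp add: empirical_op_def sphere_restrict_def kernel_at_def)

lemma empirical_op_props:
  assumes "\<And>i. i \<in> {1..N} \<Longrightarrow> norm (X i) = 1"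
  shows "f \<in> H \<Longrightarrow> empirical_op \<phi> N w X f \<in> H"
    and "f \<in> H \<Longrightarrow> g \<in> H \<Longrightarrow> nip (empirical_op \<phi> N w X f) g = (\<Sum>i=1..N. w i * (f (X i) * g (X i)))"
proof -
  have "empirical_op \<phi> N w X f \<in> H \<and> (\<forall>g\<in>H. nip (empirical_op \<phi> N w X f) g
      = (\<Sum>i=1..N. w i * (f (X i) * g (X i))))"
    if f: "f \<in> H" for f
    using assms
  proof (induction N)
    case 0
    have "empirical_op \<phi> 0 w X f = (\<lambda>_. 0)" by (simp add: empirical_op_def sphere_restrict_def
        fun_eq_iff)
    then show ?case using H_zero by (simp add: nip_def block_def harmonic_coeff_def)
  next
    case (Suc N)
    then have IH: "empirical_op \<phi> N w X f \<in> H"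
      "\<And>g. g \<in> H \<Longrightarrow> nip (empirical_op \<phi> N w X f) g = (\<Sum>i=1..N. w i * (f (X i) * g (X i)))" by auto
    have x: "norm (X (Suc N)) = 1" using Suc.prems by simp
    note k = kernel_at_in_H[OF x]
    have eq: "empirical_op \<phi> (Suc N) w X f
        = (\<lambda>x. 1 * empirical_op \<phi> N w X f x + (w (Suc N) * f (X (Suc N))) * kernel_at (X
        (Suc N)) x)"
      by (simp add: fun_eq_iff empirical_op_Suc)
    have "nip (empirical_op \<phi> (Suc N) w X f) g = (\<Sum>i=1..Suc N. w i * (f (X i) * g (X i)))" if g: "g
        \<in> H" for g
      unfolding eq nip_lincomb[OF IH(1) k g] IH(2)[OF g] nip_commute[of "kernel_at (X
          (Suc N))"] reproducing[OF g x]
      by simp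
    moreover have "empirical_op \<phi> (Suc N) w X f \<in> H"
      unfolding eq by (rule H_lincomb(1)[OF IH(1) k])
    ultimately show ?case by blast
  qed
  then show "f \<in> H \<Longrightarrow> empirical_op \<phi> N w X f \<in> H"
    and "f \<in> H \<Longrightarrow> g \<in> H \<Longrightarrow> nip (empirical_op \<phi> N w X f) g = (\<Sum>i=1..N. w i * (f (X i) * g (X i)))"
        by auto
qed

lemma accretive_empirical_op:
  assumes "\<And>i. i \<in> {1..N} \<Longrightarrow> norm (X i) = 1" "\<And>i. i \<in> {1..N} \<Longrightarrow> w i \<ge> 0"
  shows "accretive (empirical_op \<phi> N w X)"
  unfolding accretive_def
proof (intro conjI ballI allI)
  fix f assume f: "f \<in> H"
  show "empirical_op \<phi> N w X f \<in> H" by (rule empirical_op_props(1)[OF assms(1) f])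
  have "nip (empirical_op \<phi> N w X f) f = (\<Sum>i=1..N. w i * (f (X i) * f (X i)))"
    by (rule empirical_op_props(2)[OF assms(1) f f])
  also have "\<dots> \<ge> 0" by (intro sum_nonneg mult_nonneg_nonneg assms(2) zero_le_square)
  finally show "nip (empirical_op \<phi> N w X f) f \<ge> 0" .
next
  fix f g c d
  show "empirical_op \<phi> N w X (\<lambda>x. c * f x + d * g x)
      = (\<lambda>x. c * empirical_op \<phi> N w X f x + d * empirical_op \<phi> N w X g x)"
    by (simp add: empirical_op_def sphere_restrict_def fun_eq_iff sum_distrib_left
        sum.distrib[symmetric] algebra_simps)
qed

text \<open>Sherman--Morrison: nodes are added one at a time.\<close>

lemma empirical_op_surj:
  assumes \<mu>: "\<mu> > 0"
    and "\<And>i. i \<in> {1..N} \<Longrightarrow> norm (X i) = 1" "\<And>i. i \<in> {1..N} \<Longrightarrow> w i \<ge> 0" and "g \<in> H"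
  shows "\<exists>f\<in>H. shifted_op (empirical_op \<phi> N w X) \<mu> f = g"
  using assms(2-4)
proof (induction N arbitrary: g)
  case 0
  have "(\<lambda>x. (1 / \<mu>) * g x + 0 * g x) \<in> H" by (rule H_lincomb(1)[OF 0(3) 0(3)])
  moreover have "shifted_op (empirical_op \<phi> 0 w X) \<mu> (\<lambda>x. (1 / \<mu>) * g x + 0 * g x) = g"
    using \<mu> by (simp add: shifted_op_def empirical_op_def sphere_restrict_def fun_eq_iff)
  ultimately show ?case by blast
next
  case (Suc N)
  let ?B = "shifted_op (empirical_op \<phi> N w X) \<mu>"
  let ?x = "X (Suc N)"
  have x: "norm ?x = 1" and w: "w (Suc N) \<ge> 0" using Suc.prems by auto
  have acc: "accretive (empirical_op \<phi> N w X)" using Suc.prems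
      by (intro accretive_empirical_op) auto
  obtain p where p: "p \<in> H" "?B p = g" using Suc.IH[of g] Suc.prems by auto
  obtain q where q: "q \<in> H" "?B q = kernel_at ?x"
    using Suc.IH[of "kernel_at ?x"] Suc.prems kernel_at_in_H[OF x] by auto
  \<comment> \<open>The reproducing property turns coercivity at \<open>q\<close> into nonnegativity
    of \<open>q ?x\<close>, which keeps the denominator of \<open>c\<close> positive.\<close>
  have "q ?x = nip (?B q) q" using reproducing[OF q(1) x] q(2) by (simp add: nip_commute)
  moreover have "0 \<le> \<mu> * nip q q" using \<mu> nip_self_nonneg[OF q(1)] by simp
  ultimately have qx: "q ?x \<ge> 0" using shifted_op_coercive(1)[OF acc q(1) \<mu>] by linarith
  \<comment> \<open>The multiple of \<open>q\<close> to subtract from \<open>p\<close>: it makes the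
    contribution of the new node to \<open>p - c * q\<close> equal to \<open>c\<close> times the
    kernel.\<close>
  define c where "c = w (Suc N) * p ?x / (1 + w (Suc N) * q ?x)"
  have "1 + w (Suc N) * q ?x > 0" using w qx by (simp add: add_pos_nonneg)
  then have c: "w (Suc N) * (p ?x - c * q ?x) = c" by (simp add: c_def field_simps)
  define f where "f = (\<lambda>x. 1 * p x + (- c) * q x)"
  have f: "f \<in> H" unfolding f_def by (rule H_lincomb(1)[OF p(1) q(1)])
  have "shifted_op (empirical_op \<phi> (Suc N) w X) \<mu> f y = g y" for y
  proof -
    have "shifted_op (empirical_op \<phi> (Suc N) w X) \<mu> f y
        = ?B f y + (w (Suc N) * f ?x) * kernel_at ?x y"
      by (simp add: shifted_op_def empirical_op_Suc)
    also have "?B f y = g y - c * kernel_at ?x y"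
      unfolding f_def shifted_op_lincomb[OF acc p(1) q(1)] p(2) q(2) by simp
    also have "w (Suc N) * f ?x = c" using c by (simp add: f_def)
    finally show ?thesis by simp
  qed
  then show ?case using f by blast
qed

end

text \<open>In the application \<open>\<eta>\<close> and \<open>\<tau>\<close> are constants times
  \<open>s powr (-2 * \<gamma>)\<close>. The bound \<open>high\<close> is imposed uniformly on
  finite ranges of degrees, so no infinite sum of energies has to be formed.\<close>

locale native_quadrature = native_rkhs Y \<phi> \<phi>hat B + quadrature Y s N w X
  for Y :: "nat \<Rightarrow> nat \<Rightarrow> 'a::euclidean_space \<Rightarrow> real" and \<phi> \<phi>hat B s N w X +
  fixes \<eta> \<tau> :: real
  assumes \<eta>: "\<eta> > 0"
    and high: "\<And>K c. (\<Sum>k\<in>{s div 2<..K}. \<phi>hat k * energy k c) \<le> \<eta> * wnorm2 c"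
    and \<tau>: "\<And>k. k > s div 2 \<Longrightarrow> \<phi>hat k \<le> \<tau>"
begin

definition low_part :: "('a \<Rightarrow> real) \<Rightarrow> nat \<Rightarrow> real" where
  "low_part f i = (\<Sum>k\<le>s div 2. block Y (hat f) (\<lambda>k l. Y k l (X i)) k)"

definition high_part :: "('a \<Rightarrow> real) \<Rightarrow> nat \<Rightarrow> real" where
  "high_part f i = f (X i) - low_part f i"

lemma low_part_inner:
  "(\<Sum>i=1..N. w i * (low_part f i * low_part g i)) = (\<Sum>k\<le>s div 2. block Y (hat f) (hat g) k)"
proof -
  have lp: "low_part f i = (\<Sum>p\<in>low (s div 2). hat f (fst p) (snd p) * Y (fst p) (snd p) (X i))"
      for f i
    unfolding low_part_def block_def by (rule sum_low[symmetric])
  have "(\<Sum>i=1..N. w i * (low_part f i * low_part g i))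
      = (\<Sum>p\<in>low (s div 2). hat f (fst p) (snd p) * hat g (fst p) (snd p))"
    unfolding lp by (rule quadrature_low_exact) simp
  also have "\<dots> = (\<Sum>k\<le>s div 2. block Y (hat f) (hat g) k)"
    unfolding block_def by (rule sum_low)
  finally show ?thesis .
qed

lemma wnorm2_low_part:
  assumes f: "f \<in> H"
  shows "wnorm2 (low_part f) \<le> B * (nnorm f)\<^sup>2"
proof -
  let ?b = "\<lambda>k. block Y (hat f) (hat f) k"
  have "wnorm2 (low_part f) = (\<Sum>k\<le>s div 2. ?b k)"
    using low_part_inner[of f f] by (simp add: wnorm2_def power2_eq_square)
  also have "\<dots> \<le> (\<Sum>k\<le>s div 2. B * (?b k / \<phi>hat k))"
  proof (rule sum_mono)
    fix k
    have "?b k = \<phi>hat k * (?b k / \<phi>hat k)" using \<phi>hat_pos[of k] by simp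
    also have "\<dots> \<le> B * (?b k / \<phi>hat k)"
      using bounded[of k] block_self_nonneg \<phi>hat_pos[of k]
          by (intro mult_right_mono divide_nonneg_pos) auto
    finally show "?b k \<le> B * (?b k / \<phi>hat k)" .
  qed
  also have "\<dots> = B * (\<Sum>k\<le>s div 2. ?b k / \<phi>hat k)" by (simp add: sum_distrib_left)
  also have "\<dots> \<le> B * nip f f"
    unfolding nip_def using B_pos summable_nip(2)[OF f f]
    by (intro mult_left_mono sum_le_suminf) (auto intro!: divide_nonneg_pos block_self_nonneg
        \<phi>hat_pos)
  finally show ?thesis by (simp add: native_norm_sq[OF f])
qed

text \<open>Dual to \<open>high\<close>. Pairing the truncated samples \<open>c\<close> with
  themselves moves the sum over the nodes onto the coefficients of their point measure; the
  arithmetic-geometric mean inequality leaves half of \<open>\<eta> * nip f f\<close> plus half of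
  \<open>wnorm2 c\<close>, and the latter is absorbed on the left.\<close>

lemma wnorm2_high_part:
  assumes f: "f \<in> H"
  shows "wnorm2 (high_part f) \<le> \<eta> * (nnorm f)\<^sup>2"
proof -
  define a where "a = hat f"
  define m where "m = s div 2"
  \<comment> \<open>Truncation at \<open>K\<close> keeps every exchange of sums finite; pointwise
    convergence at the finitely many nodes removes it at the end.\<close>
  define c where "c K i = (\<Sum>k\<in>{m<..K}. block Y a (\<lambda>k l. Y k l (X i)) k)" for K i
  have bound: "wnorm2 (c K) \<le> \<eta> * nip f f" for K
  proof -
    define v where "v k l = (\<Sum>i=1..N. w i * c K i * Y k l (X i))" for k l
    have vv: "block Y v v k = energy k (c K)" for k
      by (simp add: block_def energy_def v_def power2_eq_square)
    have "wnorm2 (c K) = (\<Sum>i=1..N. w i * c K i * c K i)"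
      by (simp add: wnorm2_def power2_eq_square mult.assoc)
    also have "\<dots> = (\<Sum>i=1..N. \<Sum>k\<in>{m<..K}. \<Sum>l=1..harmonic_dim TYPE('a) k. a k l * (w i * c K i * Y k l
        (X i)))"
    proof (rule sum.cong[OF refl])
      fix i
      have "w i * c K i * c K i = w i * c K i * (\<Sum>k\<in>{m<..K}. \<Sum>l=1..harmonic_dim TYPE('a) k. a k l
          * Y k l (X i))"
        by (simp only: c_def[of K i] block_def)
      then show "w i * c K i * c K i = (\<Sum>k\<in>{m<..K}. \<Sum>l=1..harmonic_dim TYPE('a) k. a k l * (w i
          * c K i * Y k l (X i)))"
        by (simp only: sum_distrib_left mult_ac)
    qed
    also have "\<dots> = (\<Sum>k\<in>{m<..K}. \<Sum>i=1..N. \<Sum>l=1..harmonic_dim TYPE('a) k. a k l * (w i * c K i * Y k l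
        (X i)))"
      by (rule sum.swap)
    also have "\<dots> = (\<Sum>k\<in>{m<..K}. \<Sum>l=1..harmonic_dim TYPE('a) k. \<Sum>i=1..N. a k l * (w i * c K i * Y k l
        (X i)))"
      by (intro sum.cong refl sum.swap)
    also have "\<dots> = (\<Sum>k\<in>{m<..K}. block Y a v k)"
      by (simp only: block_def v_def sum_distrib_left)
    also have "\<dots> \<le> (\<Sum>k\<in>{m<..K}. (\<eta> * (block Y a a k / \<phi>hat k) + \<phi>hat k * energy k (c K) / \<eta>) / 2)"
    proof (rule sum_mono)
      fix k
      have "\<eta> / \<phi>hat k > 0" using \<eta> \<phi>hat_pos[of k] by simp
      from block_am_gm[OF this, of Y a v k]
      show "block Y a v k \<le> (\<eta> * (block Y a a k / \<phi>hat k) + \<phi>hat k * energy k (c K) / \<eta>) / 2"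
        unfolding vv by (simp add: mult_ac)
    qed
    also have "\<dots> = (\<eta> * (\<Sum>k\<in>{m<..K}. block Y a a k / \<phi>hat k) + (\<Sum>k\<in>{m<..K}. \<phi>hat k * energy k (c K))
        / \<eta>) / 2"
      by (simp only: sum_divide_distrib sum.distrib sum_distrib_left add_divide_distrib)
    also have "\<dots> \<le> (\<eta> * nip f f + wnorm2 (c K)) / 2"
    proof -
      have "(\<Sum>k\<in>{m<..K}. block Y a a k / \<phi>hat k) \<le> nip f f"
        unfolding nip_def a_def using summable_nip(2)[OF f f]
        by (intro sum_le_suminf) (auto intro!: divide_nonneg_pos block_self_nonneg \<phi>hat_pos)
      then have "\<eta> * (\<Sum>k\<in>{m<..K}. block Y a a k / \<phi>hat k) \<le> \<eta> * nip f f" using \<eta> by simp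
      moreover have "(\<Sum>k\<in>{m<..K}. \<phi>hat k * energy k (c K)) / \<eta> \<le> wnorm2 (c K)"
        using high[where K = K and c = "c K"] \<eta> by (simp add: m_def divide_le_eq mult.commute)
      ultimately show ?thesis by (intro divide_right_mono add_mono) auto
    qed
    finally show ?thesis by simp
  qed
  have lim: "(\<lambda>K. c K i) \<longlonglongrightarrow> high_part f i" if i: "i \<in> {1..N}" for i
  proof -
    define t where "t k = block Y a (\<lambda>k l. Y k l (X i)) k" for k
    have "(\<lambda>K. \<Sum>k<K. t k) \<longlonglongrightarrow> f (X i)"
      using H_sums[OF f X_sphere[OF i]] by (simp add: sums_def t_def a_def)
    then have "(\<lambda>K. (\<Sum>k<Suc K. t k) - low_part f i) \<longlonglongrightarrow> f (X i) - low_part f i"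
      by (intro tendsto_diff tendsto_const LIMSEQ_Suc)
    moreover have "\<forall>\<^sub>F K in sequentially. (\<Sum>k<Suc K. t k) - low_part f i = c K i"
    proof (rule eventually_sequentiallyI[of m])
      fix K assume "m \<le> K"
      then have split: "{..<Suc K} = {..m} \<union> {m<..K}" by auto
      have "(\<Sum>k<Suc K. t k) = (\<Sum>k\<le>m. t k) + (\<Sum>k\<in>{m<..K}. t k)"
        unfolding split by (rule sum.union_disjoint) auto
      then show "(\<Sum>k<Suc K. t k) - low_part f i = c K i"
        by (simp add: low_part_def c_def t_def a_def m_def)
    qed
    ultimately show ?thesis unfolding high_part_def by (rule Lim_transform_eventually)
  qed
  have "(\<lambda>K. wnorm2 (c K)) \<longlonglongrightarrow> wnorm2 (high_part f)"
    unfolding wnorm2_def by (intro tendsto_sum tendsto_mult tendsto_const tendsto_power lim)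
  then have "wnorm2 (high_part f) \<le> \<eta> * nip f f"
    by (rule LIMSEQ_le_const2) (use bound in blast)
  then show ?thesis by (simp add: native_norm_sq[OF f])
qed

lemma wsum_Cauchy_Schwarz:
  "\<bar>\<Sum>i=1..N. w i * (u i * v i)\<bar> \<le> sqrt (wnorm2 u) * sqrt (wnorm2 v)"
proof -
  have sq: "(\<Sum>i=1..N. (sqrt (w i) * u i)\<^sup>2) = wnorm2 u" for u
    unfolding wnorm2_def using w_nonneg by (intro sum.cong) (auto simp: power_mult_distrib)
  have prod: "(\<Sum>i=1..N. (sqrt (w i) * u i) * (sqrt (w i) * v i)) = (\<Sum>i=1..N. w i * (u i * v i))"
  proof (rule sum.cong[OF refl])
    fix i assume "i \<in> {1..N}"
    have "(sqrt (w i) * u i) * (sqrt (w i) * v i) = (sqrt (w i) * sqrt (w i)) * (u i * v i)"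
        by (simp only: mult_ac)
    also have "sqrt (w i) * sqrt (w i) = w i" by (simp add: w_nonneg[OF \<open>i \<in> {1..N}\<close>])
    finally show "(sqrt (w i) * u i) * (sqrt (w i) * v i) = w i * (u i * v i)" .
  qed
  have "(\<Sum>i=1..N. w i * (u i * v i))\<^sup>2 \<le> wnorm2 u * wnorm2 v"
    using Cauchy_Schwarz_ineq_sum[of "\<lambda>i. sqrt (w i) * u i" "\<lambda>i. sqrt (w i) * v i" "{1..N}"]
    unfolding sq prod .
  from real_sqrt_le_mono[OF this] show ?thesis by (simp add: real_sqrt_mult)
qed

text \<open>The product of the low parts reproduces the degrees up to \<open>s / 2\<close> of the
  integral. What remains is the tail of the integral, giving \<open>\<tau>\<close>, two mixed
  products, giving \<open>sqrt (B * \<eta>)\<close> each, and the product of the high parts, giving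
  \<open>\<eta>\<close>.\<close>

lemma quadrature_error:
  assumes f: "f \<in> H" and g: "g \<in> H"
  shows "\<bar>(\<Sum>k. block Y (hat f) (hat g) k) - (\<Sum>i=1..N. w i * (f (X i) * g (X i)))\<bar>
    \<le> (\<tau> + 2 * sqrt (B * \<eta>) + \<eta>) * (nnorm f * nnorm g)"
proof -
  define b where "b k = block Y (hat f) (hat g) k" for k
  define m where "m = s div 2"
  define r where "r k = (if k \<le> m then 0 else b k)" for k
  define S where "S u v = (\<Sum>i=1..N. w i * (u i * v i))" for u v :: "nat \<Rightarrow> real"
  have n: "nnorm f \<ge> 0" "nnorm g \<ge> 0" using native_norm_nonneg f g by auto
  have \<tau>0: "\<tau> \<ge> 0" using \<tau>[of "Suc (s div 2)"] \<phi>hat_pos[of "Suc (s div 2)"] by simp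
  have rb: "\<bar>r k\<bar> \<le> \<tau> * (\<bar>b k\<bar> / \<phi>hat k)" for k
  proof (cases "k \<le> m")
    case False
    have "\<bar>b k\<bar> = \<phi>hat k * (\<bar>b k\<bar> / \<phi>hat k)" using \<phi>hat_pos[of k] by simp
    also have "\<dots> \<le> \<tau> * (\<bar>b k\<bar> / \<phi>hat k)"
      using \<tau>[of k] False \<phi>hat_pos[of k] by (intro mult_right_mono) (auto simp: m_def)
    finally show ?thesis using False by (simp add: r_def)
  qed (use \<tau>0 \<phi>hat_pos[of k] in \<open>simp add: r_def\<close>)
  have sb: "summable (\<lambda>k. \<tau> * (\<bar>b k\<bar> / \<phi>hat k))"
    unfolding b_def by (intro summable_mult summable_nip(1) f g)
  have sr: "summable (\<lambda>k. \<bar>r k\<bar>)"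
    by (rule summable_comparison_test'[OF sb]) (use rb in simp)
  have "\<bar>suminf r\<bar> \<le> (\<Sum>k. \<bar>r k\<bar>)" by (rule summable_rabs[OF sr])
  also have "\<dots> \<le> (\<Sum>k. \<tau> * (\<bar>b k\<bar> / \<phi>hat k))" by (intro suminf_le rb sr sb)
  also have "\<dots> = \<tau> * (\<Sum>k. \<bar>b k\<bar> / \<phi>hat k)"
    unfolding b_def by (rule suminf_mult[OF summable_nip(1)[OF f g]])
  also have "\<dots> \<le> \<tau> * (nnorm f * nnorm g)"
    unfolding b_def by (intro mult_left_mono nip_abs_Cauchy_Schwarz f g \<tau>0)
  finally have tail: "\<bar>suminf r\<bar> \<le> \<tau> * (nnorm f * nnorm g)" .
  have "(\<lambda>k. (if k \<in> {..m} then b k else 0) + r k) sums ((\<Sum>k\<le>m. b k) + suminf r)"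
    by (intro sums_add sums_If_finite_set summable_sums summable_rabs_cancel[OF sr]) simp
  moreover have "(\<lambda>k. (if k \<in> {..m} then b k else 0) + r k) = b" by (auto simp: r_def)
  ultimately have split: "suminf b = (\<Sum>k\<le>m. b k) + suminf r" by (simp add: sums_iff)
  have "(\<Sum>i=1..N. w i * (f (X i) * g (X i)))
      = (\<Sum>i=1..N. w i * (low_part f i * low_part g i) + w i * (low_part f i * high_part g i)
          + w i * (high_part f i * low_part g i) + w i * (high_part f i * high_part g i))"
    by (intro sum.cong refl) (simp add: high_part_def algebra_simps)
  also have "\<dots> = S (low_part f) (low_part g) + S (low_part f) (high_part g) + S (high_part f)
      (low_part g) + S (high_part f) (high_part g)"
    by (simp add: S_def sum.distrib)
  also have "S (low_part f) (low_part g) = (\<Sum>k\<le>m. b k)"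
    unfolding S_def low_part_inner m_def b_def ..
  finally have "suminf b - (\<Sum>i=1..N. w i * (f (X i) * g (X i)))
      = suminf r - S (low_part f) (high_part g) - S (high_part f) (low_part g) - S (high_part f)
      (high_part g)"
    using split by simp
  moreover have lo: "sqrt (wnorm2 (low_part h)) \<le> sqrt B * nnorm h"
      and hi: "sqrt (wnorm2 (high_part h)) \<le> sqrt \<eta> * nnorm h" if "h \<in> H" for h
    using real_sqrt_le_mono[OF wnorm2_low_part[OF that]] real_sqrt_le_mono[OF wnorm2_high_part[OF
        that]] native_norm_nonneg[OF that]
    by (simp_all add: real_sqrt_mult)
  have sq: "sqrt (wnorm2 u) \<ge> 0" for u using wnorm2_nonneg by simp
  have "\<bar>S (low_part f) (high_part g)\<bar> \<le> (sqrt B * nnorm f) * (sqrt \<eta> * nnorm g)"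
    unfolding S_def using B_pos n
    by (intro order.trans[OF wsum_Cauchy_Schwarz] mult_mono lo hi f g sq mult_nonneg_nonneg) auto
  moreover have "\<bar>S (high_part f) (low_part g)\<bar> \<le> (sqrt \<eta> * nnorm f) * (sqrt B * nnorm g)"
    unfolding S_def using \<eta> n
    by (intro order.trans[OF wsum_Cauchy_Schwarz] mult_mono lo hi f g sq mult_nonneg_nonneg) auto
  moreover have "\<bar>S (high_part f) (high_part g)\<bar> \<le> (sqrt \<eta> * nnorm f) * (sqrt \<eta> * nnorm g)"
    unfolding S_def using \<eta> n
    by (intro order.trans[OF wsum_Cauchy_Schwarz] mult_mono lo hi f g sq mult_nonneg_nonneg) auto
  ultimately have "\<bar>suminf b - (\<Sum>i=1..N. w i * (f (X i) * g (X i)))\<bar>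
      \<le> \<tau> * (nnorm f * nnorm g) + (sqrt B * nnorm f) * (sqrt \<eta> * nnorm g) + (sqrt \<eta> * nnorm f) *
      (sqrt B * nnorm g) + (sqrt \<eta> * nnorm f) * (sqrt \<eta> * nnorm g)"
    using tail by linarith
  also have "\<dots> = (\<tau> + 2 * (sqrt B * sqrt \<eta>) + sqrt \<eta> * sqrt \<eta>) * (nnorm f * nnorm g)"
    by (simp add: algebra_simps)
  also have "\<dots> = (\<tau> + 2 * sqrt (B * \<eta>) + \<eta>) * (nnorm f * nnorm g)"
    using \<eta> by (simp add: real_sqrt_mult)
  finally show ?thesis by (simp add: b_def[abs_def])
qed

text \<open>The norm is obtained by testing the quadrature error with the difference itself in the
  place of \<open>g\<close>.\<close>

lemma operator_difference:
  assumes f: "f \<in> H"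
  shows "nnorm (\<lambda>x. integral_op \<phi> f x - empirical_op \<phi> N w X f x)
    \<le> (\<tau> + 2 * sqrt (B * \<eta>) + \<eta>) * nnorm f"
proof -
  define T where "T = (\<lambda>x. 1 * integral_op \<phi> f x + (-1) * empirical_op \<phi> N w X f x)"
  note E = empirical_op_props[where N = N and X = X and w = w, OF X_sphere]
  note L = integral_op_in_H[OF f]
  have T: "T \<in> H" unfolding T_def by (rule H_lincomb(1)[OF L E(1)[OF _ f]])
  have "(nnorm T)\<^sup>2 = nip T T" by (rule native_norm_sq[OF T])
  also have "nip T T = 1 * nip (integral_op \<phi> f) T + (-1) * nip (empirical_op \<phi> N w X f) T"
    by (subst (1) T_def, rule nip_lincomb[OF L E(1)[OF _ f] T])
  also have "\<dots> = (\<Sum>k. block Y (hat f) (hat T) k) - (\<Sum>i=1..N. w i * (f (X i) * T (X i)))"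
    using nip_integral_op[OF f, of T] E(2)[OF _ f T] by simp
  also have "\<dots> \<le> (\<tau> + 2 * sqrt (B * \<eta>) + \<eta>) * (nnorm f * nnorm T)"
    using quadrature_error[OF f T] by linarith
  finally have "nnorm T * nnorm T \<le> ((\<tau> + 2 * sqrt (B * \<eta>) + \<eta>) * nnorm f) * nnorm T"
    by (simp add: power2_eq_square mult.assoc)
  moreover have "(\<tau> + 2 * sqrt (B * \<eta>) + \<eta>) * nnorm f \<ge> 0"
    using \<eta> B_pos \<tau>[of "Suc (s div 2)"] \<phi>hat_pos[of "Suc (s div 2)"] native_norm_nonneg[OF f]
    by (intro mult_nonneg_nonneg add_nonneg_nonneg) auto
  ultimately have "nnorm T \<le> (\<tau> + 2 * sqrt (B * \<eta>) + \<eta>) * nnorm f"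
    using native_norm_nonneg[OF T] by (cases "nnorm T = 0") (auto simp: mult_le_cancel_right)
  then show ?thesis by (simp add: T_def)
qed

end

section \<open>Choice of the constant and the two resolvent bounds\<close>

theorem proposition4:
  fixes \<phi> :: "real \<Rightarrow> real" and \<phi>hat :: "nat \<Rightarrow> real" and \<gamma> v :: real and d :: nat
  assumes dim: "DIM('a::euclidean_space) = d + 1" "d \<ge> 1"
    and v: "0 \<le> v" "v \<le> 1 / 2"
    and posdef: "positive_definite_function TYPE('a) \<phi> \<phi>hat"
    and \<gamma>: "\<gamma> > real d / 2"
    and decay: "\<exists>c1>0. \<exists>c2>0. \<forall>k\<ge>1. c1 * real k powr (- 2 * \<gamma>) \<le> \<phi>hat k
                                     \<and> \<phi>hat k \<le> c2 * real k powr (- 2 * \<gamma>)"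
  shows "\<exists>c>0. \<forall>(Y :: nat \<Rightarrow> nat \<Rightarrow> 'a \<Rightarrow> real) (\<mu>::real) (s::nat) (N::nat)
           (w :: nat \<Rightarrow> real) (X :: nat \<Rightarrow> 'a).
         harmonic_orthonormal_basis Y \<longrightarrow> 0 < \<mu> \<longrightarrow> \<mu> < 1 \<longrightarrow> s \<ge> 1 \<longrightarrow>
         positive_quadrature_rule s N w X \<longrightarrow>
         (let H = native_space Y \<phi>hat;
              A = shifted_op (integral_op \<phi>) \<mu>;
              B = shifted_op (empirical_op \<phi> N w X) \<mu>
          in bij_betw A H H \<and> bij_betw B H H \<and>
             native_onorm Y \<phi>hat (inv_into H A \<circ> B)
               \<le> ereal (c * (\<mu> powr (-1) * real s powr (- \<gamma>)
                             + \<mu> powr (-1 + v) * real s powr (- (1 - v) * \<gamma>)) + 1) \<and>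
             native_onorm Y \<phi>hat (inv_into H B \<circ> A)
               \<le> ereal (2 * c\<^sup>2 * \<mu> powr (-2 + 2 * v) * real s powr (- 2 * (1 - v) * \<gamma>)
                        + 2 * c\<^sup>2 * \<mu> powr (-2) * real s powr (- 2 * \<gamma>)
                        + c * \<mu> powr (-1 + v) * real s powr (- (1 - v) * \<gamma>)
                        + c * \<mu> powr (-1) * real s powr (- \<gamma>) + 1))"
proof -
  obtain c2 where c2: "c2 > 0" "\<And>k. k \<ge> 1 \<Longrightarrow> \<phi>hat k \<le> c2 * real k powr (- 2 * \<gamma>)"
    using decay by blast
  have pos: "\<phi>hat k > 0" for k
    using posdef by (auto simp: positive_definite_function_def)
  have g: "\<gamma> > 0" using \<gamma> by (smt (verit) divide_nonneg_nonneg of_nat_0_le_iff)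
  \<comment> \<open>The decay assumption starts at \<open>k = 1\<close>, so
    \<open>\<phi>hat 0\<close> enters separately.\<close>
  define B where "B = max (\<phi>hat 0) c2"
  have B: "B > 0" using c2 by (simp add: B_def)
  have bounded: "\<phi>hat k \<le> B" for k
  proof (cases "k = 0")
    case False
    then have "real k powr (- 2 * \<gamma>) \<le> 1 powr (- 2 * \<gamma>)" using g by (intro powr_mono2') auto
    then have "c2 * real k powr (- 2 * \<gamma>) \<le> c2 * 1" using c2(1) by (intro mult_left_mono) auto
    then show ?thesis using c2(2)[of k] False by (simp add: B_def)
  qed (simp add: B_def)
  define C where "C = c2 * mz_const d * 2 powr (2 * \<gamma> + real d) / (1 - 2 powr (real d - 2 * \<gamma>))"
  have "2 powr (real d - 2 * \<gamma>) < (1::real)"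
    using \<gamma> powr_less_mono[of "real d - 2 * \<gamma>" 0 2] by simp
  then have C: "C > 0" unfolding C_def using c2(1) mz_const_pos[of d]
      by (intro divide_pos_pos mult_pos_pos) auto
  \<comment> \<open>The error is this expression with \<open>q = s powr (-2 * \<gamma>)\<close>
    multiplied to \<open>2 powr (2 * \<gamma>)\<close> and to \<open>C\<close>. The square root
    contributes exactly \<open>s powr (- \<gamma>)\<close>, and \<open>q\<close> is at most that for
    \<open>s \<ge> 1\<close>. The constant is fixed before the basis, \<open>\<mu>\<close>,
    \<open>s\<close> and the rule.\<close>
  define c where "c = c2 * 2 powr (2 * \<gamma>) + 2 * sqrt (B * C) + C"
  have c: "c > 0" unfolding c_def using c2(1) B C by (intro add_nonneg_pos) auto
  show ?thesis
  proof (intro exI[of _ c] conjI c allI impI)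
    fix Y :: "nat \<Rightarrow> nat \<Rightarrow> 'a \<Rightarrow> real" and \<mu> :: real and s N :: nat and w and X :: "nat \<Rightarrow> 'a"
    assume Y: "harmonic_orthonormal_basis Y" and \<mu>: "0 < \<mu>" "\<mu> < 1" and s: "s \<ge> 1"
      and quad: "positive_quadrature_rule s N w X"
    define q where "q = real s powr (- 2 * \<gamma>)"
    have q: "q > 0" using s by (simp add: q_def)
    interpret quadrature Y s N w X
      using dim Y quad by unfold_locales auto
    interpret native_quadrature Y \<phi> \<phi>hat B s N w X "C * q" "c2 * 2 powr (2 * \<gamma>) * q"
    proof unfold_locales
      show "positive_definite_function TYPE('a) \<phi> \<phi>hat" by (rule posdef)
      show "\<phi>hat k \<le> B" for k by (rule bounded)
      show "C * q > 0" using C q by simp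
      show "(\<Sum>k\<in>{s div 2<..K}. \<phi>hat k * energy k c) \<le> C * q * wnorm2 c" for K c
        unfolding C_def q_def
        by (rule high_energy_bound[OF dim(1) s \<gamma> less_imp_le[OF c2(1)] c2(2) less_imp_le[OF pos]])
      show "\<phi>hat k \<le> c2 * 2 powr (2 * \<gamma>) * q" if k: "k > s div 2" for k
      proof -
        have "real s / 2 \<le> real k" using k by linarith
        then have "real k powr (- 2 * \<gamma>) \<le> (real s / 2) powr (- 2 * \<gamma>)"
          using s g by (intro powr_mono2') auto
        also have "\<dots> = 2 powr (2 * \<gamma>) * q"
          by (simp add: q_def powr_divide powr_minus field_simps)
        finally have "c2 * real k powr (- 2 * \<gamma>) \<le> c2 * (2 powr (2 * \<gamma>) * q)"
          using c2(1) by (intro mult_left_mono) auto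
        then show ?thesis using c2(2)[of k] k by simp
      qed
    qed
    define \<epsilon> where "\<epsilon> = c2 * 2 powr (2 * \<gamma>) * q + 2 * sqrt (B * (C * q)) + C * q"
    define p where "p = real s powr (- \<gamma>)"
    have p: "p > 0" using s by (simp add: p_def)
    have qp: "q = p * p" by (simp add: q_def p_def powr_add[symmetric])
    have "p \<le> 1"
      using powr_mono[of "- \<gamma>" 0 "real s"] s g by (simp add: p_def)
    then have qle: "q \<le> p" using p by (simp add: qp mult_left_le)
    have "\<epsilon> \<le> c * p"
    proof -
      have "sqrt (B * (C * q)) = sqrt (B * C) * p"
        using p by (simp add: qp real_sqrt_mult)
      moreover have "c2 * 2 powr (2 * \<gamma>) * q \<le> c2 * 2 powr (2 * \<gamma>) * p" "C * q \<le> C * p"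
        using c2(1) C qle by (auto intro!: mult_left_mono)
      ultimately show ?thesis by (simp add: \<epsilon>_def c_def algebra_simps)
    qed
    then have \<epsilon>\<mu>: "\<epsilon> / \<mu> \<le> c * (\<mu> powr (-1) * p)"
      using \<mu> by (simp add: powr_minus divide_right_mono field_simps)
    have \<epsilon>: "\<epsilon> \<ge> 0" unfolding \<epsilon>_def using c2(1) B C q
        by (intro add_nonneg_nonneg mult_nonneg_nonneg) auto
    have accL: "accretive (integral_op \<phi>)" by (rule accretive_integral_op)
    have accD: "accretive (empirical_op \<phi> N w X)"
        by (rule accretive_empirical_op[OF X_sphere w_nonneg])
    have bijL: "bij_betw (shifted_op (integral_op \<phi>) \<mu>) (native_space Y \<phi>hat) (native_space Y \<phi>hat)"
      by (rule shifted_op_bij[OF accL \<mu>(1) integral_op_surj[OF \<mu>(1)]])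
    have bijD: "bij_betw (shifted_op (empirical_op \<phi> N w X) \<mu>) (native_space Y \<phi>hat)
        (native_space Y \<phi>hat)"
      by (rule shifted_op_bij[OF accD \<mu>(1) empirical_op_surj[OF \<mu>(1) X_sphere w_nonneg]])
    have diff1: "native_norm Y \<phi>hat (\<lambda>x. integral_op \<phi> f x - empirical_op \<phi> N w X f x)
        \<le> \<epsilon> * native_norm Y \<phi>hat f"
      if "f \<in> native_space Y \<phi>hat" for f
      using operator_difference[OF that] by (simp only: \<epsilon>_def)
    have diff2: "native_norm Y \<phi>hat (\<lambda>x. empirical_op \<phi> N w X f x - integral_op \<phi> f x)
        \<le> \<epsilon> * native_norm Y \<phi>hat f"
      if "f \<in> native_space Y \<phi>hat" for f
    proof -
      have "native_norm Y \<phi>hat (\<lambda>x. empirical_op \<phi> N w X f x - integral_op \<phi> f x)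
          = native_norm Y \<phi>hat (\<lambda>x. integral_op \<phi> f x - empirical_op \<phi> N w X f x)"
        by (rule native_norm_minus)
      then show ?thesis using diff1[OF that] by simp
    qed
    have r: "\<mu> powr x \<ge> 0" "real s powr x \<ge> 0" for x by simp_all
    have "native_onorm Y \<phi>hat (inv_into (native_space Y \<phi>hat) (shifted_op
        (integral_op \<phi>) \<mu>) \<circ> shifted_op (empirical_op \<phi> N w X) \<mu>) \<le> ereal (1 + \<epsilon> / \<mu>)"
      by (rule resolvent_perturbation[OF accL accD \<mu>(1) bijL diff2 \<epsilon>])
    also have "\<dots> \<le> ereal (c * (\<mu> powr (-1) * p + \<mu> powr (-1 + v) * real s powr (- (1 - v) * \<gamma>))
        + 1)"
    proof -
      have "0 \<le> c * (\<mu> powr (-1 + v) * real s powr (- (1 - v) * \<gamma>))"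
        using c by (intro mult_nonneg_nonneg r) auto
      then show ?thesis using \<epsilon>\<mu> by (simp add: distrib_left)
    qed
    finally have 1: "native_onorm Y \<phi>hat (inv_into (native_space Y \<phi>hat) (shifted_op
        (integral_op \<phi>) \<mu>) \<circ> shifted_op (empirical_op \<phi> N w X) \<mu>)
      \<le> ereal (c * (\<mu> powr (-1) * p + \<mu> powr (-1 + v) * real s powr (- (1 - v) * \<gamma>)) + 1)" .
    have "native_onorm Y \<phi>hat (inv_into (native_space Y \<phi>hat) (shifted_op
        (empirical_op \<phi> N w X) \<mu>) \<circ> shifted_op (integral_op \<phi>) \<mu>) \<le> ereal (1 + \<epsilon> / \<mu>)"
      by (rule resolvent_perturbation[OF accD accL \<mu>(1) bijD diff1 \<epsilon>])
    also have "\<dots> \<le> ereal (2 * c\<^sup>2 * \<mu> powr (-2 + 2 * v) * real s powr (- 2 * (1 - v) * \<gamma>)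
                        + 2 * c\<^sup>2 * \<mu> powr (-2) * real s powr (- 2 * \<gamma>)
                        + c * \<mu> powr (-1 + v) * real s powr (- (1 - v) * \<gamma>)
                        + c * \<mu> powr (-1) * p + 1)"
    proof -
      have "0 \<le> 2 * c\<^sup>2 * \<mu> powr (-2 + 2 * v) * real s powr (- 2 * (1 - v) * \<gamma>)"
        "0 \<le> 2 * c\<^sup>2 * \<mu> powr (-2) * real s powr (- 2 * \<gamma>)"
        "0 \<le> c * \<mu> powr (-1 + v) * real s powr (- (1 - v) * \<gamma>)"
        using c by (intro mult_nonneg_nonneg r; simp)+
      then show ?thesis using \<epsilon>\<mu> unfolding ereal_less_eq(3) by (simp only: mult.assoc[of c])
    qed
    finally have 2: "native_onorm Y \<phi>hat (inv_into (native_space Y \<phi>hat) (shifted_op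
        (empirical_op \<phi> N w X) \<mu>) \<circ> shifted_op (integral_op \<phi>) \<mu>)
      \<le> ereal (2 * c\<^sup>2 * \<mu> powr (-2 + 2 * v) * real s powr (- 2 * (1 - v) * \<gamma>)
                        + 2 * c\<^sup>2 * \<mu> powr (-2) * real s powr (- 2 * \<gamma>)
                        + c * \<mu> powr (-1 + v) * real s powr (- (1 - v) * \<gamma>)
                        + c * \<mu> powr (-1) * p + 1)" .
    show "let H = native_space Y \<phi>hat;
              A = shifted_op (integral_op \<phi>) \<mu>;
              B = shifted_op (empirical_op \<phi> N w X) \<mu>
          in bij_betw A H H \<and> bij_betw B H H \<and>
             native_onorm Y \<phi>hat (inv_into H A \<circ> B)
               \<le> ereal (c * (\<mu> powr (-1) * real s powr (- \<gamma>)
                             + \<mu> powr (-1 + v) * real s powr (- (1 - v) * \<gamma>)) + 1) \<and>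
             native_onorm Y \<phi>hat (inv_into H B \<circ> A)
               \<le> ereal (2 * c\<^sup>2 * \<mu> powr (-2 + 2 * v) * real s powr (- 2 * (1 - v) * \<gamma>)
                        + 2 * c\<^sup>2 * \<mu> powr (-2) * real s powr (- 2 * \<gamma>)
                        + c * \<mu> powr (-1 + v) * real s powr (- (1 - v) * \<gamma>)
                        + c * \<mu> powr (-1) * real s powr (- \<gamma>) + 1)"
      unfolding Let_def using bijL bijD 1 2 unfolding p_def by blast
  qed
qed

end
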